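(* Let $\{6j\}(l)$ denote the $SU(2)$ $6j$ symbol $\begin{Bmatrix} j_{12}& j_{13}& j_{14}\\ j_{34}& j_{24}& j_{23}\end{Bmatrix}$ as a function of $l=(l_{ij})_{1\le i<j\le 4}$, $l_{ij}=j_{ij}+\frac12$. Then $$ \det\left[\frac{T^{1}_{ij}+T^{-1}_{ij}}{2}\right]_{1\le i,j\le4}\, \big(N\,\{6j\}\big)(l)= O(|l|^{-\infty}), $$ i.e. for every compact set $K$ of edge-length $6$-tuples of non-degenerate Euclidean tetrahedra and every $M>0$, the left-hand side is $O(|l|^{-M})$ as $|l|\to\infty$, uniformly over admissible spins for which $l$ lies in the cone $\{tx:t>0,\ x\in K\}$.
   Context: The four faces of a tetrahedron are labelled $1,\dots,4$; the edge shared by faces $i,j$ is labelled $ij$ and has length $l_{ij}=l_{ji}$; $|l|^2=\sum_{i<j}l_{ij}^2$. Spins $j_{ij}=j_{ji}\in\frac12\mathbb{Z}_{\ge0}$ are admissible if for each face $i$ the three spins $j_{ik}$ ($k\ne i$) satisfy the triangle inequalities and have integer sum. For $v\in\{1,-1\}$ and $i\neq j$ the operator $T^v_{ij}=T^v_{ji}$ acts on functions $C(l)$ by $$(T^v_{ij}C)(l)=\Big(1+\frac{v}{2l_{ij}}\Big)\,C\big(\{l_{km}+v\,\delta_{(ij),(km)}\}\big),$$ i.e. it shifts only $l_{ij}$ by $v$; and $T^v_{ii}=1$. The operators $X_{ij}=\frac12(T^1_{ij}+T^{-1}_{ij})$ commute with each other, and the determinant is $\sum_{\sigma\in S_4}\operatorname{sgn}(\sigma)\prod_{i=1}^4X_{i\sigma(i)}$,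 with products meaning composition of operators. $N$ is the multiplication operator by $N(l)=\sqrt{\prod_{i=1}^4\Theta_i(l)}$, where $\Theta_i$ is the theta-graph normalization of the three-valent intertwiner of face $i$: if $a_1,a_2,a_3$ are the spins of the edges of face $i$ and $2g=a_1+a_2+a_3$, then $$\Theta_i=\frac{\Gamma(g+1)^2}{\prod_{r=1}^3\Gamma(g-a_r+1)^2}\cdot\frac{\prod_{r=1}^3\Gamma(2g-2a_r+1)}{\Gamma(2g+2)},$$ which for integer spins with even sum is the square of the Wigner $3j$ symbol $\begin{pmatrix}a_1&a_2&a_3\\0&0&0\end{pmatrix}$. *)

theory Defs
  imports "HOL-Analysis.Analysis" "HOL-Library.Landau_Symbols"
begin

text \<open>Edge \<open>Eij\<close> of the tetrahedron is the one shared by the faces \<open>i\<close> and \<open>j\<close>. A 6-tuple of lengths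
  or spins is a vector in \<open>real ^ edge\<close>, whose norm satisfies \<open>|l|^2 = \<Sum>i<j. l_ij^2\<close>.\<close>

datatype edge = E12 | E13 | E14 | E23 | E24 | E34

lemma UNIV_edge: "(UNIV :: edge set) = {E12, E13, E14, E23, E24, E34}"
  using edge.exhaust by auto

instance edge :: finite
  by standard (simp add: UNIV_edge)

text \<open>Only meaningful for distinct \<open>i, j \<in> {1..4}\<close>.\<close>

definition edge :: "nat \<Rightarrow> nat \<Rightarrow> edge" where
  "edge i j =
    (if {i, j} = {1, 2} then E12 else if {i, j} = {1, 3} then E13
     else if {i, j} = {1, 4} then E14 else if {i, j} = {2, 3} then E23
     else if {i, j} = {2, 4} then E24 else E34)"

definition spins :: "real ^ edge \<Rightarrow> real ^ edge" where
  "spins l = (\<chi> e. l $ e - 1 / 2)"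

definition triad :: "real \<Rightarrow> real \<Rightarrow> real \<Rightarrow> bool" where
  "triad a b c \<longleftrightarrow>
     2 * a \<in> \<nat> \<and> 2 * b \<in> \<nat> \<and> 2 * c \<in> \<nat> \<and> a + b + c \<in> \<int> \<and>
     a \<le> b + c \<and> b \<le> a + c \<and> c \<le> a + b"

definition admissible :: "real ^ edge \<Rightarrow> bool" where
  "admissible j \<longleftrightarrow>
     triad (j $ E12) (j $ E13) (j $ E14) \<and> triad (j $ E12) (j $ E23) (j $ E24) \<and>
     triad (j $ E13) (j $ E23) (j $ E34) \<and> triad (j $ E14) (j $ E24) (j $ E34)"

text \<open>The \<open>6j\<close> symbol by Racah's formula, extended by \<open>0\<close> to inadmissible arguments.
  In the admissible case \<open>ffact\<close> is applied to nonnegative integers only.\<close>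

definition ffact :: "real \<Rightarrow> real" where
  "ffact x = fact (nat \<lfloor>x\<rfloor>)"

definition triangle_coeff :: "real \<Rightarrow> real \<Rightarrow> real \<Rightarrow> real" where
  "triangle_coeff a b c =
     sqrt (ffact (a + b - c) * ffact (a - b + c) * ffact (- a + b + c) / ffact (a + b + c + 1))"

definition wigner_6j :: "real \<Rightarrow> real \<Rightarrow> real \<Rightarrow> real \<Rightarrow> real \<Rightarrow> real \<Rightarrow> real" where
  "wigner_6j a b c d e f =
    (if triad a b c \<and> triad a e f \<and> triad d b f \<and> triad d e c then
       triangle_coeff a b c * triangle_coeff a e f * triangle_coeff d b f * triangle_coeff d e c *
       (\<Sum>t | a + b + c \<le> real t \<and> a + e + f \<le> real t \<and> d + b + f \<le> real t \<and> d + e + c \<le> real t \<and>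
              real t \<le> a + b + d + e \<and> real t \<le> b + c + e + f \<and> real t \<le> c + a + f + d.
          (- 1) ^ t * fact (t + 1) /
          (ffact (t - (a + b + c)) * ffact (t - (a + e + f)) *
           ffact (t - (d + b + f)) * ffact (t - (d + e + c)) *
           ffact (a + b + d + e - t) * ffact (b + c + e + f - t) * ffact (c + a + f + d - t)))
     else 0)"

definition sixj :: "real ^ edge \<Rightarrow> real" where
  "sixj l = (let j = spins l in
     wigner_6j (j $ E12) (j $ E13) (j $ E14) (j $ E34) (j $ E24) (j $ E23))"

definition theta :: "real \<Rightarrow> real \<Rightarrow> real \<Rightarrow> real" where
  "theta a b c = (let g = (a + b + c) / 2 in
     (Gamma (g + 1))\<^sup>2 /
       ((Gamma (g - a + 1))\<^sup>2 * (Gamma (g - b + 1))\<^sup>2 * (Gamma (g - c + 1))\<^sup>2) *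
     (Gamma (2 * g - 2 * a + 1) * Gamma (2 * g - 2 * b + 1) * Gamma (2 * g - 2 * c + 1) /
       Gamma (2 * g + 2)))"

definition normalization :: "real ^ edge \<Rightarrow> real" where
  "normalization l = (let j = spins l in
     sqrt (theta (j $ E12) (j $ E13) (j $ E14) * theta (j $ E12) (j $ E23) (j $ E24) *
           theta (j $ E13) (j $ E23) (j $ E34) * theta (j $ E14) (j $ E24) (j $ E34)))"

definition T_op :: "real \<Rightarrow> nat \<Rightarrow> nat \<Rightarrow> (real ^ edge \<Rightarrow> real) \<Rightarrow> real ^ edge \<Rightarrow> real" where
  "T_op v i j C =
    (if i = j then C
     else (\<lambda>l. (1 + v / (2 * l $ edge i j)) * C (l + axis (edge i j) v)))"

definition X_op :: "nat \<Rightarrow> nat \<Rightarrow> (real ^ edge \<Rightarrow> real) \<Rightarrow> real ^ edge \<Rightarrow> real" where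
  "X_op i j C = (\<lambda>l. (T_op 1 i j C l + T_op (- 1) i j C l) / 2)"

definition op_det4 ::
  "(nat \<Rightarrow> nat \<Rightarrow> ('a \<Rightarrow> real) \<Rightarrow> 'a \<Rightarrow> real) \<Rightarrow> ('a \<Rightarrow> real) \<Rightarrow> 'a \<Rightarrow> real" where
  "op_det4 A C = (\<lambda>l. \<Sum>\<sigma> | \<sigma> permutes {1..4}.
     of_int (sign \<sigma>) * (A 1 (\<sigma> 1) \<circ> A 2 (\<sigma> 2) \<circ> A 3 (\<sigma> 3) \<circ> A 4 (\<sigma> 4)) C l)"

text \<open>\<open>P i\<close> is the vertex opposite to face \<open>i\<close>, so the edge shared by faces \<open>i\<close> and \<open>j\<close> joins the other
  two vertices.\<close>

definition tetrahedron_lengths :: "(real ^ edge) set" where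
  "tetrahedron_lengths = {l. \<exists>P :: nat \<Rightarrow> real ^ 3.
     inj_on P {1..4} \<and> \<not> affine_dependent (P ` {1..4}) \<and>
     (\<forall>i j k m. {i, j, k, m} = {1..4} \<longrightarrow> l $ edge i j = dist (P k) (P m))}"

definition cone_over :: "(real ^ edge) set \<Rightarrow> (real ^ edge) set" where
  "cone_over K = {t *\<^sub>R x | t x. t > 0 \<and> x \<in> K}"

end

theory Submission
  imports Defs "HOL-Library.Poly_Mapping"
begin

text \<open>For integer spins whose sum is even on every face, \<open>N {6j}\<close> is the integral of the product of the
  Legendre polynomials \<open>P_{j_ij}(n_i \<bullet> n_j)\<close> over four unit vectors \<open>n_i\<close>. By the three-term
  recurrence \<open>X_ij\<close> multiplies the integrand by \<open>n_i \<bullet> n_j\<close>, and the Gram determinant of four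
  vectors in 3-space vanishes. This argument can be made algebraic so that it needs neither integer spins
  nor even sums: the functions of \<open>n_i\<close> become polynomials in spinors on the half-edges of the face
  \<open>i\<close>, with weights that are Dirichlet integrals with half-integral exponents, multiplication by a
  component of \<open>n_i\<close> becomes an operator on these polynomials, and the integral becomes a Wick pairing,
  which is Racah's sum. So the determinant vanishes exactly wherever the four faces are not too close to
  degenerate, in particular at all large admissible lengths in the cone.\<close>

section \<open>Polynomials\<close>

text \<open>The obstacle is that for general spins there is no vector n_i whose components could be
  multiplied in. What remains is an operator \<open>vec_mult i j a\<close> that inserts component a
  through one chosen edge ij, and a priori it depends on j. Two facts repair this: operators through
  different edges of a face commute, and on \<open>face_poly i\<close> all three edges give the same
  result, thanks to the Dirichlet weights. Going once around the three edges then shows that the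
  double insertion \<open>pair_vec i a b\<close> is symmetric in a and b, which is what the
  antisymmetry argument needs, since every term of the determinant touches each face twice. The
  invariant form has signature (1,2), so that everything stays real; what matters is only that there
  are three components for four rows. The link with the 6j symbol is a generating function.
  \<open>corner_prod n\<close> is the coefficient of Y^n in exp (sum of Y_c times
  \<open>corner c\<close>), the pairing of this exponential is (1 +
  \<open>cycle_sum Y\<close>)^(-2), and Racah's sum is the multinomial expansion of that power. No
  power series are formed: both sides are compared through the recurrence that expresses the
  logarithmic derivative.\<close>

type_synonym 'v mpoly = "('v \<Rightarrow>\<^sub>0 nat) \<Rightarrow>\<^sub>0 real"

definition mvar :: "'v \<Rightarrow> 'v mpoly" where
  "mvar v = Poly_Mapping.single (Poly_Mapping.single v 1) 1"

definition mconst :: "real \<Rightarrow> 'v mpoly" where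
  "mconst c = Poly_Mapping.single 0 c"

lemma mconst_0 [simp]: "mconst 0 = 0"
  and mconst_1 [simp]: "mconst 1 = 1"
  and mconst_numeral: "mconst (numeral k) = numeral k"
  and mconst_add: "mconst (a + b) = mconst a + mconst b"
  and mconst_diff: "mconst (a - b) = mconst a - mconst b"
  and mconst_minus: "mconst (- a) = - mconst a"
  and mconst_mult: "mconst (a * b) = mconst a * mconst b"
  by (simp_all add: mconst_def single_add single_diff single_uminus mult_single)

lemma mpoly_induct [case_names monom add]:
  fixes p :: "'v mpoly"
  assumes "\<And>m c. P (Poly_Mapping.single m c)" and "\<And>p q. P p \<Longrightarrow> P q \<Longrightarrow> P (p + q)"
  shows "P p"
proof (induction p rule: update_induct)
  case const
  show ?case using assms(1)[of 0 0] by simp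
next
  case (update f a b)
  have "Poly_Mapping.update a b f = f + Poly_Mapping.single a b"
    using update(1) by (intro poly_mapping_eqI)
      (auto simp: lookup_update lookup_add lookup_single when_def in_keys_iff)
  then show ?case using assms update by metis
qed

subsection \<open>Linear functionals and partial derivatives\<close>

definition lin :: "(('v \<Rightarrow>\<^sub>0 nat) \<Rightarrow> real) \<Rightarrow> 'v mpoly \<Rightarrow> real" where
  "lin g p = (\<Sum>m\<in>Poly_Mapping.keys p. Poly_Mapping.lookup p m * g m)"

lemma lin_add: "lin g (p + q) = lin g p + lin g q"
  unfolding lin_def by (rule setsum_keys_plus_distrib) (auto simp: distrib_right)

lemma lin_single [simp]: "lin g (Poly_Mapping.single m c) = c * g m"
  by (simp add: lin_def)

lemma lin_0 [simp]: "lin g 0 = 0"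
  by (simp add: lin_def)

lemma lin_1: "lin g 1 = g 0"
  by (simp add: lin_def)

lemma lin_single_mult:
  "lin g (Poly_Mapping.single m c * p) = c * lin (\<lambda>k. g (m + k)) p"
  by (induction p rule: mpoly_induct) (simp_all add: mult_single lin_add distrib_left)

lemma lin_mconst_mult: "lin g (mconst c * p) = c * lin g p"
  by (simp add: mconst_def lin_single_mult)

lemma lin_uminus: "lin g (- p) = - lin g p"
  using lin_mconst_mult[of g "-1" p] by (simp add: mconst_minus)

lemma lin_diff: "lin g (p - q) = lin g p - lin g q"
  using lin_add[of g p "-q"] by (simp add: lin_uminus)

lemma lin_sum: "lin g (sum f A) = (\<Sum>a\<in>A. lin g (f a))"
  by (induction A rule: infinite_finite_induct) (simp_all add: lin_add)

lift_definition pdiff :: "'v \<Rightarrow> 'v mpoly \<Rightarrow> 'v mpoly" is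
  "\<lambda>v p m. real (Poly_Mapping.lookup m v + 1) * p (m + Poly_Mapping.single v 1)"
proof -
  fix v :: 'v and p :: "('v \<Rightarrow>\<^sub>0 nat) \<Rightarrow> real"
  assume fin: "finite {m. p m \<noteq> 0}"
  have "inj (\<lambda>m. m + Poly_Mapping.single v (1::nat))" by (simp add: inj_on_def)
  from finite_vimageI[OF fin this]
  show "finite {m. real (Poly_Mapping.lookup m v + 1) * p (m + Poly_Mapping.single v 1) \<noteq> 0}"
    by (rule rev_finite_subset) auto
qed

lemma pdiff_add: "pdiff v (p + q) = pdiff v p + pdiff v q"
  by (rule poly_mapping_eqI) (simp add: pdiff.rep_eq lookup_add distrib_left)

lemma pdiff_single:
  "pdiff v (Poly_Mapping.single m c) =
    Poly_Mapping.single (m - Poly_Mapping.single v 1) (real (Poly_Mapping.lookup m v) * c)"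
proof (rule poly_mapping_eqI)
  fix k
  show "Poly_Mapping.lookup (pdiff v (Poly_Mapping.single m c)) k =
      Poly_Mapping.lookup (Poly_Mapping.single (m - Poly_Mapping.single v 1) (real (Poly_Mapping.lookup m v) * c)) k"
  proof (cases "m = k + Poly_Mapping.single v 1")
    case True
    then show ?thesis by (simp add: pdiff.rep_eq lookup_add)
  next
    case False
    have "m = k + Poly_Mapping.single v 1"
      if "Poly_Mapping.lookup m v \<noteq> 0" "m - Poly_Mapping.single v 1 = k"
      unfolding that(2)[symmetric] using that(1)
      by (intro poly_mapping_eqI) (auto simp: lookup_add lookup_minus lookup_single when_def)
    with False show ?thesis
      by (auto simp: pdiff.rep_eq lookup_single when_def)
  qed
qed

lemma pdiff_mult: "pdiff v (p * q) = pdiff v p * q + p * pdiff v q"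
proof (induction p rule: mpoly_induct)
  case (monom m c)
  show ?case
  proof (induction q rule: mpoly_induct)
    case (monom n d)
    have *: "Poly_Mapping.single (m + n - Poly_Mapping.single v 1) (real (Poly_Mapping.lookup m v) * (c * d)) =
        Poly_Mapping.single (m - Poly_Mapping.single v 1 + n) (real (Poly_Mapping.lookup m v) * (c * d))"
      for m n :: "'a \<Rightarrow>\<^sub>0 nat" and c d :: real
    proof (cases "Poly_Mapping.lookup m v = 0")
      case False
      then have "m + n - Poly_Mapping.single v 1 = m - Poly_Mapping.single v 1 + n"
        by (intro poly_mapping_eqI) (auto simp: lookup_add lookup_minus lookup_single when_def)
      then show ?thesis by simp
    qed simp
    show ?case
      using *[of m n c d] *[of n m c d]
      by (simp add: mult_single pdiff_single lookup_add distrib_left distrib_right single_add ac_simps)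
  qed (simp add: distrib_left pdiff_add)
qed (simp add: distrib_right pdiff_add)

lemma pdiff_mconst [simp]: "pdiff v (mconst c) = 0"
  by (simp add: mconst_def pdiff_single)

lemma pdiff_1 [simp]: "pdiff v 1 = 0"
  using pdiff_mconst[of v 1] by simp

lemma pdiff_0 [simp]: "pdiff v 0 = 0"
  using pdiff_mconst[of v 0] by simp

lemma pdiff_mvar: "pdiff v (mvar u) = (if u = v then 1 else 0)"
  by (auto simp: mvar_def pdiff_single lookup_single when_def)

lemma pdiff_mconst_mult: "pdiff v (mconst c * p) = mconst c * pdiff v p"
  by (simp add: pdiff_mult)

lemma pdiff_uminus: "pdiff v (- p) = - pdiff v p"
  using pdiff_mconst_mult[of v "-1" p] by (simp add: mconst_minus)

lemma pdiff_diff: "pdiff v (p - q) = pdiff v p - pdiff v q"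
  using pdiff_add[of v p "-q"] by (simp add: pdiff_uminus)

lemma pdiff_commute: "pdiff u (pdiff v p) = pdiff v (pdiff u p)"
  by (rule poly_mapping_eqI) (auto simp: pdiff.rep_eq lookup_add lookup_single when_def ac_simps)

lemmas pdiff_simps = pdiff_add pdiff_diff pdiff_uminus pdiff_mult pdiff_mvar

text \<open>Zero unless \<open>\<nu>\<close> is a natural number; real exponents make the rules below unconditional.\<close>

definition dpow :: "'v mpoly \<Rightarrow> real \<Rightarrow> 'v mpoly" where
  "dpow b \<nu> = (if \<nu> \<in> \<nat> then mconst (1 / fact (nat \<lfloor>\<nu>\<rfloor>)) * b ^ nat \<lfloor>\<nu>\<rfloor> else 0)"

lemma dpow_0 [simp]: "dpow b 0 = 1"
  by (simp add: dpow_def)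

lemma dpow_of_nat: "dpow b (real n) = mconst (1 / fact n) * b ^ n"
  by (simp add: dpow_def)

lemma dpow_eq_0: "\<nu> \<notin> \<nat> \<Longrightarrow> dpow b \<nu> = 0"
  by (simp add: dpow_def)

text \<open>The value 0 is the only natural number whose predecessor is not natural. Separating it
  lets the rules for \<open>dpow\<close> and \<open>rfact\<close>, which relate the arguments \<nu>
  and \<nu> - 1, hold for every real argument.\<close>

lemma Nats_cases_real:
  obtains "\<nu> \<notin> \<nat>" "\<nu> - 1 \<notin> \<nat>" | "\<nu> = 0" | n where "\<nu> = real (Suc n)"
proof (cases "\<nu> \<in> \<nat>")
  case True
  then obtain n where "\<nu> = real n" by (auto elim: Nats_cases)
  then show thesis using that by (cases n) auto
next
  case False
  then have "\<nu> - 1 \<notin> \<nat>" using Nats_add[of "\<nu> - 1" 1] by auto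
  with False show thesis using that by blast
qed

lemma minus_one_notin_Nats: "(-1::real) \<notin> \<nat>"
  using Nats_altdef2 by force

lemma inverse_fact_Suc: "1 / fact n = (1 + real n) * (1 / fact (Suc n) :: real)"
proof -
  have "1 + real n \<noteq> 0" by linarith
  then show ?thesis by simp
qed

lemma mconst_of_nat: "mconst (of_nat n) = of_nat n"
  by (simp add: mconst_def)

lemma mconst_inverse_fact:
  "mconst (1 / fact n) = mconst (real (Suc n)) * mconst (1 / fact (Suc n))"
  unfolding mconst_mult[symmetric] by (subst inverse_fact_Suc) simp

lemma dpow_rec: "b * dpow b (\<nu> - 1) = mconst \<nu> * dpow b \<nu>"
proof (cases \<nu> rule: Nats_cases_real)
  case (3 n)
  then have \<nu>: "\<nu> - 1 = real n" by simp
  show ?thesis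
    unfolding \<nu> unfolding 3 dpow_of_nat[of b n] dpow_of_nat[of b "Suc n"] mconst_inverse_fact[of n]
    by (simp only: power_Suc mult_ac)
qed (simp_all add: dpow_eq_0 minus_one_notin_Nats)

lemma pdiff_power: "pdiff v (b ^ Suc n) = of_nat (Suc n) * b ^ n * pdiff v b"
  by (induction n) (simp_all add: pdiff_mult algebra_simps)

lemma pdiff_dpow: "pdiff v (dpow b \<nu>) = dpow b (\<nu> - 1) * pdiff v b"
proof (cases \<nu> rule: Nats_cases_real)
  case (3 n)
  then have \<nu>: "\<nu> - 1 = real n" by simp
  show ?thesis
    unfolding \<nu> unfolding 3 dpow_of_nat[of b n] dpow_of_nat[of b "Suc n"] mconst_inverse_fact[of n]
      pdiff_mconst_mult pdiff_power mconst_of_nat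
    by (simp only: mult_ac)
qed (simp_all add: dpow_eq_0 minus_one_notin_Nats)


section \<open>Spinors on the half-edges and their Wick pairing\<close>

definition half_edges :: "(nat \<times> nat) set" where
  "half_edges = {(1,2), (1,3), (1,4), (2,1), (2,3), (2,4), (3,1), (3,2), (3,4), (4,1), (4,2), (4,3)}"

text \<open>The cyclic order of the neighbours of a face comes from a planar drawing of \<open>K4\<close>, and
  \<open>orient\<close> is a Kasteleyn orientation of it: with these signs every cycle enters the generating
  function of the pairing below with the sign \<open>+\<close>.\<close>

definition nx :: "nat \<Rightarrow> nat \<Rightarrow> nat" where
  "nx i j =
    (if i = 1 then (if j = 2 then 3 else if j = 3 then 4 else 2)
     else if i = 2 then (if j = 1 then 4 else if j = 4 then 3 else 1)
     else if i = 3 then (if j = 1 then 2 else if j = 2 then 4 else 1)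
     else (if j = 1 then 3 else if j = 3 then 2 else 1))"

definition orient :: "nat \<Rightarrow> nat \<Rightarrow> real" where
  "orient i j = (if (i, j) \<in> {(1,2), (1,4), (2,3), (2,4), (3,4), (3,1)} then 1 else - 1)"

type_synonym spoly = "(nat \<times> nat \<times> bool) mpoly"

abbreviation sx :: "nat \<Rightarrow> nat \<Rightarrow> spoly" where "sx i j \<equiv> mvar (i, j, False)"
abbreviation sy :: "nat \<Rightarrow> nat \<Rightarrow> spoly" where "sy i j \<equiv> mvar (i, j, True)"
abbreviation dx :: "nat \<Rightarrow> nat \<Rightarrow> spoly \<Rightarrow> spoly" where "dx i j \<equiv> pdiff (i, j, False)"
abbreviation dy :: "nat \<Rightarrow> nat \<Rightarrow> spoly \<Rightarrow> spoly" where "dy i j \<equiv> pdiff (i, j, True)"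

text \<open>A Gaussian moment: the x of (i, j) contracts only with the y of (j, i), each contraction
  gives \<open>- orient i j\<close>, and n of each can be matched in n! ways. The y of (i, j) is
  handled by the factor of the opposite half-edge (j, i).\<close>

definition edge_moment :: "((nat \<times> nat \<times> bool) \<Rightarrow>\<^sub>0 nat) \<Rightarrow> nat \<times> nat \<Rightarrow> real" where
  "edge_moment m = (\<lambda>(i, j).
     let n = Poly_Mapping.lookup m (i, j, False)
     in if n = Poly_Mapping.lookup m (j, i, True) then (- orient i j) ^ n * fact n else 0)"

definition moment :: "((nat \<times> nat \<times> bool) \<Rightarrow>\<^sub>0 nat) \<Rightarrow> real" where
  "moment m = (\<Prod>h\<in>half_edges. edge_moment m h)"

definition wick :: "spoly \<Rightarrow> real" where
  "wick = lin moment"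

lemma finite_half_edges [simp]: "finite half_edges"
  by (simp add: half_edges_def)

lemma half_edges_swap: "(i, j) \<in> half_edges \<Longrightarrow> (j, i) \<in> half_edges"
  by (auto simp: half_edges_def)

lemma orient_swap: "(i, j) \<in> half_edges \<Longrightarrow> orient j i = - orient i j"
  by (auto simp: half_edges_def orient_def)

lemma wick_simps:
  "wick (p + q) = wick p + wick q" "wick (p - q) = wick p - wick q" "wick (- p) = - wick p"
  "wick (mconst c * p) = c * wick p" "wick 0 = 0" "wick (sum f A) = (\<Sum>a\<in>A. wick (f a))"
  by (simp_all add: wick_def lin_add lin_diff lin_uminus lin_mconst_mult lin_sum)

lemma moment_shift:
  assumes "(i, j) \<in> half_edges"
    and "\<And>p q. (p, q) \<noteq> (i, j) \<Longrightarrow> edge_moment m (p, q) = edge_moment m' (p, q)"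
    and "edge_moment m (i, j) = c * edge_moment m' (i, j)"
  shows "moment m = c * moment m'"
proof -
  have "(\<Prod>h\<in>half_edges - {(i, j)}. edge_moment m h) =
      (\<Prod>h\<in>half_edges - {(i, j)}. edge_moment m' h)"
    using assms(2) by (intro prod.cong) auto
  then show ?thesis
    unfolding moment_def prod.remove[OF finite_half_edges assms(1)] using assms(3) by simp
qed

lemma moment_sx:
  assumes "(i, j) \<in> half_edges"
  shows "moment (Poly_Mapping.single (i, j, False) 1 + m) =
    - orient i j * real (Poly_Mapping.lookup m (j, i, True)) *
      moment (m - Poly_Mapping.single (j, i, True) 1)"
proof (rule moment_shift[OF assms])
  show "edge_moment (Poly_Mapping.single (i, j, False) 1 + m) (i, j) =
      - orient i j * real (Poly_Mapping.lookup m (j, i, True)) *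
        edge_moment (m - Poly_Mapping.single (j, i, True) 1) (i, j)"
    by (cases "Poly_Mapping.lookup m (j, i, True)")
      (simp_all add: edge_moment_def Let_def lookup_add lookup_minus lookup_single)
qed (auto simp: edge_moment_def lookup_add lookup_minus lookup_single when_def)

lemma moment_sy:
  assumes "(i, j) \<in> half_edges"
  shows "moment (Poly_Mapping.single (i, j, True) 1 + m) =
    orient i j * real (Poly_Mapping.lookup m (j, i, False)) *
      moment (m - Poly_Mapping.single (j, i, False) 1)"
proof (rule moment_shift[OF half_edges_swap[OF assms]])
  show "edge_moment (Poly_Mapping.single (i, j, True) 1 + m) (j, i) =
      orient i j * real (Poly_Mapping.lookup m (j, i, False)) *
        edge_moment (m - Poly_Mapping.single (j, i, False) 1) (j, i)"
    by (cases "Poly_Mapping.lookup m (j, i, False)")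
      (simp_all add: edge_moment_def Let_def lookup_add lookup_minus lookup_single
        orient_swap[OF assms])
qed (auto simp: edge_moment_def lookup_add lookup_minus lookup_single when_def)

text \<open>Integration by parts: a single x contracts in turn with every y at the other end of its
  edge, and the sum over these choices is a derivative. For y the sign is opposite because
  \<open>orient\<close> is antisymmetric.\<close>

lemma wick_sx:
  assumes "(i, j) \<in> half_edges"
  shows "wick (sx i j * p) = - orient i j * wick (dy j i p)"
proof (induction p rule: mpoly_induct)
  case (monom m c)
  show ?case
    using moment_sx[OF assms, of m] by (simp add: wick_def mvar_def mult_single pdiff_single)
qed (simp add: distrib_left wick_simps pdiff_add)

lemma wick_sy:
  assumes "(i, j) \<in> half_edges"
  shows "wick (sy i j * p) = orient i j * wick (dx j i p)"
proof (induction p rule: mpoly_induct)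
  case (monom m c)
  show ?case
    using moment_sy[OF assms, of m] by (simp add: wick_def mvar_def mult_single pdiff_single)
qed (simp add: distrib_left wick_simps pdiff_add)

lemma wick_1: "wick 1 = 1"
  by (simp add: wick_def lin_1 moment_def edge_moment_def prod.neutral split: prod.splits)

subsection \<open>Products of corner brackets\<close>

definition bracket :: "nat \<Rightarrow> nat \<Rightarrow> nat \<Rightarrow> nat \<Rightarrow> spoly" where
  "bracket i j p q = sx i j * sy p q - sy i j * sx p q"

text \<open>The corner \<open>(i, j)\<close> of face \<open>i\<close> lies between the two edges of \<open>i\<close> other than \<open>ij\<close>.\<close>

definition corner :: "nat \<times> nat \<Rightarrow> spoly" where
  "corner = (\<lambda>(i, j). bracket i (nx i j) i (nx i (nx i j)))"

text \<open>The divided powers are chosen so that summing against Y^n gives an exponential;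
  differentiation then lowers an exponent without producing a factor.\<close>

definition corner_prod :: "(nat \<times> nat \<Rightarrow> real) \<Rightarrow> spoly" where
  "corner_prod n = (\<Prod>c\<in>half_edges. dpow (corner c) (n c))"

lemma pdiff_prod_dpow:
  assumes "finite A"
  shows "pdiff v (\<Prod>c\<in>A. dpow (b c) (n c)) =
    (\<Sum>c\<in>A. pdiff v (b c) * (\<Prod>c'\<in>A. dpow (b c') ((n(c := n c - 1)) c')))"
  using assms
proof (induction A rule: finite_induct)
  case (insert a A)
  have *: "(\<Prod>c'\<in>A. dpow (b c') ((n(a := n a - 1)) c')) = (\<Prod>c'\<in>A. dpow (b c') (n c'))"
    using insert by (intro prod.cong) auto
  have "(\<Sum>c\<in>A. pdiff v (b c) * (\<Prod>c'\<in>insert a A. dpow (b c') ((n(c := n c - 1)) c'))) =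
      dpow (b a) (n a) * (\<Sum>c\<in>A. pdiff v (b c) * (\<Prod>c'\<in>A. dpow (b c') ((n(c := n c - 1)) c')))"
    unfolding sum_distrib_left using insert by (intro sum.cong) (auto simp: ac_simps)
  with * insert show ?case by (simp add: pdiff_mult pdiff_dpow ac_simps)
qed simp

lemma pdiff_corner_prod:
  "pdiff v (corner_prod n) =
    (\<Sum>c\<in>half_edges. pdiff v (corner c) * corner_prod (n(c := n c - 1)))"
  unfolding corner_prod_def by (rule pdiff_prod_dpow) simp

lemma nx_half_edge: "(i, j) \<in> half_edges \<Longrightarrow> (i, nx i j) \<in> half_edges"
  by (auto simp: half_edges_def nx_def)

lemma nx_nx_nx: "(i, j) \<in> half_edges \<Longrightarrow> nx i (nx i (nx i j)) = j"
  unfolding half_edges_def by (elim insertE) (simp_all add: nx_def)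

lemma nx_neq: "(i, j) \<in> half_edges \<Longrightarrow> nx i j \<noteq> j"
  unfolding half_edges_def by (elim insertE) (simp_all add: nx_def)

text \<open>The spinor of a half-edge of face i occurs only in the two corners adjacent to that
  edge, which carry the names of the two other neighbours.\<close>

lemma diff_corner:
  assumes "(i, j) \<in> half_edges" "c \<in> half_edges"
  shows "dx i j (corner c) = (if c = (i, nx i (nx i j)) then sy i (nx i j) else 0)
      - (if c = (i, nx i j) then sy i (nx i (nx i j)) else 0)"
    and "dy i j (corner c) = (if c = (i, nx i j) then sx i (nx i (nx i j)) else 0)
      - (if c = (i, nx i (nx i j)) then sx i (nx i j) else 0)"
proof -
  obtain a b where c: "c = (a, b)" by fastforce
  show "dx i j (corner c) = (if c = (i, nx i (nx i j)) then sy i (nx i j) else 0)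
      - (if c = (i, nx i j) then sy i (nx i (nx i j)) else 0)"
  proof (cases "a = i")
    case True
    have "nx i b = j \<longleftrightarrow> b = nx i (nx i j)" "nx i (nx i b) = j \<longleftrightarrow> b = nx i j"
      using nx_nx_nx assms c True by metis+
    then show ?thesis
      using nx_nx_nx[OF assms(1)] nx_neq[OF nx_half_edge[OF assms(1)]]
      by (auto simp: c True corner_def bracket_def pdiff_simps)
  qed (simp add: c corner_def bracket_def pdiff_simps)
  show "dy i j (corner c) = (if c = (i, nx i j) then sx i (nx i (nx i j)) else 0)
      - (if c = (i, nx i (nx i j)) then sx i (nx i j) else 0)"
  proof (cases "a = i")
    case True
    have "nx i b = j \<longleftrightarrow> b = nx i (nx i j)" "nx i (nx i b) = j \<longleftrightarrow> b = nx i j"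
      using nx_nx_nx assms c True by metis+
    then show ?thesis
      using nx_nx_nx[OF assms(1)] nx_neq[OF nx_half_edge[OF assms(1)]]
      by (auto simp: c True corner_def bracket_def pdiff_simps)
  qed (simp add: c corner_def bracket_def pdiff_simps)
qed

lemma diff_corner_prod:
  assumes "(i, j) \<in> half_edges"
  defines "k \<equiv> nx i j" defines "l \<equiv> nx i k"
  shows "dx i j (corner_prod n) = sy i k * corner_prod (n((i, l) := n (i, l) - 1))
      - sy i l * corner_prod (n((i, k) := n (i, k) - 1))"
    and "dy i j (corner_prod n) = sx i l * corner_prod (n((i, k) := n (i, k) - 1))
      - sx i k * corner_prod (n((i, l) := n (i, l) - 1))"
proof -
  have H: "(i, k) \<in> half_edges" "(i, l) \<in> half_edges"
    using assms nx_half_edge by auto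
  have *: "(\<Sum>c\<in>half_edges. ((if c = a then A else 0) - (if c = b then B else 0)) * f c) =
      A * f a - B * f b" if "a \<in> half_edges" "b \<in> half_edges" for a b A B and f :: "_ \<Rightarrow> spoly"
    using that by (simp add: left_diff_distrib sum_subtractf if_distrib[of "\<lambda>x. x * _"] cong: if_cong)
  show "dx i j (corner_prod n) = sy i k * corner_prod (n((i, l) := n (i, l) - 1))
      - sy i l * corner_prod (n((i, k) := n (i, k) - 1))"
    unfolding pdiff_corner_prod
    by (subst sum.cong[OF refl], subst diff_corner(1)[OF assms(1)], assumption, rule refl)
      (unfold k_def[symmetric], unfold l_def[symmetric],
       rule *[OF H(2) H(1), of _ _ "\<lambda>c. corner_prod (n(c := n c - 1))"])
  show "dy i j (corner_prod n) = sx i l * corner_prod (n((i, k) := n (i, k) - 1))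
      - sx i k * corner_prod (n((i, l) := n (i, l) - 1))"
    unfolding pdiff_corner_prod
    by (subst sum.cong[OF refl], subst diff_corner(2)[OF assms(1)], assumption, rule refl)
      (unfold k_def[symmetric], unfold l_def[symmetric],
       rule *[OF H(1) H(2), of _ _ "\<lambda>c. corner_prod (n(c := n c - 1))"])
qed

text \<open>The spinor at (i, j) is contracted across the edge and continues through one of the two
  corners of face j adjacent to it. The last term is the contraction with the bracket's own second
  spinor, to which both of its components contribute, hence the factor 2.\<close>

lemma wick_bracket_corner_prod:
  assumes "(i, j) \<in> half_edges"
  defines "k \<equiv> nx j i" defines "l \<equiv> nx j k"
  shows "wick (bracket i j p q * corner_prod n) = orient i j *
    (wick (bracket j k p q * corner_prod (n((j, l) := n (j, l) - 1)))
     - wick (bracket j l p q * corner_prod (n((j, k) := n (j, k) - 1)))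
     - 2 * of_bool ((p, q) = (j, i)) * wick (corner_prod n))"
proof -
  have "bracket i j p q * corner_prod n =
      sx i j * (sy p q * corner_prod n) - sy i j * (sx p q * corner_prod n)"
    by (simp add: bracket_def algebra_simps)
  then have "wick (bracket i j p q * corner_prod n) =
      - orient i j * (wick (dy j i (sy p q * corner_prod n)) + wick (dx j i (sx p q * corner_prod n)))"
    by (simp only: wick_simps wick_sx[OF assms(1)] wick_sy[OF assms(1)]) (simp add: algebra_simps)
  also have "dy j i (sy p q * corner_prod n) = mconst (of_bool ((p, q) = (j, i))) * corner_prod n +
      sy p q * dy j i (corner_prod n)"
    by (simp add: pdiff_mult pdiff_mvar)
  also have "dx j i (sx p q * corner_prod n) = mconst (of_bool ((p, q) = (j, i))) * corner_prod n +
      sx p q * dx j i (corner_prod n)"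
    by (simp add: pdiff_mult pdiff_mvar)
  finally show ?thesis
    unfolding diff_corner_prod[OF half_edges_swap[OF assms(1)]] k_def l_def bracket_def
      left_diff_distrib right_diff_distrib wick_simps
    by (simp only: mult_ac) (simp add: algebra_simps)
qed


section \<open>The generating function of the pairing\<close>

text \<open>The seven cycles of \<open>K4\<close>, given by the corners they pass.\<close>

definition cycles :: "(nat \<times> nat) list list" where
  "cycles = [[(2,1), (3,1), (4,1)], [(1,2), (3,2), (4,2)], [(1,3), (2,3), (4,3)], [(1,4), (2,4), (3,4)],
    [(1,2), (2,1), (3,4), (4,3)], [(1,3), (2,4), (3,1), (4,2)], [(1,4), (2,3), (3,2), (4,1)]]"

definition cycle_sum :: "(nat \<times> nat \<Rightarrow> 'r) \<Rightarrow> 'r::comm_ring_1" where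
  "cycle_sum Y = (\<Sum>\<gamma>\<leftarrow>cycles. prod_list (map Y \<gamma>))"

text \<open>Iterating \<open>rec\<close> follows a strand through \<open>K4\<close>. The multipliers below are the entries of
  a row of \<open>1 + cycle_sum Y\<close> times the inverse of the \<open>12 \<times> 12\<close> transfer matrix; that
  they are polynomials reflects that the transfer determinant is the square of a Pfaffian.\<close>

locale transfer_system =
  fixes L D :: "nat \<Rightarrow> nat \<Rightarrow> 'r::comm_ring_1 \<Rightarrow> real" and Y :: "nat \<times> nat \<Rightarrow> 'r"
  assumes L_add: "L i j (p + q) = L i j p + L i j q"
    and rec: "(i, j) \<in> half_edges \<Longrightarrow> L i j q = orient i j *
      (L j (nx j i) (Y (j, nx j (nx j i)) * q) - L j (nx j (nx j i)) (Y (j, nx j i) * q) - D i j q)"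
begin

lemma L_0: "L i j 0 = 0"
  using L_add[of i j 0 0] by simp

lemma L_minus: "L i j (- p) = - L i j p"
  using L_add[of i j p "- p"] L_0 by simp

lemma L_diff: "L i j (p - q) = L i j p - L i j q"
  using L_add[of i j p "- q"] L_minus by simp

lemmas L_simps = L_add L_diff L_minus

lemma L_eq_0: "p = 0 \<Longrightarrow> L i j p = 0"
  using L_0 by simp

end

text \<open>The recursion of each half-edge is applied to its multiplier and everything is added.
  The coefficients of all \<open>L i j\<close> cancel as polynomials in Y, except that
  \<open>L 1 2\<close> retains 1 + \<open>cycle_sum Y\<close>; only the source terms
  \<open>D\<close> are left.\<close>

lemma (in transfer_system) transfer_12:
  "L 1 2 (1 + cycle_sum Y) =
    - D 1 2 (1 + Y (1,2) * Y (3,2) * Y (4,2) + Y (2,1) * Y (3,1) * Y (4,1) + Y (1,2) * Y (2,1) * Y (3,4) * Y (4,3))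
    + D 1 3 (Y (1,2) * Y (2,3) * Y (4,3) + Y (1,2) * Y (2,4) * Y (3,1) * Y (4,2))
    - D 1 4 (Y (1,2) * Y (2,4) * Y (3,4) + Y (1,2) * Y (2,3) * Y (3,2) * Y (4,1))
    - D 2 3 (- Y (2,4) - Y (1,2) * Y (2,4) * Y (3,2) * Y (4,2))
    - D 2 4 (Y (2,3) + Y (1,2) * Y (2,3) * Y (3,2) * Y (4,2))
    - D 3 1 (Y (2,4) * Y (3,4) + Y (2,3) * Y (3,2) * Y (4,1))
    + D 3 2 (- Y (2,3) * Y (3,1) * Y (4,1) - Y (1,2) * Y (2,3) * Y (3,4) * Y (4,3))
    - D 3 4 (- Y (2,4) * Y (3,1) + Y (1,2) * Y (2,3) * Y (3,2) * Y (4,3))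
    + D 4 1 (Y (2,3) * Y (4,3) + Y (2,4) * Y (3,1) * Y (4,2))
    + D 4 2 (- Y (2,4) * Y (3,1) * Y (4,1) - Y (1,2) * Y (2,4) * Y (3,4) * Y (4,3))
    + D 4 3 (- Y (2,3) * Y (4,1) + Y (1,2) * Y (2,4) * Y (3,4) * Y (4,2))"
proof -
  define q12 where "q12 = 1 + Y (1,2) * Y (3,2) * Y (4,2) + Y (2,1) * Y (3,1) * Y (4,1) + Y (1,2) * Y (2,1) * Y (3,4) * Y (4,3)"
  define q13 where "q13 = Y (1,2) * Y (2,3) * Y (4,3) + Y (1,2) * Y (2,4) * Y (3,1) * Y (4,2)"
  define q14 where "q14 = Y (1,2) * Y (2,4) * Y (3,4) + Y (1,2) * Y (2,3) * Y (3,2) * Y (4,1)"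
  define q23 where "q23 = - Y (2,4) - Y (1,2) * Y (2,4) * Y (3,2) * Y (4,2)"
  define q24 where "q24 = Y (2,3) + Y (1,2) * Y (2,3) * Y (3,2) * Y (4,2)"
  define q31 where "q31 = Y (2,4) * Y (3,4) + Y (2,3) * Y (3,2) * Y (4,1)"
  define q32 where "q32 = - Y (2,3) * Y (3,1) * Y (4,1) - Y (1,2) * Y (2,3) * Y (3,4) * Y (4,3)"
  define q34 where "q34 = - Y (2,4) * Y (3,1) + Y (1,2) * Y (2,3) * Y (3,2) * Y (4,3)"
  define q41 where "q41 = Y (2,3) * Y (4,3) + Y (2,4) * Y (3,1) * Y (4,2)"
  define q42 where "q42 = - Y (2,4) * Y (3,1) * Y (4,1) - Y (1,2) * Y (2,4) * Y (3,4) * Y (4,3)"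
  define q43 where "q43 = - Y (2,3) * Y (4,1) + Y (1,2) * Y (2,4) * Y (3,4) * Y (4,2)"
  note q_defs = q12_def q13_def q14_def q23_def q24_def q31_def q32_def q34_def q41_def q42_def q43_def
  note q_recs = rec[of 1 2 q12] rec[of 1 3 q13] rec[of 1 4 q14] rec[of 2 3 q23] rec[of 2 4 q24] rec[of 3 1 q31] rec[of 3 2 q32] rec[of 3 4 q34] rec[of 4 1 q41] rec[of 4 2 q42] rec[of 4 3 q43]
  \<comment> \<open>Each of the following facts balances one half-edge: its multiplier on the left
    against what the recursions of the half-edges pointing to that face deliver on the
    right.\<close>
  have "L 1 2 q12 = L 1 2 (1 + cycle_sum Y) - L 1 2 (Y (1,4) * q31) - L 1 2 (Y (1,3) * q41)"
    unfolding L_simps[symmetric] by (rule arg_cong[of _ _ "L 1 2"])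
      (simp add: q_defs cycle_sum_def cycles_def algebra_simps)
  moreover
  have "L 1 3 q13 = L 1 3 (Y (1,2) * q41)"
    unfolding L_simps[symmetric] by (rule arg_cong[of _ _ "L 1 3"])
      (simp add: q_defs cycle_sum_def cycles_def algebra_simps)
  moreover
  have "L 1 4 q14 = L 1 4 (Y (1,2) * q31)"
    unfolding L_simps[symmetric] by (rule arg_cong[of _ _ "L 1 4"])
      (simp add: q_defs cycle_sum_def cycles_def algebra_simps)
  moreover
  \<comment> \<open>The half-edge (2, 1) has multiplier zero, so what is delivered there has to
    cancel by itself.\<close>
  have "- L 2 1 (Y (2,4) * q32) + L 2 1 (Y (2,3) * q42) = 0"
    unfolding q_defs L_simps[symmetric] by (rule L_eq_0) (simp add: algebra_simps)
  moreover
  have "L 2 3 q23 = - L 2 3 (Y (2,4) * q12) - L 2 3 (Y (2,1) * q42)"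
    unfolding L_simps[symmetric] by (rule arg_cong[of _ _ "L 2 3"])
      (simp add: q_defs cycle_sum_def cycles_def algebra_simps)
  moreover
  have "L 2 4 q24 = L 2 4 (Y (2,3) * q12) + L 2 4 (Y (2,1) * q32)"
    unfolding L_simps[symmetric] by (rule arg_cong[of _ _ "L 2 4"])
      (simp add: q_defs cycle_sum_def cycles_def algebra_simps)
  moreover
  have "L 3 1 q31 = - L 3 1 (Y (3,4) * q23) - L 3 1 (Y (3,2) * q43)"
    unfolding L_simps[symmetric] by (rule arg_cong[of _ _ "L 3 1"])
      (simp add: q_defs cycle_sum_def cycles_def algebra_simps)
  moreover
  have "L 3 2 q32 = - L 3 2 (Y (3,4) * q13) + L 3 2 (Y (3,1) * q43)"
    unfolding L_simps[symmetric] by (rule arg_cong[of _ _ "L 3 2"])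
      (simp add: q_defs cycle_sum_def cycles_def algebra_simps)
  moreover
  have "L 3 4 q34 = L 3 4 (Y (3,2) * q13) + L 3 4 (Y (3,1) * q23)"
    unfolding L_simps[symmetric] by (rule arg_cong[of _ _ "L 3 4"])
      (simp add: q_defs cycle_sum_def cycles_def algebra_simps)
  moreover
  have "L 4 1 q41 = L 4 1 (Y (4,3) * q24) - L 4 1 (Y (4,2) * q34)"
    unfolding L_simps[symmetric] by (rule arg_cong[of _ _ "L 4 1"])
      (simp add: q_defs cycle_sum_def cycles_def algebra_simps)
  moreover
  have "L 4 2 q42 = - L 4 2 (Y (4,3) * q14) + L 4 2 (Y (4,1) * q34)"
    unfolding L_simps[symmetric] by (rule arg_cong[of _ _ "L 4 2"])
      (simp add: q_defs cycle_sum_def cycles_def algebra_simps)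
  moreover
  have "L 4 3 q43 = L 4 3 (Y (4,2) * q14) - L 4 3 (Y (4,1) * q24)"
    unfolding L_simps[symmetric] by (rule arg_cong[of _ _ "L 4 3"])
      (simp add: q_defs cycle_sum_def cycles_def algebra_simps)
  ultimately show ?thesis
    using q_recs unfolding q_defs[symmetric] by (simp add: half_edges_def nx_def orient_def)
qed

lemma (in transfer_system) transfer_13:
  "L 1 3 (1 + cycle_sum Y) =
    - D 1 2 (Y (1,3) * Y (3,2) * Y (4,2) + Y (1,3) * Y (2,1) * Y (3,4) * Y (4,3))
    + D 1 3 (1 + Y (1,3) * Y (2,3) * Y (4,3) + Y (2,1) * Y (3,1) * Y (4,1) + Y (1,3) * Y (2,4) * Y (3,1) * Y (4,2))
    - D 1 4 (Y (1,3) * Y (2,4) * Y (3,4) + Y (1,3) * Y (2,3) * Y (3,2) * Y (4,1))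
    + D 2 1 (Y (2,4) * Y (3,4) + Y (2,3) * Y (3,2) * Y (4,1))
    - D 2 3 (- Y (2,1) * Y (3,2) * Y (4,1) - Y (1,3) * Y (2,4) * Y (3,2) * Y (4,2))
    - D 2 4 (- Y (2,1) * Y (3,4) + Y (1,3) * Y (2,3) * Y (3,2) * Y (4,2))
    + D 3 2 (- Y (3,4) - Y (1,3) * Y (2,3) * Y (3,4) * Y (4,3))
    - D 3 4 (Y (3,2) + Y (1,3) * Y (2,3) * Y (3,2) * Y (4,3))
    + D 4 1 (- Y (3,2) * Y (4,2) - Y (2,1) * Y (3,4) * Y (4,3))
    + D 4 2 (Y (3,2) * Y (4,1) - Y (1,3) * Y (2,4) * Y (3,4) * Y (4,3))
    + D 4 3 (Y (2,1) * Y (3,4) * Y (4,1) + Y (1,3) * Y (2,4) * Y (3,4) * Y (4,2))"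
proof -
  define q12 where "q12 = Y (1,3) * Y (3,2) * Y (4,2) + Y (1,3) * Y (2,1) * Y (3,4) * Y (4,3)"
  define q13 where "q13 = 1 + Y (1,3) * Y (2,3) * Y (4,3) + Y (2,1) * Y (3,1) * Y (4,1) + Y (1,3) * Y (2,4) * Y (3,1) * Y (4,2)"
  define q14 where "q14 = Y (1,3) * Y (2,4) * Y (3,4) + Y (1,3) * Y (2,3) * Y (3,2) * Y (4,1)"
  define q21 where "q21 = Y (2,4) * Y (3,4) + Y (2,3) * Y (3,2) * Y (4,1)"
  define q23 where "q23 = - Y (2,1) * Y (3,2) * Y (4,1) - Y (1,3) * Y (2,4) * Y (3,2) * Y (4,2)"
  define q24 where "q24 = - Y (2,1) * Y (3,4) + Y (1,3) * Y (2,3) * Y (3,2) * Y (4,2)"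
  define q32 where "q32 = - Y (3,4) - Y (1,3) * Y (2,3) * Y (3,4) * Y (4,3)"
  define q34 where "q34 = Y (3,2) + Y (1,3) * Y (2,3) * Y (3,2) * Y (4,3)"
  define q41 where "q41 = - Y (3,2) * Y (4,2) - Y (2,1) * Y (3,4) * Y (4,3)"
  define q42 where "q42 = Y (3,2) * Y (4,1) - Y (1,3) * Y (2,4) * Y (3,4) * Y (4,3)"
  define q43 where "q43 = Y (2,1) * Y (3,4) * Y (4,1) + Y (1,3) * Y (2,4) * Y (3,4) * Y (4,2)"
  note q_defs = q12_def q13_def q14_def q21_def q23_def q24_def q32_def q34_def q41_def q42_def q43_def
  note q_recs = rec[of 1 2 q12] rec[of 1 3 q13] rec[of 1 4 q14] rec[of 2 1 q21] rec[of 2 3 q23] rec[of 2 4 q24] rec[of 3 2 q32] rec[of 3 4 q34] rec[of 4 1 q41] rec[of 4 2 q42] rec[of 4 3 q43]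
  have "L 1 2 q12 = - L 1 2 (Y (1,3) * q41)"
    unfolding L_simps[symmetric] by (rule arg_cong[of _ _ "L 1 2"])
      (simp add: q_defs cycle_sum_def cycles_def algebra_simps)
  moreover
  have "L 1 3 q13 = L 1 3 (1 + cycle_sum Y) - L 1 3 (Y (1,4) * q21) + L 1 3 (Y (1,2) * q41)"
    unfolding L_simps[symmetric] by (rule arg_cong[of _ _ "L 1 3"])
      (simp add: q_defs cycle_sum_def cycles_def algebra_simps)
  moreover
  have "L 1 4 q14 = L 1 4 (Y (1,3) * q21)"
    unfolding L_simps[symmetric] by (rule arg_cong[of _ _ "L 1 4"])
      (simp add: q_defs cycle_sum_def cycles_def algebra_simps)
  moreover
  have "L 2 1 q21 = - L 2 1 (Y (2,4) * q32) + L 2 1 (Y (2,3) * q42)"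
    unfolding L_simps[symmetric] by (rule arg_cong[of _ _ "L 2 1"])
      (simp add: q_defs cycle_sum_def cycles_def algebra_simps)
  moreover
  have "L 2 3 q23 = - L 2 3 (Y (2,4) * q12) - L 2 3 (Y (2,1) * q42)"
    unfolding L_simps[symmetric] by (rule arg_cong[of _ _ "L 2 3"])
      (simp add: q_defs cycle_sum_def cycles_def algebra_simps)
  moreover
  have "L 2 4 q24 = L 2 4 (Y (2,3) * q12) + L 2 4 (Y (2,1) * q32)"
    unfolding L_simps[symmetric] by (rule arg_cong[of _ _ "L 2 4"])
      (simp add: q_defs cycle_sum_def cycles_def algebra_simps)
  moreover
  have "- L 3 1 (Y (3,4) * q23) - L 3 1 (Y (3,2) * q43) = 0"
    unfolding q_defs L_simps[symmetric] by (rule L_eq_0) (simp add: algebra_simps)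
  moreover
  have "L 3 2 q32 = - L 3 2 (Y (3,4) * q13) + L 3 2 (Y (3,1) * q43)"
    unfolding L_simps[symmetric] by (rule arg_cong[of _ _ "L 3 2"])
      (simp add: q_defs cycle_sum_def cycles_def algebra_simps)
  moreover
  have "L 3 4 q34 = L 3 4 (Y (3,2) * q13) + L 3 4 (Y (3,1) * q23)"
    unfolding L_simps[symmetric] by (rule arg_cong[of _ _ "L 3 4"])
      (simp add: q_defs cycle_sum_def cycles_def algebra_simps)
  moreover
  have "L 4 1 q41 = L 4 1 (Y (4,3) * q24) - L 4 1 (Y (4,2) * q34)"
    unfolding L_simps[symmetric] by (rule arg_cong[of _ _ "L 4 1"])
      (simp add: q_defs cycle_sum_def cycles_def algebra_simps)
  moreover
  have "L 4 2 q42 = - L 4 2 (Y (4,3) * q14) + L 4 2 (Y (4,1) * q34)"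
    unfolding L_simps[symmetric] by (rule arg_cong[of _ _ "L 4 2"])
      (simp add: q_defs cycle_sum_def cycles_def algebra_simps)
  moreover
  have "L 4 3 q43 = L 4 3 (Y (4,2) * q14) - L 4 3 (Y (4,1) * q24)"
    unfolding L_simps[symmetric] by (rule arg_cong[of _ _ "L 4 3"])
      (simp add: q_defs cycle_sum_def cycles_def algebra_simps)
  ultimately show ?thesis
    using q_recs unfolding q_defs[symmetric] by (simp add: half_edges_def nx_def orient_def)
qed

lemma (in transfer_system) transfer_23:
  "L 2 3 (1 + cycle_sum Y) =
    - D 1 2 (Y (1,4) * Y (3,4) + Y (1,3) * Y (3,1) * Y (4,2))
    + D 1 3 (- Y (1,2) * Y (3,1) * Y (4,2) - Y (1,4) * Y (2,3) * Y (3,1) * Y (4,1))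
    - D 1 4 (- Y (1,2) * Y (3,4) + Y (1,3) * Y (2,3) * Y (3,1) * Y (4,1))
    + D 2 1 (Y (2,3) * Y (3,1) * Y (4,1) + Y (1,2) * Y (2,3) * Y (3,4) * Y (4,3))
    - D 2 3 (1 + Y (1,2) * Y (3,2) * Y (4,2) + Y (1,3) * Y (2,3) * Y (4,3) + Y (1,4) * Y (2,3) * Y (3,2) * Y (4,1))
    - D 2 4 (Y (1,4) * Y (2,3) * Y (3,4) + Y (1,3) * Y (2,3) * Y (3,1) * Y (4,2))
    - D 3 1 (- Y (3,4) - Y (1,3) * Y (2,3) * Y (3,4) * Y (4,3))
    - D 3 4 (Y (3,1) + Y (1,3) * Y (2,3) * Y (3,1) * Y (4,3))
    + D 4 1 (- Y (3,1) * Y (4,2) + Y (1,4) * Y (2,3) * Y (3,4) * Y (4,3))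
    + D 4 2 (Y (3,1) * Y (4,1) + Y (1,2) * Y (3,4) * Y (4,3))
    + D 4 3 (- Y (1,2) * Y (3,4) * Y (4,2) - Y (1,4) * Y (2,3) * Y (3,4) * Y (4,1))"
proof -
  define q12 where "q12 = Y (1,4) * Y (3,4) + Y (1,3) * Y (3,1) * Y (4,2)"
  define q13 where "q13 = - Y (1,2) * Y (3,1) * Y (4,2) - Y (1,4) * Y (2,3) * Y (3,1) * Y (4,1)"
  define q14 where "q14 = - Y (1,2) * Y (3,4) + Y (1,3) * Y (2,3) * Y (3,1) * Y (4,1)"
  define q21 where "q21 = Y (2,3) * Y (3,1) * Y (4,1) + Y (1,2) * Y (2,3) * Y (3,4) * Y (4,3)"
  define q23 where "q23 = 1 + Y (1,2) * Y (3,2) * Y (4,2) + Y (1,3) * Y (2,3) * Y (4,3) + Y (1,4) * Y (2,3) * Y (3,2) * Y (4,1)"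
  define q24 where "q24 = Y (1,4) * Y (2,3) * Y (3,4) + Y (1,3) * Y (2,3) * Y (3,1) * Y (4,2)"
  define q31 where "q31 = - Y (3,4) - Y (1,3) * Y (2,3) * Y (3,4) * Y (4,3)"
  define q34 where "q34 = Y (3,1) + Y (1,3) * Y (2,3) * Y (3,1) * Y (4,3)"
  define q41 where "q41 = - Y (3,1) * Y (4,2) + Y (1,4) * Y (2,3) * Y (3,4) * Y (4,3)"
  define q42 where "q42 = Y (3,1) * Y (4,1) + Y (1,2) * Y (3,4) * Y (4,3)"
  define q43 where "q43 = - Y (1,2) * Y (3,4) * Y (4,2) - Y (1,4) * Y (2,3) * Y (3,4) * Y (4,1)"
  note q_defs = q12_def q13_def q14_def q21_def q23_def q24_def q31_def q34_def q41_def q42_def q43_def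
  note q_recs = rec[of 1 2 q12] rec[of 1 3 q13] rec[of 1 4 q14] rec[of 2 1 q21] rec[of 2 3 q23] rec[of 2 4 q24] rec[of 3 1 q31] rec[of 3 4 q34] rec[of 4 1 q41] rec[of 4 2 q42] rec[of 4 3 q43]
  have "L 1 2 q12 = - L 1 2 (Y (1,4) * q31) - L 1 2 (Y (1,3) * q41)"
    unfolding L_simps[symmetric] by (rule arg_cong[of _ _ "L 1 2"])
      (simp add: q_defs cycle_sum_def cycles_def algebra_simps)
  moreover
  have "L 1 3 q13 = - L 1 3 (Y (1,4) * q21) + L 1 3 (Y (1,2) * q41)"
    unfolding L_simps[symmetric] by (rule arg_cong[of _ _ "L 1 3"])
      (simp add: q_defs cycle_sum_def cycles_def algebra_simps)
  moreover
  have "L 1 4 q14 = L 1 4 (Y (1,3) * q21) + L 1 4 (Y (1,2) * q31)"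
    unfolding L_simps[symmetric] by (rule arg_cong[of _ _ "L 1 4"])
      (simp add: q_defs cycle_sum_def cycles_def algebra_simps)
  moreover
  have "L 2 1 q21 = L 2 1 (Y (2,3) * q42)"
    unfolding L_simps[symmetric] by (rule arg_cong[of _ _ "L 2 1"])
      (simp add: q_defs cycle_sum_def cycles_def algebra_simps)
  moreover
  have "L 2 3 q23 = L 2 3 (1 + cycle_sum Y) - L 2 3 (Y (2,4) * q12) - L 2 3 (Y (2,1) * q42)"
    unfolding L_simps[symmetric] by (rule arg_cong[of _ _ "L 2 3"])
      (simp add: q_defs cycle_sum_def cycles_def algebra_simps)
  moreover
  have "L 2 4 q24 = L 2 4 (Y (2,3) * q12)"
    unfolding L_simps[symmetric] by (rule arg_cong[of _ _ "L 2 4"])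
      (simp add: q_defs cycle_sum_def cycles_def algebra_simps)
  moreover
  have "L 3 1 q31 = - L 3 1 (Y (3,4) * q23) - L 3 1 (Y (3,2) * q43)"
    unfolding L_simps[symmetric] by (rule arg_cong[of _ _ "L 3 1"])
      (simp add: q_defs cycle_sum_def cycles_def algebra_simps)
  moreover
  have "- L 3 2 (Y (3,4) * q13) + L 3 2 (Y (3,1) * q43) = 0"
    unfolding q_defs L_simps[symmetric] by (rule L_eq_0) (simp add: algebra_simps)
  moreover
  have "L 3 4 q34 = L 3 4 (Y (3,2) * q13) + L 3 4 (Y (3,1) * q23)"
    unfolding L_simps[symmetric] by (rule arg_cong[of _ _ "L 3 4"])
      (simp add: q_defs cycle_sum_def cycles_def algebra_simps)
  moreover
  have "L 4 1 q41 = L 4 1 (Y (4,3) * q24) - L 4 1 (Y (4,2) * q34)"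
    unfolding L_simps[symmetric] by (rule arg_cong[of _ _ "L 4 1"])
      (simp add: q_defs cycle_sum_def cycles_def algebra_simps)
  moreover
  have "L 4 2 q42 = - L 4 2 (Y (4,3) * q14) + L 4 2 (Y (4,1) * q34)"
    unfolding L_simps[symmetric] by (rule arg_cong[of _ _ "L 4 2"])
      (simp add: q_defs cycle_sum_def cycles_def algebra_simps)
  moreover
  have "L 4 3 q43 = L 4 3 (Y (4,2) * q14) - L 4 3 (Y (4,1) * q24)"
    unfolding L_simps[symmetric] by (rule arg_cong[of _ _ "L 4 3"])
      (simp add: q_defs cycle_sum_def cycles_def algebra_simps)
  ultimately show ?thesis
    using q_recs unfolding q_defs[symmetric] by (simp add: half_edges_def nx_def orient_def)
qed



section \<open>Recurrence for the coefficients of the generating function\<close>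

abbreviation (input) lower :: "(nat \<times> nat \<Rightarrow> real) \<Rightarrow> ((nat \<times> nat) \<Rightarrow>\<^sub>0 nat) \<Rightarrow> nat \<times> nat \<Rightarrow> real" where
  "lower n \<mu> \<equiv> \<lambda>c. n c - real (Poly_Mapping.lookup \<mu> c)"

definition cyc :: "(nat \<times> nat) list \<Rightarrow> (nat \<times> nat) \<Rightarrow>\<^sub>0 nat" where
  "cyc \<gamma> = sum_list (map (\<lambda>c. Poly_Mapping.single c 1) \<gamma>)"

lemma prod_list_mvar: "prod_list (map mvar \<gamma>) = Poly_Mapping.single (cyc \<gamma>) 1"
  by (induction \<gamma>) (simp_all add: cyc_def mvar_def mult_single)

lemma lookup_cyc: "distinct \<gamma> \<Longrightarrow> Poly_Mapping.lookup (cyc \<gamma>) c = of_bool (c \<in> set \<gamma>)"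
  by (induction \<gamma>) (auto simp: cyc_def lookup_add lookup_single)

lemma lin_sum_list: "lin g (sum_list ps) = (\<Sum>p\<leftarrow>ps. lin g p)"
  by (induction ps) (simp_all add: lin_add)

lemma lin_cycle_sum: "lin g (1 + cycle_sum mvar) = g 0 + (\<Sum>\<gamma>\<leftarrow>cycles. g (cyc \<gamma>))"
  by (simp add: lin_add lin_1 cycle_sum_def lin_sum_list prod_list_mvar o_def)

lemma lin_mvar_mult: "lin g (mvar c * p) = lin (\<lambda>\<mu>. g (Poly_Mapping.single c 1 + \<mu>)) p"
  by (simp add: mvar_def lin_single_mult)

definition wick_count :: "(nat \<times> nat \<Rightarrow> real) \<Rightarrow> real" where
  "wick_count n = wick (corner_prod n)"

text \<open>Coefficient extraction in place of power series: applying \<open>lin\<close> to a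
  function of \<open>lower n \<mu>\<close> yields the coefficient of Y^n in the product of the
  polynomial r(Y) with the series of that function. Multiplication by \<open>mvar c\<close>
  therefore amounts to lowering n at c.\<close>

lemma transfer_system_wick:
  "transfer_system (\<lambda>i j. lin (\<lambda>\<mu>. wick (bracket i j p q * corner_prod (lower n \<mu>))))
     (\<lambda>i j r. 2 * of_bool ((p, q) = (j, i)) * lin (\<lambda>\<mu>. wick_count (lower n \<mu>)) r) mvar"
proof
  fix i j :: nat and r :: "(nat \<times> nat) mpoly"
  assume ij: "(i, j) \<in> half_edges"
  have upd: "(lower n \<mu>)(c := n c - real (Poly_Mapping.lookup \<mu> c) - 1) =
      lower n (Poly_Mapping.single c 1 + \<mu>)" for \<mu> c
    by (auto simp: fun_eq_iff lookup_add lookup_single)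
  show "lin (\<lambda>\<mu>. wick (bracket i j p q * corner_prod (lower n \<mu>))) r =
    orient i j *
     (lin (\<lambda>\<mu>. wick (bracket j (nx j i) p q * corner_prod (lower n \<mu>))) (mvar (j, nx j (nx j i)) * r) -
      lin (\<lambda>\<mu>. wick (bracket j (nx j (nx j i)) p q * corner_prod (lower n \<mu>))) (mvar (j, nx j i) * r) -
      2 * of_bool ((p, q) = (j, i)) * lin (\<lambda>\<mu>. wick_count (lower n \<mu>)) r)"
  proof (induction r rule: mpoly_induct)
    case (monom m a)
    show ?case
      unfolding lin_mvar_mult lin_single wick_bracket_corner_prod[OF ij] upd wick_count_def
      by (simp add: algebra_simps)
  next
    case (add r s)
    show ?case
      unfolding lin_add distrib_left[of "mvar _"] add.IH by (simp only: right_diff_distrib distrib_left)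
  qed
qed (simp add: lin_add)

lemma corner_prod_rec:
  assumes "c \<in> half_edges"
  shows "corner c * corner_prod (n(c := n c - 1)) = mconst (n c) * corner_prod n"
proof -
  have *: "(\<Prod>h\<in>half_edges - {c}. dpow (corner h) ((n(c := n c - 1)) h)) =
      (\<Prod>h\<in>half_edges - {c}. dpow (corner h) (n h))"
    by (rule prod.cong) auto
  show ?thesis
    unfolding corner_prod_def prod.remove[OF finite_half_edges assms] *
    by (simp add: mult.assoc[symmetric] dpow_rec)
qed

lemma wick_corner_lower:
  assumes "c \<in> half_edges"
  shows "wick (corner c * corner_prod (lower (n(c := n c - 1)) \<mu>)) =
    (n c - real (Poly_Mapping.lookup \<mu> c)) * wick_count (lower n \<mu>)"
proof -
  have "lower (n(c := n c - 1)) \<mu> = (lower n \<mu>)(c := lower n \<mu> c - 1)"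
    by auto
  then show ?thesis
    using corner_prod_rec[OF assms, of "lower n \<mu>"] by (simp add: wick_simps wick_count_def)
qed

lemma lower_upd: "lower (n(c := n c - 1)) \<mu> = lower n (Poly_Mapping.single c 1 + \<mu>)"
  by (auto simp: fun_eq_iff lookup_add lookup_single)

lemma lower_cyc: "\<gamma> \<in> set cycles \<Longrightarrow> lower n (cyc \<gamma>) = (\<lambda>c. n c - of_bool (c \<in> set \<gamma>))"
  by (rule ext, subst lookup_cyc) (auto simp: cycles_def)

text \<open>With S the cycle sum and G = (1 + S)^(-2), one has (1 + S) Y_c dG/dY_c = -2 (Y_c
  dS/dY_c) G, and the conclusion is its coefficient at Y^n. The polynomial q is dS/dY_c, as each
  cycle passes c at most once. Lowering n at c in the hypothesis is undone by the factor
  \<open>corner c\<close>, which restores the exponent and produces n c.\<close>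

lemma wick_count_rec_aux:
  assumes c: "c \<in> half_edges"
    and eq: "lin (\<lambda>\<mu>. wick (corner c * corner_prod (lower (n(c := n c - 1)) \<mu>))) (1 + cycle_sum mvar) =
      - 2 * lin (\<lambda>\<mu>. wick_count (lower (n(c := n c - 1)) \<mu>)) q"
    and q: "mvar c * q = (\<Sum>\<gamma>\<leftarrow>filter (\<lambda>\<gamma>. c \<in> set \<gamma>) cycles. prod_list (map mvar \<gamma>))"
  shows "n c * wick_count n =
    - (\<Sum>\<gamma>\<leftarrow>cycles. (n c + of_bool (c \<in> set \<gamma>)) * wick_count (\<lambda>c'. n c' - of_bool (c' \<in> set \<gamma>)))"
proof -
  have "lin (\<lambda>\<mu>. wick_count (lower (n(c := n c - 1)) \<mu>)) q =
      lin (\<lambda>\<mu>. wick_count (lower n \<mu>)) (mvar c * q)"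
    unfolding lin_mvar_mult lower_upd ..
  also have "\<dots> = (\<Sum>\<gamma>\<leftarrow>filter (\<lambda>\<gamma>. c \<in> set \<gamma>) cycles. wick_count (lower n (cyc \<gamma>)))"
    unfolding q by (simp add: lin_sum_list prod_list_mvar o_def)
  also have "\<dots> = (\<Sum>\<gamma>\<leftarrow>cycles. of_bool (c \<in> set \<gamma>) * wick_count (lower n (cyc \<gamma>)))"
    by (simp add: cycles_def)
  finally have "n c * wick_count n + (\<Sum>\<gamma>\<leftarrow>cycles. (n c - real (Poly_Mapping.lookup (cyc \<gamma>) c)) *
      wick_count (lower n (cyc \<gamma>))) = - 2 * (\<Sum>\<gamma>\<leftarrow>cycles. of_bool (c \<in> set \<gamma>) * wick_count (lower n (cyc \<gamma>)))"
    using eq unfolding lin_cycle_sum wick_corner_lower[OF c] by simp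
  moreover have "(\<Sum>\<gamma>\<leftarrow>cycles. (n c - real (Poly_Mapping.lookup (cyc \<gamma>) c)) * wick_count (lower n (cyc \<gamma>))) =
      (\<Sum>\<gamma>\<leftarrow>cycles. (n c - of_bool (c \<in> set \<gamma>)) * wick_count (lower n (cyc \<gamma>)))"
    by (intro arg_cong[of _ _ sum_list] map_cong refl, subst lookup_cyc) (auto simp: cycles_def)
  moreover have "(\<Sum>\<gamma>\<leftarrow>cs. (n c + of_bool (c \<in> set \<gamma>)) * w \<gamma>) =
      (\<Sum>\<gamma>\<leftarrow>cs. (n c - of_bool (c \<in> set \<gamma>)) * w \<gamma>) + 2 * (\<Sum>\<gamma>\<leftarrow>cs. of_bool (c \<in> set \<gamma>) * w \<gamma>)"
    for cs and w :: "_ \<Rightarrow> real" by (induction cs) (simp_all add: algebra_simps)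
  note this[of "\<lambda>\<gamma>. wick_count (lower n (cyc \<gamma>))" cycles]
  ultimately have "n c * wick_count n =
      - (\<Sum>\<gamma>\<leftarrow>cycles. (n c + of_bool (c \<in> set \<gamma>)) * wick_count (lower n (cyc \<gamma>)))"
    by linarith
  also have "(\<Sum>\<gamma>\<leftarrow>cycles. (n c + of_bool (c \<in> set \<gamma>)) * wick_count (lower n (cyc \<gamma>))) =
      (\<Sum>\<gamma>\<leftarrow>cycles. (n c + of_bool (c \<in> set \<gamma>)) * wick_count (\<lambda>c'. n c' - of_bool (c' \<in> set \<gamma>)))"
    by (intro arg_cong[of _ _ sum_list] map_cong refl) (simp add: lower_cyc)
  finally show ?thesis .
qed

lemma lin_wick_uminus: "lin (\<lambda>\<mu>. wick (- f \<mu>)) p = - lin (\<lambda>\<mu>. wick (f \<mu>)) p"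
  by (simp add: lin_def wick_simps sum_negf)

text \<open>These four corners suffice: once all corner numbers are known to be nonnegative, the
  vanishing of these four forces all twelve to vanish. Up to sign their brackets start at (1, 2),
  (1, 3) or (2, 3), the three rows computed above.\<close>

lemma wick_count_rec:
  assumes "c \<in> {(1,2), (1,3), (1,4), (2,1)}"
  shows "n c * wick_count n =
    - (\<Sum>\<gamma>\<leftarrow>cycles. (n c + of_bool (c \<in> set \<gamma>)) * wick_count (\<lambda>c'. n c' - of_bool (c' \<in> set \<gamma>)))"
proof -
  note sys = transfer_system_wick[of _ _ "n(c := n c - 1)"]
  consider "c = (1,4)" | "c = (1,3)" | "c = (1,2)" | "c = (2,1)" using assms by auto
  then show ?thesis
  proof cases
    case 1
    \<comment> \<open>For (p, q) = (1, 3) the bracket is \<open>corner (1,4)\<close> and only the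
      source \<open>D 3 1\<close> survives; its multiplier is the derivative of the cycle sum by
      Y(1,4). The other cases are analogous, with a sign when the bracket runs against the cyclic
      order.\<close>
    show ?thesis
      using transfer_system.transfer_12[OF sys[of 1 3]]
      by (intro wick_count_rec_aux[of c n "mvar (2,4) * mvar (3,4) + mvar (2,3) * mvar (3,2) * mvar (4,1)"])
        (simp_all add: half_edges_def 1 corner_def nx_def cycles_def algebra_simps)
  next
    case 2
    have cor: "corner (1,3) = - bracket 1 2 1 4"
      by (simp add: corner_def nx_def bracket_def)
    show ?thesis
      using transfer_system.transfer_12[OF sys[of 1 4]]
      by (intro wick_count_rec_aux[of c n "mvar (2,3) * mvar (4,3) + mvar (2,4) * mvar (3,1) * mvar (4,2)"])
        (simp_all add: half_edges_def 2 cor[simplified] cycles_def algebra_simps lin_wick_uminus)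
  next
    case 3
    show ?thesis
      using transfer_system.transfer_13[OF sys[of 1 4]]
      by (intro wick_count_rec_aux[of c n "mvar (3,2) * mvar (4,2) + mvar (2,1) * mvar (3,4) * mvar (4,3)"])
        (simp_all add: half_edges_def 3 corner_def nx_def cycles_def algebra_simps lin_add lin_diff lin_uminus)
  next
    case 4
    have cor: "corner (2,1) = - bracket 2 3 2 4"
      by (simp add: corner_def nx_def bracket_def)
    show ?thesis
      using transfer_system.transfer_23[OF sys[of 2 4]]
      by (intro wick_count_rec_aux[of c n "mvar (3,1) * mvar (4,1) + mvar (1,2) * mvar (3,4) * mvar (4,3)"])
        (simp_all add: half_edges_def 4 cor[simplified] cycles_def algebra_simps lin_wick_uminus)
  qed
qed


section \<open>Racah's sum\<close>

text \<open>The 1/2 converts lengths to spins: the value is the sum of the spins of the two edges at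
  the corner minus the spin of ij, that is, the number of spin-1/2 strands passing from one of these
  two edges to the other.\<close>

definition corner_num :: "real ^ edge \<Rightarrow> nat \<times> nat \<Rightarrow> real" where
  "corner_num l = (\<lambda>(i, j). l $ edge i (nx i j) + l $ edge i (nx i (nx i j)) - l $ edge i j - 1 / 2)"

text \<open>In the term with index \<open>t\<close> of Racah's sum, \<open>strand l t k\<close> is the multiplicity of the cycle
  \<open>cycles ! k\<close>, and the total multiplicity is \<open>t\<close>.\<close>

definition strand :: "real ^ edge \<Rightarrow> real \<Rightarrow> nat \<Rightarrow> real" where
  "strand l t k = (let j = spins l in
    [t - (j $ E12 + j $ E13 + j $ E14), t - (j $ E12 + j $ E24 + j $ E23),
     t - (j $ E34 + j $ E13 + j $ E23), t - (j $ E34 + j $ E24 + j $ E14),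
     j $ E13 + j $ E14 + j $ E24 + j $ E23 - t, j $ E14 + j $ E12 + j $ E23 + j $ E34 - t,
     j $ E12 + j $ E13 + j $ E34 + j $ E24 - t] ! k)"

lemma strand_simps:
  "strand l t 0 = t - (l $ E12 + l $ E13 + l $ E14 - 3 / 2)"
  "strand l t (Suc 0) = t - (l $ E12 + l $ E24 + l $ E23 - 3 / 2)"
  "strand l t 2 = t - (l $ E34 + l $ E13 + l $ E23 - 3 / 2)"
  "strand l t 3 = t - (l $ E34 + l $ E24 + l $ E14 - 3 / 2)"
  "strand l t 4 = l $ E13 + l $ E14 + l $ E24 + l $ E23 - 2 - t"
  "strand l t 5 = l $ E14 + l $ E12 + l $ E23 + l $ E34 - 2 - t"
  "strand l t 6 = l $ E12 + l $ E13 + l $ E34 + l $ E24 - 2 - t"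
  by (simp_all add: strand_def spins_def)

definition cycle_edges :: "nat \<Rightarrow> edge set" where
  "cycle_edges k =
    [{E23, E24, E34}, {E13, E14, E34}, {E12, E14, E24}, {E12, E13, E23},
     {E13, E14, E23, E24}, {E12, E14, E23, E34}, {E12, E13, E24, E34}] ! k"

lemma cycle_edges_simps:
  "cycle_edges 0 = {E23, E24, E34}" "cycle_edges (Suc 0) = {E13, E14, E34}"
  "cycle_edges 2 = {E12, E14, E24}" "cycle_edges 3 = {E12, E13, E23}"
  "cycle_edges 4 = {E13, E14, E23, E24}" "cycle_edges 5 = {E12, E14, E23, E34}"
  "cycle_edges 6 = {E12, E13, E24, E34}"
  by (simp_all add: cycle_edges_def)

text \<open>One strand carries spin 1/2, so deleting one copy of a cycle shortens every edge it
  traverses by 1/2.\<close>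

definition remove_cycle :: "nat \<Rightarrow> real ^ edge \<Rightarrow> real ^ edge" where
  "remove_cycle k l = (\<chi> e. l $ e - of_bool (e \<in> cycle_edges k) / 2)"

text \<open>Vanishing off the naturals replaces the range conditions on t in Racah's
  formula.\<close>

definition rfact :: "real \<Rightarrow> real" where
  "rfact x = (if x \<in> \<nat> then 1 / ffact x else 0)"

definition racah_term :: "real ^ edge \<Rightarrow> nat \<Rightarrow> real" where
  "racah_term l t = (- 1) ^ t * fact (t + 1) * (\<Prod>k<7. rfact (strand l (real t) k))"

lemma rfact_rec: "rfact (x - 1) = x * rfact x"
proof (cases x rule: Nats_cases_real)
  case (3 n)
  then have "x - 1 = real n" by simp
  then show ?thesis using 3 inverse_fact_Suc[of n]
    by (simp add: rfact_def ffact_def del: of_nat_Suc fact_Suc) (simp add: add.commute)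
qed (simp_all add: rfact_def minus_one_notin_Nats)

lemma length_cycles: "length cycles = 7"
  by (simp add: cycles_def)

lemma less_7: "{..<7::nat} = {0, 1, 2, 3, 4, 5, 6}"
  by auto

lemma half_edges_cases:
  assumes "c \<in> half_edges"
  obtains "c = (1,2)" | "c = (1,3)" | "c = (1,4)" | "c = (2,1)" | "c = (2,3)" | "c = (2,4)"
    | "c = (3,1)" | "c = (3,2)" | "c = (3,4)" | "c = (4,1)" | "c = (4,2)" | "c = (4,3)"
  using assms unfolding half_edges_def by blast

lemma edge_simps [simp]:
  "edge 1 2 = E12" "edge 1 3 = E13" "edge 1 4 = E14" "edge 2 3 = E23" "edge 2 4 = E24" "edge 3 4 = E34"
  "edge 2 1 = E12" "edge 3 1 = E13" "edge 4 1 = E14" "edge 3 2 = E23" "edge 4 2 = E24" "edge 4 3 = E34"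
  "edge (Suc 0) 2 = E12" "edge (Suc 0) 3 = E13" "edge (Suc 0) 4 = E14"
  "edge 2 (Suc 0) = E12" "edge 3 (Suc 0) = E13" "edge 4 (Suc 0) = E14"
  by (simp_all add: edge_def doubleton_eq_iff)

text \<open>Every corner lies on exactly one cycle of length three and one of length four. The
  former has multiplicity growing with t and the latter falling with t, so t drops out.\<close>

lemma corner_num_strand:
  assumes "c \<in> half_edges"
  shows "corner_num l c = (\<Sum>k<7. of_bool (c \<in> set (cycles ! k)) * strand l t k)"
  by (rule half_edges_cases[OF assms])
    (simp_all add: less_7 corner_num_def strand_simps cycles_def nx_def)

lemma sum_strand: "(\<Sum>k<7. strand l t k) = t"
  by (simp add: less_7 strand_simps)

lemma strand_remove_cycle:
  assumes "m < 7" "k < 7"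
  shows "strand (remove_cycle k l) t m = strand l (t + 1) m - of_bool (m = k)"
proof -
  have "k \<in> {0, 1, 2, 3, 4, 5, 6}" "m \<in> {0, 1, 2, 3, 4, 5, 6}" using assms by auto
  then show ?thesis
    by (elim insertE emptyE; hypsubst)
      (simp_all add: strand_simps remove_cycle_def cycle_edges_simps)
qed

lemma corner_num_remove_cycle:
  assumes "c \<in> half_edges" "k < 7"
  shows "corner_num (remove_cycle k l) c = corner_num l c - of_bool (c \<in> set (cycles ! k))"
proof -
  have "corner_num (remove_cycle k l) c =
      (\<Sum>m<7. of_bool (c \<in> set (cycles ! m)) * (strand l 1 m - of_bool (m = k)))"
    unfolding corner_num_strand[OF assms(1), of _ 0]
    using assms by (intro sum.cong) (auto simp: strand_remove_cycle)
  also have "\<dots> = corner_num l c - (\<Sum>m<7. of_bool (c \<in> set (cycles ! m)) * of_bool (m = k))"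
    unfolding right_diff_distrib sum_subtractf corner_num_strand[OF assms(1), of _ 1, symmetric] ..
  also have "(\<Sum>m<7. of_bool (c \<in> set (cycles ! m)) * of_bool (m = k)) = (of_bool (c \<in> set (cycles ! k)) :: real)"
    using assms(2)
    by (subst sum.cong[OF refl, of _ _ "\<lambda>m. if m = k then of_bool (c \<in> set (cycles ! k)) else 0"]) auto
  finally show ?thesis .
qed

lemma racah_term_remove_cycle:
  assumes "k < 7"
  shows "racah_term (remove_cycle k l) t = - racah_term l (Suc t) * strand l (real (Suc t)) k / (real t + 2)"
proof -
  have k: "k \<in> {..<7}" using assms by simp
  have "(\<Prod>m<7. rfact (strand (remove_cycle k l) (real t) m)) =
      (\<Prod>m<7. rfact (strand l (real t + 1) m - of_bool (m = k)))"
    using strand_remove_cycle[OF _ assms] by (intro prod.cong) auto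
  also have "\<dots> = strand l (real t + 1) k * (\<Prod>m<7. rfact (strand l (real t + 1) m))"
    unfolding prod.remove[OF finite_lessThan k]
    by (subst prod.cong[OF refl, of _ _ "\<lambda>m. rfact (strand l (real t + 1) m)"])
      (auto simp: rfact_rec)
  finally show ?thesis
    by (simp add: racah_term_def field_simps)
qed

lemma strand_Nats: "racah_term l t \<noteq> 0 \<Longrightarrow> k < 7 \<Longrightarrow> strand l (real t) k \<in> \<nat>"
  by (force simp: racah_term_def rfact_def split: if_splits)

lemma racah_term_eq_0:
  assumes "c \<in> half_edges" "corner_num l c \<notin> \<nat>"
  shows "racah_term l t = 0"
proof (rule ccontr)
  assume "racah_term l t \<noteq> 0"
  then have "corner_num l c \<in> \<nat>"
    unfolding corner_num_strand[OF assms(1), of l "real t"] using strand_Nats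
    by (simp add: less_7 of_bool_def)
  with assms(2) show False ..
qed

lemma wick_count_eq_0:
  assumes "c \<in> half_edges" "n c \<notin> \<nat>"
  shows "wick_count n = 0"
proof -
  have "corner_prod n = 0"
    unfolding corner_prod_def using assms by (intro prod_zero) (auto intro!: dpow_eq_0)
  then show ?thesis by (simp add: wick_count_def wick_simps)
qed

lemma wick_count_cong:
  assumes "\<And>c. c \<in> half_edges \<Longrightarrow> n c = n' c"
  shows "wick_count n = wick_count n'"
proof -
  have "corner_prod n = corner_prod n'"
    unfolding corner_prod_def using assms by (intro prod.cong) auto
  then show ?thesis by (simp add: wick_count_def)
qed

text \<open>Both sides obey the same recurrence. The induction is on a bound for the summation
  range: a nonzero term needs \<open>strand l t 4\<close> nonnegative, hence t at most
  \<open>strand l 0 4\<close>, and removing any cycle lowers this bound by at least 1.\<close>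

lemma wick_count_racah:
  assumes "strand l 0 4 < real N"
  shows "wick_count (corner_num l) = (\<Sum>t<N. racah_term l t)"
  using assms
proof (induction N arbitrary: l)
  case 0
  \<comment> \<open>\<open>strand l 0 4\<close> is the sum of the corner numbers at (1,2), (1,3),
    (1,4) and (2,1), so it cannot be negative if all of them are natural.\<close>
  have "\<exists>c\<in>half_edges. corner_num l c \<notin> \<nat>"
  proof (rule ccontr)
    assume "\<not> ?thesis"
    then have "corner_num l c \<ge> 0" if "c \<in> half_edges" for c
      using that by (metis Nats_altdef2 mem_Collect_eq)
    from this[of "(1,2)"] this[of "(1,3)"] this[of "(1,4)"] this[of "(2,1)"] this[of "(2,3)"] this[of "(2,4)"]
    show False
      using 0 by (simp add: half_edges_def corner_num_def nx_def strand_simps)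
  qed
  then show ?case using wick_count_eq_0 by auto
next
  case (Suc N)
  show ?case
  proof (cases "\<exists>c\<in>half_edges. corner_num l c \<notin> \<nat>")
    case True
    then show ?thesis using wick_count_eq_0 racah_term_eq_0 by fastforce
  next
    case False
    then have nonneg: "corner_num l c \<ge> 0" if "c \<in> half_edges" for c
      using that by (metis Nats_altdef2 mem_Collect_eq)
    note nn = nonneg[of "(1,2)"] nonneg[of "(1,3)"] nonneg[of "(1,4)"] nonneg[of "(2,1)"]
      nonneg[of "(2,3)"] nonneg[of "(2,4)"] nonneg[of "(3,1)"] nonneg[of "(3,2)"] nonneg[of "(3,4)"]
      nonneg[of "(4,1)"] nonneg[of "(4,2)"] nonneg[of "(4,3)"]
    show ?thesis
    proof (cases "\<exists>c\<in>{(1,2), (1,3), (1,4), (2,1)}. corner_num l c \<noteq> 0")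
      case True
      then obtain c where c: "c \<in> {(1,2), (1,3), (1,4), (2,1)}" and nz: "corner_num l c \<noteq> 0" by blast
      have H: "c \<in> half_edges" using c by (auto simp: half_edges_def)
      have rec: "wick_count (\<lambda>c. corner_num l c - of_bool (c \<in> set (cycles ! k))) =
          (\<Sum>t<N. - racah_term l (Suc t) * strand l (real (Suc t)) k / (real t + 2))" if "k < 7" for k
      proof -
        have "strand (remove_cycle k l) 0 4 = strand l 1 4 - of_bool (4 = k)"
          using strand_remove_cycle[of 4 k l 0] that by simp
        also have "\<dots> < real N"
          using Suc.prems by (simp add: strand_simps)
        finally have "wick_count (corner_num (remove_cycle k l)) = (\<Sum>t<N. racah_term (remove_cycle k l) t)"
          by (rule Suc.IH)
        also have "wick_count (corner_num (remove_cycle k l)) =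
            wick_count (\<lambda>c. corner_num l c - of_bool (c \<in> set (cycles ! k)))"
          using that by (intro wick_count_cong corner_num_remove_cycle)
        finally show ?thesis using racah_term_remove_cycle[OF that] by simp
      qed
      have "corner_num l c * wick_count (corner_num l) =
          - (\<Sum>k<7. (corner_num l c + of_bool (c \<in> set (cycles ! k))) *
            wick_count (\<lambda>c. corner_num l c - of_bool (c \<in> set (cycles ! k))))"
        unfolding wick_count_rec[OF c, of "corner_num l"] sum_list_sum_nth
        by (simp add: atLeast0LessThan length_cycles)
      also have "\<dots> = (\<Sum>k<7. \<Sum>t<N. (corner_num l c + of_bool (c \<in> set (cycles ! k))) *
          (racah_term l (Suc t) * strand l (real (Suc t)) k / (real t + 2)))"
        unfolding sum_negf[symmetric]
        by (intro sum.cong refl, subst rec) (auto simp: sum_distrib_left sum_negf)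
      also have "\<dots> = (\<Sum>t<N. racah_term l (Suc t) / (real t + 2) * (\<Sum>k<7.
          (corner_num l c + of_bool (c \<in> set (cycles ! k))) * strand l (real (Suc t)) k))"
        by (subst sum.swap) (simp add: sum_distrib_left ac_simps)
      \<comment> \<open>The strand numbers at t + 1 add up to t + 1, and those of the cycles through
        c add up to the corner number. The inner sum is thus the corner number times t + 2, which
        cancels the denominator.\<close>
      also have "\<dots> = (\<Sum>t<N. racah_term l (Suc t) * corner_num l c)"
      proof (rule sum.cong[OF refl])
        fix t
        have "(\<Sum>k<7. (corner_num l c + of_bool (c \<in> set (cycles ! k))) * strand l (real (Suc t)) k) =
            corner_num l c * real (Suc t) + corner_num l c"
          unfolding distrib_right sum.distrib sum_distrib_left[symmetric] sum_strand
            corner_num_strand[OF H, symmetric] ..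
        then show "racah_term l (Suc t) / (real t + 2) * (\<Sum>k<7.
            (corner_num l c + of_bool (c \<in> set (cycles ! k))) * strand l (real (Suc t)) k) =
            racah_term l (Suc t) * corner_num l c"
          by (simp add: field_simps)
      qed
      also have "\<dots> = corner_num l c * (\<Sum>t<N. racah_term l (Suc t))"
        by (simp add: sum_distrib_left mult.commute)
      finally have "wick_count (corner_num l) = (\<Sum>t<N. racah_term l (Suc t))"
        using nz by simp
      \<comment> \<open>At t = 0 the first four strand numbers are the negated spin sums of the
        faces; if they were nonnegative, all spins would vanish, against the choice of c.\<close>
      moreover have "racah_term l 0 = 0"
      proof (rule ccontr)
        assume "racah_term l 0 \<noteq> 0"
        then have "strand l 0 k \<ge> 0" if "k < 7" for k
          using that strand_Nats[of l 0 k] by (simp add: Nats_altdef2)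
        from this[of 0] this[of 1] this[of 2] this[of 3] show False
          using nn c nz by (auto simp: half_edges_def corner_num_def nx_def strand_simps)
      qed
      ultimately show ?thesis by (simp only: sum.lessThan_Suc_shift)
    next
      case False
      \<comment> \<open>The spins of face 1 vanish, then those of 23 and 24 by the corner (2,1), and
        finally that of 34 by the triangle inequality in face 3.\<close>
      have zero: "corner_num l c = 0" if "c \<in> half_edges" for c
        using nn False by (rule_tac half_edges_cases[OF that])
          (simp_all add: half_edges_def corner_num_def nx_def)
      have "corner_prod (corner_num l) = 1"
        unfolding corner_prod_def using zero by (simp add: prod.neutral)
      then have "wick_count (corner_num l) = 1" by (simp add: wick_count_def wick_1)
      moreover have "l $ e = 1 / 2" for e
        using zero[of "(1,2)"] zero[of "(1,3)"] zero[of "(1,4)"] zero[of "(2,1)"] zero[of "(2,3)"]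
          zero[of "(2,4)"] zero[of "(3,1)"] zero[of "(3,2)"] zero[of "(3,4)"]
        by (cases e) (simp_all add: half_edges_def corner_num_def nx_def)
      note half = this
      have "strand l t k = (if k < 4 then t else - t)" if "k < 7" for t k
      proof -
        have "k \<in> {0, 1, 2, 3, 4, 5, 6}" using that by auto
        then show ?thesis by (elim insertE emptyE) (simp_all add: strand_simps half)
      qed
      then have "racah_term l t = of_bool (t = 0)" for t
        by (cases t) (simp_all add: racah_term_def less_7 rfact_def ffact_def Nats_altdef2)
      ultimately show ?thesis by (simp add: sum.lessThan_Suc_shift)
    qed
  qed
qed


section \<open>The normalized \<open>6j\<close> symbol as a pairing\<close>

text \<open>The Dirichlet integral of u^((x-1)/2) v^((y-1)/2) w^((z-1)/2) over the simplex u + v + w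
  = 1, divided by 2 pi, its value at x = y = z = 0.\<close>

definition beta_weight :: "real \<Rightarrow> real \<Rightarrow> real \<Rightarrow> real" where
  "beta_weight x y z =
    Gamma ((x + 1) / 2) * Gamma ((y + 1) / 2) * Gamma ((z + 1) / 2) / Gamma ((x + y + z + 3) / 2) / (2 * pi)"

lemma ffact_of_nat [simp]: "ffact (real n) = fact n"
  by (simp add: ffact_def)

lemma Gamma_duplication_nat:
  "Gamma ((real n + 1) / 2) * Gamma (real n / 2 + 1) = (1 / 2) ^ n * sqrt pi * fact n"
proof (induction n)
  case 0
  show ?case by (simp add: Gamma_one_half_real)
next
  case (Suc n)
  have "Gamma ((real (Suc n) + 1) / 2) * Gamma (real (Suc n) / 2 + 1) =
      Gamma (real n / 2 + 1) * ((real n + 1) / 2 * Gamma ((real n + 1) / 2))"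
    using Gamma_plus1[of "(real n + 1) / 2"] by (simp add: nonpos_Ints_def add_divide_distrib add_ac)
  also have "\<dots> = (real n + 1) / 2 * ((1 / 2) ^ n * sqrt pi * fact n)"
    unfolding Suc.IH[symmetric] by (simp add: ac_simps)
  finally show ?case by (simp add: field_simps)
qed

lemma Gamma_half_nat:
  "Gamma ((real n + 1) / 2) = (1 / 2) ^ n * sqrt pi * fact n / Gamma (real n / 2 + 1)"
  using Gamma_duplication_nat[of n] Gamma_real_pos[of "real n / 2 + 1"]
  by (intro eq_divide_imp) linarith+

text \<open>By the duplication formula the product of the theta normalization with the factors of
  Racah's formula is a Dirichlet integral.\<close>

lemma theta_triangle_coeff:
  assumes "b + c - a = real p" "a + c - b = real q" "a + b - c = real r"
  shows "theta a b c \<ge> 0"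
    and "sqrt (theta a b c) * triangle_coeff a b c = beta_weight p q r"
proof -
  define P Q R S where PQRS: "P = Gamma (real p / 2 + 1)" "Q = Gamma (real q / 2 + 1)"
    "R = Gamma (real r / 2 + 1)" "S = Gamma (real (p + q + r) / 2 + 1)"
  \<comment> \<open>The theta normalization turns out to be A^2 B and the Racah factor sqrt B, so
    that the square roots disappear from the product A B.\<close>
  define A where "A = S / (P * Q * R)"
  define B :: real where "B = fact p * fact q * fact r / fact (p + q + r + 1)"
  have abc: "a = (real q + real r) / 2" "b = (real p + real r) / 2" "c = (real p + real q) / 2"
    using assms by simp_all
  have pos: "P > 0" "Q > 0" "R > 0" "S > 0"
    unfolding PQRS by (auto intro!: Gamma_real_pos add_nonneg_pos)
  have A0: "A \<ge> 0" unfolding A_def using pos by simp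
  have B0: "B \<ge> 0" unfolding B_def by simp
  have aux: "(a + b + c) / 2 + 1 = (x + y + z) / 2 + 1 \<and> (a + b + c) / 2 - a + 1 = x / 2 + 1 \<and>
    (a + b + c) / 2 - b + 1 = y / 2 + 1 \<and> (a + b + c) / 2 - c + 1 = z / 2 + 1 \<and>
    2 * ((a + b + c) / 2) - 2 * a + 1 = 1 + x \<and> 2 * ((a + b + c) / 2) - 2 * b + 1 = 1 + y \<and>
    2 * ((a + b + c) / 2) - 2 * c + 1 = 1 + z \<and> 2 * ((a + b + c) / 2) + 2 = 1 + (x + y + z + 1) \<and>
    a - b + c = y \<and> - a + b + c = x \<and> a + b + c + 1 = x + y + z + 1"
    if "b + c - a = x" "a + c - b = y" "a + b - c = z" for x y z :: real
    using that by (auto simp: field_simps)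
  have eqs: "(a + b + c) / 2 + 1 = real (p + q + r) / 2 + 1" "(a + b + c) / 2 - a + 1 = real p / 2 + 1"
    "(a + b + c) / 2 - b + 1 = real q / 2 + 1" "(a + b + c) / 2 - c + 1 = real r / 2 + 1"
    "2 * ((a + b + c) / 2) - 2 * a + 1 = 1 + real p" "2 * ((a + b + c) / 2) - 2 * b + 1 = 1 + real q"
    "2 * ((a + b + c) / 2) - 2 * c + 1 = 1 + real r" "2 * ((a + b + c) / 2) + 2 = 1 + real (p + q + r + 1)"
    using aux[OF assms] by (simp_all only: of_nat_add of_nat_1)
  have "theta a b c = A\<^sup>2 * B"
    unfolding theta_def Let_def A_def B_def PQRS
    by (simp only: eqs Gamma_fact) (simp add: power_divide power_mult_distrib)
  moreover have "triangle_coeff a b c = sqrt B"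
  proof -
    have eqs: "a + b - c = real r" "a - b + c = real q" "- a + b + c = real p" "a + b + c + 1 = real (p + q + r + 1)"
      using assms(3) aux[OF assms] by (simp_all only: of_nat_add of_nat_1)
    show ?thesis unfolding triangle_coeff_def B_def
      by (simp only: eqs ffact_of_nat) (simp add: ac_simps)
  qed
  ultimately have AB: "theta a b c \<ge> 0" "sqrt (theta a b c) * triangle_coeff a b c = A * B"
    using A0 B0 by (simp_all add: real_sqrt_mult)
  have "Gamma ((real p + real q + real r + 3) / 2) =
      (1 / 2) ^ Suc (p + q + r) * sqrt pi * fact (Suc (p + q + r)) / S"
  proof -
    have eqs: "(real (Suc (p + q + r)) + 1) / 2 = real (p + q + r) / 2 + 1"
      "real (Suc (p + q + r)) / 2 + 1 = (real p + real q + real r + 3) / 2"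
      by (simp_all add: field_simps)
    show ?thesis
      using Gamma_duplication_nat[of "Suc (p + q + r)"] pos(4)
      unfolding eqs PQRS(4)[symmetric] by (intro eq_divide_imp) (simp, metis mult.commute)
  qed
  then have "beta_weight p q r =
      ((1 / 2) ^ p * sqrt pi * fact p / P) * ((1 / 2) ^ q * sqrt pi * fact q / Q) *
      ((1 / 2) ^ r * sqrt pi * fact r / R) /
      ((1 / 2) ^ Suc (p + q + r) * sqrt pi * fact (Suc (p + q + r)) / S) / (2 * (sqrt pi * sqrt pi))"
    unfolding beta_weight_def PQRS by (simp only: Gamma_half_nat) simp
  also have "\<dots> = A * B"
    unfolding A_def B_def using pos
    by (simp add: power_add field_simps del: fact_Suc real_sqrt_mult_self)
  finally show "theta a b c \<ge> 0" "sqrt (theta a b c) * triangle_coeff a b c = beta_weight p q r"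
    using AB by simp_all
qed

definition face_weight :: "nat \<Rightarrow> real ^ edge \<Rightarrow> real" where
  "face_weight i l = (let j = (if i = 1 then 2 else 1); k = nx i j in
     beta_weight (corner_num l (i, j)) (corner_num l (i, k)) (corner_num l (i, nx i k)))"

text \<open>A bound r on the corner numbers leaves room for r successive shifts of single edges by 1
  or -1, since each shift changes a corner number by at most 1.\<close>

definition region :: "nat \<Rightarrow> (real ^ edge) set" where
  "region r = {l. \<forall>c\<in>half_edges. corner_num l c \<in> \<nat> \<and> corner_num l c \<ge> real r}"

lemma triad_of_nat:
  assumes "b + c - a = real p" "a + c - b = real q" "a + b - c = real r"
  shows "triad a b c"
proof -
  have "2 * a = real (q + r)" "2 * b = real (p + r)" "2 * c = real (p + q)"
    using assms by simp_all
  moreover have "a + b + c = real (p + q + r)" using assms by simp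
  ultimately show ?thesis
    unfolding triad_def using assms
    by (auto simp only: of_nat_in_Nats intro: Ints_of_nat)
qed

lemma triangle_coeff_commute: "triangle_coeff a b c = triangle_coeff a c b"
  "triangle_coeff a b c = triangle_coeff b a c"
  by (simp_all add: triangle_coeff_def algebra_simps)

lemma beta_weight_commute: "beta_weight a b c = beta_weight a c b" "beta_weight a b c = beta_weight b a c"
  by (simp_all add: beta_weight_def ac_simps)

lemma racah_sum:
  assumes "l \<in> region 0"
  defines "j \<equiv> spins l"
  defines "a \<equiv> j $ E12" and "b \<equiv> j $ E13" and "c \<equiv> j $ E14"
    and "d \<equiv> j $ E34" and "e \<equiv> j $ E24" and "f \<equiv> j $ E23"
  shows "(\<Sum>t | a + b + c \<le> real t \<and> a + e + f \<le> real t \<and> d + b + f \<le> real t \<and> d + e + c \<le> real t \<and>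
              real t \<le> a + b + d + e \<and> real t \<le> b + c + e + f \<and> real t \<le> c + a + f + d.
          (- 1) ^ t * fact (t + 1) /
          (ffact (t - (a + b + c)) * ffact (t - (a + e + f)) *
           ffact (t - (d + b + f)) * ffact (t - (d + e + c)) *
           ffact (a + b + d + e - t) * ffact (b + c + e + f - t) * ffact (c + a + f + d - t))) =
    wick_count (corner_num l)" (is "sum ?g ?T = _")
proof -
  define N where "N = nat \<lceil>\<bar>strand l 0 4\<bar>\<rceil> + 1"
  have N: "strand l 0 4 < real N" unfolding N_def by linarith
  have strands: "strand l t 0 = t - (a + b + c)" "strand l t (Suc 0) = t - (a + e + f)"
    "strand l t 2 = t - (d + b + f)" "strand l t 3 = t - (d + e + c)"
    "strand l t 4 = b + c + e + f - t" "strand l t 5 = c + a + f + d - t" "strand l t 6 = a + b + d + e - t" for t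
    by (simp_all add: strand_simps a_def b_def c_def d_def e_def f_def j_def spins_def)
  have Nats: "corner_num l h \<in> \<nat>" if "h \<in> half_edges" for h
    using assms(1) that by (simp add: region_def)
  \<comment> \<open>The three corner numbers of a face add up to the sum of its spins, which makes
    the first four strand numbers integral; each of the other three is a corner number minus one of
    these.\<close>
  have ints: "strand l (real t) k \<in> \<int>" if "k < 7" for t k
  proof -
    note Int = subsetD[OF Nats_subset_Ints Nats]
    have tri: "strand l (real t) 0 \<in> \<int>" "strand l (real t) (Suc 0) \<in> \<int>"
      "strand l (real t) 2 \<in> \<int>" "strand l (real t) 3 \<in> \<int>"
    proof -
      have "strand l (real t) 0 = real t - (corner_num l (1,2) + corner_num l (1,3) + corner_num l (1,4))"
        "strand l (real t) (Suc 0) = real t - (corner_num l (2,1) + corner_num l (2,3) + corner_num l (2,4))"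
        "strand l (real t) 2 = real t - (corner_num l (3,1) + corner_num l (3,2) + corner_num l (3,4))"
        "strand l (real t) 3 = real t - (corner_num l (4,1) + corner_num l (4,2) + corner_num l (4,3))"
        by (simp_all add: strand_simps corner_num_def nx_def)
      then show "strand l (real t) 0 \<in> \<int>" "strand l (real t) (Suc 0) \<in> \<int>"
        "strand l (real t) 2 \<in> \<int>" "strand l (real t) 3 \<in> \<int>"
        by (simp_all only:, (intro Ints_diff Ints_add Int Ints_of_nat; simp add: half_edges_def)+)
    qed
    have "strand l (real t) 4 = corner_num l (1,2) - strand l (real t) (Suc 0)"
      "strand l (real t) 5 = corner_num l (1,3) - strand l (real t) 2"
      "strand l (real t) 6 = corner_num l (1,4) - strand l (real t) 3"
      by (simp_all add: strand_simps corner_num_def nx_def)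
    then have "strand l (real t) 4 \<in> \<int>" "strand l (real t) 5 \<in> \<int>" "strand l (real t) 6 \<in> \<int>"
      by (simp_all only:, (intro Ints_diff Int tri; simp add: half_edges_def)+)
    moreover have "k \<in> {0, 1, 2, 3, 4, 5, 6}" using that by auto
    ultimately show ?thesis using tri by auto
  qed
  have "sum ?g ?T = (\<Sum>t<N. racah_term l t)"
  proof (rule sum.mono_neutral_cong_left)
    show "?T \<subseteq> {..<N}" using N unfolding strands by force
    show "\<forall>t\<in>{..<N} - ?T. racah_term l t = 0"
    proof
      fix t assume "t \<in> {..<N} - ?T"
      then have "\<exists>k\<in>{0, Suc 0, 2, 3, 4, 5, 6}. strand l (real t) k < 0" by (auto simp: strands)
      then obtain k where "k \<in> {0, Suc 0, 2, 3, 4, 5, 6}" "strand l (real t) k < 0" by blast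
      then have "k < 7" "strand l (real t) k < 0" by auto
      then show "racah_term l t = 0" using strand_Nats[of l t k] by (force simp: Nats_altdef2)
    qed
    show "?g t = racah_term l t" if "t \<in> ?T" for t
    proof -
      have "\<forall>k\<in>{0, Suc 0, 2, 3, 4, 5, 6}. strand l (real t) k \<ge> 0" using that by (simp add: strands)
      then have "\<forall>k\<in>{0, Suc 0, 2, 3, 4, 5, 6}. strand l (real t) k \<in> \<nat>"
        using ints by (auto simp: Nats_altdef2)
      then show ?thesis by (simp add: racah_term_def less_7 rfact_def strands)
    qed
  qed simp
  then show ?thesis using wick_count_racah[OF N] by simp
qed

lemma edge_pos_region: "l \<in> region r \<Longrightarrow> l $ e \<ge> real r + 1 / 2"
proof -
  assume "l \<in> region r"
  then have *: "corner_num l c \<ge> real r" if "c \<in> half_edges" for c using that by (simp add: region_def)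
  from *[of "(1,2)"] *[of "(1,3)"] *[of "(1,4)"] *[of "(2,1)"] *[of "(2,3)"]
          *[of "(2,4)"] *[of "(3,1)"] *[of "(3,2)"] *[of "(3,4)"]
  show "l $ e \<ge> real r + 1 / 2"
    by (cases e) (simp_all add: half_edges_def corner_num_def nx_def)
qed

lemma normalization_sixj:
  assumes "l \<in> region 0"
  shows "normalization l * sixj l =
    face_weight 1 l * face_weight 2 l * face_weight 3 l * face_weight 4 l * wick_count (corner_num l)"
proof -
  define j where "j = spins l"
  have *: "\<exists>n. corner_num l c = real n" if "c \<in> half_edges" for c
    using assms that by (force simp: region_def elim: Nats_cases)
  obtain n where n: "\<And>c. c \<in> half_edges \<Longrightarrow> corner_num l c = real (n c)"
    using * by metis
  have n': "corner_num l (1,2) = real (n (1,2))" "corner_num l (1,3) = real (n (1,3))"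
    "corner_num l (1,4) = real (n (1,4))" "corner_num l (2,1) = real (n (2,1))"
    "corner_num l (2,3) = real (n (2,3))" "corner_num l (2,4) = real (n (2,4))"
    "corner_num l (3,1) = real (n (3,1))" "corner_num l (3,2) = real (n (3,2))"
    "corner_num l (3,4) = real (n (3,4))" "corner_num l (4,1) = real (n (4,1))"
    "corner_num l (4,2) = real (n (4,2))" "corner_num l (4,3) = real (n (4,3))"
    by (rule n, simp add: half_edges_def)+
  note eqs = n'[unfolded corner_num_def nx_def, simplified]
  have spins: "j $ e = l $ e - 1 / 2" for e by (simp add: j_def spins_def)
  have f1: "j $ E13 + j $ E14 - j $ E12 = real (n (1,2))" "j $ E12 + j $ E14 - j $ E13 = real (n (1,3))"
    "j $ E12 + j $ E13 - j $ E14 = real (n (1,4))"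
   and f2: "j $ E23 + j $ E24 - j $ E12 = real (n (2,1))" "j $ E12 + j $ E24 - j $ E23 = real (n (2,3))"
    "j $ E12 + j $ E23 - j $ E24 = real (n (2,4))"
   and f3: "j $ E23 + j $ E34 - j $ E13 = real (n (3,1))" "j $ E13 + j $ E34 - j $ E23 = real (n (3,2))"
    "j $ E13 + j $ E23 - j $ E34 = real (n (3,4))"
   and f4: "j $ E24 + j $ E34 - j $ E14 = real (n (4,1))" "j $ E14 + j $ E34 - j $ E24 = real (n (4,2))"
    "j $ E14 + j $ E24 - j $ E34 = real (n (4,3))"
    using eqs unfolding spins by (simp_all add: algebra_simps)
  note t1 = theta_triangle_coeff[OF f1] and t2 = theta_triangle_coeff[OF f2]
    and t3 = theta_triangle_coeff[OF f3] and t4 = theta_triangle_coeff[OF f4]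
  have sym: "triangle_coeff (j $ E12) (j $ E24) (j $ E23) = triangle_coeff (j $ E12) (j $ E23) (j $ E24)"
    "triangle_coeff (j $ E34) (j $ E13) (j $ E23) = triangle_coeff (j $ E13) (j $ E23) (j $ E34)"
    "triangle_coeff (j $ E34) (j $ E24) (j $ E14) = triangle_coeff (j $ E14) (j $ E24) (j $ E34)"
    by (metis triangle_coeff_commute)+
  have triads: "triad (j $ E12) (j $ E13) (j $ E14)" "triad (j $ E12) (j $ E24) (j $ E23)"
    "triad (j $ E34) (j $ E13) (j $ E23)" "triad (j $ E34) (j $ E24) (j $ E14)"
    using triad_of_nat[OF f1] triad_of_nat[OF f2] triad_of_nat[OF f3] triad_of_nat[OF f4]
    by (auto simp: triad_def algebra_simps)
  have "normalization l = sqrt (theta (j $ E12) (j $ E13) (j $ E14)) * sqrt (theta (j $ E12) (j $ E23) (j $ E24)) *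
      sqrt (theta (j $ E13) (j $ E23) (j $ E34)) * sqrt (theta (j $ E14) (j $ E24) (j $ E34))"
    by (simp add: normalization_def j_def Let_def real_sqrt_mult)
  moreover have "sixj l = triangle_coeff (j $ E12) (j $ E13) (j $ E14) * triangle_coeff (j $ E12) (j $ E23) (j $ E24) *
      triangle_coeff (j $ E13) (j $ E23) (j $ E34) * triangle_coeff (j $ E14) (j $ E24) (j $ E34) * wick_count (corner_num l)"
    unfolding sixj_def wigner_6j_def Let_def j_def[symmetric] racah_sum[OF assms, folded j_def] sym
    using triads by simp
  moreover have "face_weight 1 l = beta_weight (n (1,2)) (n (1,3)) (n (1,4))"
    "face_weight 2 l = beta_weight (n (2,1)) (n (2,3)) (n (2,4))"
    "face_weight 3 l = beta_weight (n (3,1)) (n (3,2)) (n (3,4))"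
    "face_weight 4 l = beta_weight (n (4,1)) (n (4,2)) (n (4,3))"
    using n'[simplified] beta_weight_commute by (simp_all add: face_weight_def nx_def Let_def)
  ultimately show ?thesis
    unfolding t1(2)[symmetric] t2(2)[symmetric] t3(2)[symmetric] t4(2)[symmetric]
    by (simp only: mult_ac)
qed


section \<open>Multiplication by a vector component\<close>

text \<open>A spinor \<open>(x, y)\<close> has the null vector \<open>(x^2, xy, y^2)\<close>, and \<open>null_comb\<close> passes to a basis
  in which the invariant form is diagonal with the signs \<open>metric_sign\<close>.\<close>

definition null_comb :: "nat \<Rightarrow> 'v mpoly \<Rightarrow> 'v mpoly \<Rightarrow> 'v mpoly \<Rightarrow> 'v mpoly" where
  "null_comb a p q r =
    (if a = 0 then mconst (1 / 2) * (p + r) else if a = 1 then mconst (1 / 2) * (p - r) else q)"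

definition metric_sign :: "nat \<Rightarrow> real" where
  "metric_sign a = (if a = 0 then 1 else - 1)"

definition null_vec :: "nat \<Rightarrow> nat \<Rightarrow> nat \<Rightarrow> spoly" where
  "null_vec a i j = null_comb a (sx i j * sx i j) (sx i j * sy i j) (sy i j * sy i j)"

text \<open>The null vector with x replaced by d/dy and y by -d/dx: up to the sign of the
  orientation, this is what the pairing makes of a spinor when it is moved to the other end of its
  edge.\<close>

definition null_diff :: "nat \<Rightarrow> nat \<Rightarrow> nat \<Rightarrow> spoly \<Rightarrow> spoly" where
  "null_diff a i j p = null_comb a (dy i j (dy i j p)) (- dx i j (dy i j p)) (dx i j (dx i j p))"

text \<open>For integer spins \<open>F\<close> may be the family of the functions \<open>(n \<bullet> v)^j / j!\<close> of the null vectors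
  \<open>v\<close> of the edge \<open>ij\<close>, for a unit vector \<open>n\<close>; then \<open>vec_mult\<close> is multiplication by a
  component of \<open>n\<close>. The definition makes sense for all spins.\<close>

definition vec_mult :: "nat \<Rightarrow> nat \<Rightarrow> nat \<Rightarrow> (real ^ edge \<Rightarrow> spoly) \<Rightarrow> real ^ edge \<Rightarrow> spoly" where
  "vec_mult i j a F = (\<lambda>l. mconst (1 / (2 * l $ edge i j)) *
     (null_diff a i j (F (l + axis (edge i j) 1)) + null_vec a i j * F (l + axis (edge i j) (- 1))))"

lemma pdiff_numeral [simp]: "pdiff v (numeral k) = 0"
  by (simp add: mconst_numeral[symmetric])

lemma half_half: "mconst (1 / 2) + mconst (1 / 2) = 1" "mconst (1 / 2) * 2 = 1"
  unfolding mconst_numeral[symmetric] mconst_mult[symmetric] mconst_add[symmetric] by simp_all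

lemma less_3: "{..<3::nat} = {0, 1, 2}"
  by auto

lemma null_comb_mult: "null_comb a p q r * s = null_comb a (p * s) (q * s) (r * s)"
  "s * null_comb a p q r = null_comb a (s * p) (s * q) (s * r)"
  by (simp_all add: null_comb_def algebra_simps)

lemma null_comb_add: "null_comb a p q r + null_comb a p' q' r' = null_comb a (p + p') (q + q') (r + r')"
  by (simp add: null_comb_def algebra_simps)

lemma pdiff_null_comb: "pdiff v (null_comb a p q r) = null_comb a (pdiff v p) (pdiff v q) (pdiff v r)"
  by (simp add: null_comb_def pdiff_simps pdiff_mconst_mult)

lemma minus_null_comb: "- null_comb a p q r = null_comb a (- p) (- q) (- r)"
  by (simp add: null_comb_def algebra_simps)

text \<open>In the coordinates (p, q, r) the invariant form is the polarization of p r - q^2, which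
  vanishes on (x^2, xy, y^2).\<close>

lemma sum_null_comb:
  "(\<Sum>a<3. mconst (metric_sign a) * (null_comb a p q r * null_comb a p' q' r')) =
    mconst (1 / 2) * (p * r' + r * p') - q * q'"
proof -
  define h :: "'a mpoly" where "h = mconst (1 / 2)"
  have h: "h + h = 1" unfolding h_def by (rule half_half)
  have "h * (p + r) * (h * (p' + r')) - h * (p - r) * (h * (p' - r')) - q * q' =
      (h + h) * (h * (p * r' + r * p')) - q * q'"
    by (simp add: algebra_simps)
  then have "h * (p + r) * (h * (p' + r')) - h * (p - r) * (h * (p' - r')) - q * q' = h * (p * r' + r * p') - q * q'"
    unfolding h by simp
  then show ?thesis
    by (simp add: less_3 null_comb_def metric_sign_def mconst_minus h_def)
qed

text \<open>The same contraction for a two-index array that need not be a product of two vectors, as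
  arises when an operator acts on a null combination.\<close>

lemma sum_null_comb_nested:
  "(\<Sum>a<3. mconst (metric_sign a) *
      null_comb a (null_comb a p q r) (null_comb a p' q' r') (null_comb a p'' q'' r'')) =
    mconst (1 / 2) * (r + p'') - q'"
proof -
  define h :: "'a mpoly" where "h = mconst (1 / 2)"
  have h: "h + h = 1" unfolding h_def by (rule half_half)
  have "h * (h * (p + r) + h * (p'' + r'')) - h * (h * (p - r) - h * (p'' - r'')) - q' =
      (h + h) * (h * (r + p'')) - q'"
    by (simp add: algebra_simps)
  then have "h * (h * (p + r) + h * (p'' + r'')) - h * (h * (p - r) - h * (p'' - r'')) - q' = h * (r + p'') - q'"
    unfolding h by simp
  then show ?thesis
    by (simp add: less_3 null_comb_def metric_sign_def mconst_minus h_def)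
qed

lemma null_diff_add: "null_diff a i j (p + q) = null_diff a i j p + null_diff a i j q"
  by (simp add: null_diff_def pdiff_add null_comb_add)

lemma null_diff_mconst_mult: "null_diff a i j (mconst c * p) = mconst c * null_diff a i j p"
  by (simp add: null_diff_def pdiff_mconst_mult null_comb_mult pdiff_uminus)

lemma null_diff_0: "null_diff a i j 0 = 0"
  using null_diff_mconst_mult[of a i j 0 0] by simp

lemma null_diff_uminus: "null_diff a i j (- p) = - null_diff a i j p"
  using null_diff_mconst_mult[of a i j "-1" p] by (simp add: mconst_minus)

lemma null_diff_null_comb:
  "null_diff a i j (null_comb b p q r) =
    null_comb b (null_diff a i j p) (null_diff a i j q) (null_diff a i j r)"
  using null_diff_add[of a i j p "- r"]
  by (simp add: null_comb_def null_diff_add null_diff_mconst_mult null_diff_uminus)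

lemma null_diff_mult_left:
  assumes "dx i j f = 0" "dy i j f = 0"
  shows "null_diff a i j (f * p) = f * null_diff a i j p"
  using assms by (simp add: null_diff_def pdiff_mult null_comb_mult)

lemma pdiff_null_diff: "pdiff v (null_diff a i j p) = null_diff a i j (pdiff v p)"
proof -
  have "pdiff v (dx i j (dx i j p)) = dx i j (dx i j (pdiff v p))"
    "pdiff v (dy i j (dy i j p)) = dy i j (dy i j (pdiff v p))"
    "pdiff v (dx i j (dy i j p)) = dx i j (dy i j (pdiff v p))"
    by (metis pdiff_commute)+
  then show ?thesis by (simp add: null_diff_def pdiff_null_comb pdiff_uminus)
qed

lemma pdiff_null_vec:
  assumes "fst v \<noteq> i \<or> fst (snd v) \<noteq> j"
  shows "pdiff v (null_vec a i j) = 0"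
  using assms by (cases v) (auto simp: null_vec_def pdiff_null_comb pdiff_simps null_comb_def)

subsection \<open>Homogeneity\<close>

definition euler :: "nat \<Rightarrow> nat \<Rightarrow> spoly \<Rightarrow> spoly" where
  "euler i j p = sx i j * dx i j p + sy i j * dy i j p"

lemma euler_add: "euler i j (p + q) = euler i j p + euler i j q"
  by (simp add: euler_def pdiff_add algebra_simps)

lemma euler_mconst_mult: "euler i j (mconst c * p) = mconst c * euler i j p"
  by (simp add: euler_def pdiff_mult algebra_simps)

lemma euler_mconst [simp]: "euler i j (mconst c) = 0"
  by (simp add: euler_def)

lemma euler_mult: "euler i j (p * q) = euler i j p * q + p * euler i j q"
  by (simp add: euler_def pdiff_mult algebra_simps)

text \<open>The contraction is half of x^2 d_x^2 + 2 x y d_x d_y + y^2 d_y^2 = E (E - 1), with E the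
  Euler operator. In the opposite order, treated next, commuting adds 3 E + 3.\<close>

lemma null_vec_null_diff:
  assumes "euler i j p = mconst c * p"
  shows "(\<Sum>a<3. mconst (metric_sign a) * (null_vec a i j * null_diff a i j p)) = mconst (c * (c - 1) / 2) * p"
proof -
  let ?x = "sx i j" and ?y = "sy i j"
  have "euler i j (euler i j p) = mconst (c * c) * p"
    unfolding assms euler_mconst_mult by (simp add: mconst_mult ac_simps)
  also have "euler i j (euler i j p) = euler i j p +
      (?x * ?x * dx i j (dx i j p) + 2 * (?x * ?y * dx i j (dy i j p)) + ?y * ?y * dy i j (dy i j p))"
    using pdiff_commute[of "(i, j, True)" "(i, j, False)" p]
    by (simp add: euler_def pdiff_simps algebra_simps)
  finally have "?x * ?x * dx i j (dx i j p) + 2 * (?x * ?y * dx i j (dy i j p)) + ?y * ?y * dy i j (dy i j p) =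
      mconst (c * (c - 1)) * p"
    unfolding assms by (simp add: mconst_diff algebra_simps)
  note e = this[symmetric]
  have "mconst (1 / 2) * (mconst (c * (c - 1)) * p) =
      mconst (1 / 2) * (?x * ?x * dx i j (dx i j p) + ?y * ?y * dy i j (dy i j p)) +
      (mconst (1 / 2) * 2) * (?x * ?y * dx i j (dy i j p))"
    unfolding e by (simp only: distrib_left mult.assoc add_ac)
  then show ?thesis
    unfolding half_half null_vec_def null_diff_def sum_null_comb
    by (simp add: mconst_mult[symmetric] mult.assoc[symmetric])
qed

lemma null_diff_null_vec:
  assumes "euler i j p = mconst c * p"
  shows "(\<Sum>a<3. mconst (metric_sign a) * null_diff a i j (null_vec a i j * p)) =
    mconst ((c + 2) * (c + 3) / 2) * p"
proof -
  let ?x = "sx i j" and ?y = "sy i j"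
  have "(\<Sum>a<3. mconst (metric_sign a) * null_diff a i j (null_vec a i j * p)) =
      (\<Sum>a<3. mconst (metric_sign a) * (null_vec a i j * null_diff a i j p)) + 3 * euler i j p + 3 * p"
  proof -
    let ?h = "mconst (1 / 2)"
    have *: "dx i j (dy i j (?x * ?y * p)) = p + euler i j p + ?x * ?y * dx i j (dy i j p)"
      "dy i j (dy i j (?y * ?y * p)) = 2 * p + 4 * (?y * dy i j p) + ?y * ?y * dy i j (dy i j p)"
      "dx i j (dx i j (?x * ?x * p)) = 2 * p + 4 * (?x * dx i j p) + ?x * ?x * dx i j (dx i j p)"
      by (simp_all add: pdiff_simps euler_def algebra_simps)
    have "?h * (dy i j (dy i j (?y * ?y * p)) + dx i j (dx i j (?x * ?x * p))) + dx i j (dy i j (?x * ?y * p)) =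
        ?h * (?y * ?y * dy i j (dy i j p) + ?x * ?x * dx i j (dx i j p)) + ?x * ?y * dx i j (dy i j p) +
        (?h + ?h) * (2 * p + 2 * euler i j p) + p + euler i j p"
      unfolding * by (simp add: euler_def algebra_simps)
    moreover have nv: "null_vec a i j * p = null_comb a (?x * ?x * p) (?x * ?y * p) (?y * ?y * p)" for a
      by (simp add: null_vec_def null_comb_mult)
    have "(\<Sum>a<3. mconst (metric_sign a) * null_diff a i j (null_vec a i j * p)) =
        ?h * (dy i j (dy i j (?y * ?y * p)) + dx i j (dx i j (?x * ?x * p))) + dx i j (dy i j (?x * ?y * p))"
      unfolding nv null_diff_def pdiff_null_comb minus_null_comb sum_null_comb_nested by simp
    moreover have "(\<Sum>a<3. mconst (metric_sign a) * (null_vec a i j * null_diff a i j p)) =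
        ?h * (?y * ?y * dy i j (dy i j p) + ?x * ?x * dx i j (dx i j p)) + ?x * ?y * dx i j (dy i j p)"
      unfolding null_vec_def null_diff_def sum_null_comb by (simp add: algebra_simps)
    ultimately show ?thesis unfolding half_half by (simp add: algebra_simps)
  qed
  then show ?thesis
    unfolding null_vec_null_diff[OF assms] assms
    unfolding mconst_numeral[symmetric] mult.assoc[symmetric] mconst_mult[symmetric] distrib_right[symmetric] mconst_add[symmetric]
    by (simp add: field_simps)
qed

lemma null_vec_null_vec: "(\<Sum>a<3. mconst (metric_sign a) * (null_vec a i j * null_vec a i j)) = 0"
proof -
  have "mconst (1 / 2) * 2 * (sx i j * sx i j * (sy i j * sy i j)) = sx i j * sx i j * (sy i j * sy i j)"
    unfolding half_half by simp
  then show ?thesis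
    unfolding null_vec_def sum_null_comb by (simp add: algebra_simps)
qed

lemma null_diff_null_diff:
  "(\<Sum>a<3. mconst (metric_sign a) * null_diff a i j (null_diff a i j p)) = 0"
proof -
  let ?q = "dx i j (dx i j (dy i j (dy i j p)))"
  have c: "dy i j (dx i j q) = dx i j (dy i j q)" for q
    by (rule pdiff_commute)
  have "mconst (1 / 2) * (?q + ?q) = (mconst (1 / 2) * 2) * ?q" by (simp add: algebra_simps)
  then show ?thesis
    unfolding half_half null_diff_def pdiff_null_comb minus_null_comb sum_null_comb_nested c
    by (simp add: pdiff_uminus c)
qed

lemma euler_pdiff: "euler i j (dx i j p) = dx i j (euler i j p) - dx i j p"
  "euler i j (dy i j p) = dy i j (euler i j p) - dy i j p"
  using pdiff_commute[of "(i, j, True)" "(i, j, False)" p] by (simp_all add: euler_def pdiff_simps)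

lemma euler_null_comb: "euler i j (null_comb a p q r) = null_comb a (euler i j p) (euler i j q) (euler i j r)"
  by (simp add: euler_def pdiff_null_comb null_comb_mult null_comb_add)

lemma hom_pdiff:
  assumes "euler i j p = mconst c * p"
  shows "euler i j (dx i j p) = mconst (c - 1) * dx i j p" "euler i j (dy i j p) = mconst (c - 1) * dy i j p"
  unfolding euler_pdiff assms by (simp_all add: pdiff_mult mconst_diff algebra_simps)

lemma hom_null_diff:
  assumes "euler i j p = mconst c * p"
  shows "euler i j (null_diff a i j p) = mconst (c - 2) * null_diff a i j p"
proof -
  have "euler i j (- dx i j (dy i j p)) = mconst (c - 2) * - dx i j (dy i j p)"
    using hom_pdiff(1)[OF hom_pdiff(2)[OF assms]] euler_mconst_mult[of i j "-1"]
    by (simp add: mconst_minus)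
  then show ?thesis
    using hom_pdiff(1)[OF hom_pdiff(1)[OF assms]] hom_pdiff(2)[OF hom_pdiff(2)[OF assms]]
    by (simp add: null_diff_def euler_null_comb null_comb_mult)
qed

lemma euler_null_vec: "euler i j (null_vec a i j) = mconst 2 * null_vec a i j"
proof -
  have "euler i j (sx i j) = sx i j" "euler i j (sy i j) = sy i j"
    by (simp_all add: euler_def pdiff_mvar)
  then show ?thesis
    by (simp add: null_vec_def euler_null_comb euler_mult null_comb_mult mconst_numeral)
qed

lemma euler_null_vec_other: "k \<noteq> j \<Longrightarrow> euler i k (null_vec a i j) = 0"
  by (simp add: euler_def pdiff_null_vec)

lemma euler_null_diff_other:
  assumes "k \<noteq> j"
  shows "euler i k (null_diff a i j p) = null_diff a i j (euler i k p)"
  using assms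
  by (simp add: euler_def null_diff_add pdiff_null_diff null_diff_mult_left pdiff_mvar)

text \<open>These closure conditions are what the contraction across an edge needs: only spinors of
  face i occur, the degree in the spinor of ij is twice the spin, and the lengths of the three edges
  off the face do not matter.\<close>

definition face_family :: "nat \<Rightarrow> (real ^ edge \<Rightarrow> spoly) \<Rightarrow> bool" where
  "face_family i F \<longleftrightarrow>
     (\<forall>l p q. p \<noteq> i \<longrightarrow> dx p q (F l) = 0 \<and> dy p q (F l) = 0) \<and>
     (\<forall>l j. (i, j) \<in> half_edges \<longrightarrow> euler i j (F l) = mconst (2 * l $ edge i j - 1) * F l) \<and>
     (\<forall>l p q v. (p, q) \<in> half_edges \<and> p \<noteq> i \<and> q \<noteq> i \<longrightarrow> F (l + axis (edge p q) v) = F l)"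

lemma edge_eq_iff:
  assumes "(i, j) \<in> half_edges" "(p, q) \<in> half_edges"
  shows "edge i j = edge p q \<longleftrightarrow> (i, j) = (p, q) \<or> (i, j) = (q, p)"
  by (rule half_edges_cases[OF assms(1)]; rule half_edges_cases[OF assms(2)]; simp)

lemma vec_mult_eq:
  "vec_mult i j a F l = mconst (1 / (2 * l $ edge i j)) * null_diff a i j (F (l + axis (edge i j) 1)) +
    mconst (1 / (2 * l $ edge i j)) * (null_vec a i j * F (l + axis (edge i j) (- 1)))"
  by (simp add: vec_mult_def distrib_left)

lemma face_family_vec_mult:
  assumes F: "face_family i F" and ij: "(i, j) \<in> half_edges"
  shows "face_family i (vec_mult i j a F)"
  unfolding face_family_def
proof (intro conjI allI impI)
  fix l p q assume "p \<noteq> i"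
  then have "dx p q (F l') = 0" "dy p q (F l') = 0" for l'
    using F by (auto simp: face_family_def)
  with \<open>p \<noteq> i\<close> have "pdiff v (vec_mult i j a F l) = 0" if "v = (p, q, False) \<or> v = (p, q, True)" for v
    using that
    by (auto simp: vec_mult_def pdiff_mult pdiff_add pdiff_null_diff pdiff_null_vec null_diff_0)
  then show "dx p q (vec_mult i j a F l) = 0" "dy p q (vec_mult i j a F l) = 0" by auto
next
  fix l k assume ik: "(i, k) \<in> half_edges"
  have hom: "euler i k (F l') = mconst (2 * l' $ edge i k - 1) * F l'" for l'
    using F ik by (simp add: face_family_def)
  show "euler i k (vec_mult i j a F l) = mconst (2 * l $ edge i k - 1) * vec_mult i j a F l"
  proof (cases "k = j")
    case True
    let ?c = "2 * l $ edge i j - 1"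
    have "euler i j (null_diff a i j (F (l + axis (edge i j) 1))) =
        mconst ?c * null_diff a i j (F (l + axis (edge i j) 1))"
      using hom_null_diff[OF hom[of "l + axis (edge i j) 1", unfolded True], of a]
      by (simp add: axis_def algebra_simps)
    moreover have "euler i j (null_vec a i j * F (l + axis (edge i j) (- 1))) =
        mconst ?c * (null_vec a i j * F (l + axis (edge i j) (- 1)))"
    proof -
      have "euler i j (null_vec a i j * F (l + axis (edge i j) (- 1))) =
          (mconst 2 + mconst (?c - 2)) * (null_vec a i j * F (l + axis (edge i j) (- 1)))"
        unfolding euler_mult euler_null_vec hom[unfolded True] by (simp add: axis_def algebra_simps)
      then show ?thesis unfolding mconst_add[symmetric] by simp
    qed
    ultimately show ?thesis
      unfolding True vec_mult_eq euler_add euler_mconst_mult by (simp add: algebra_simps)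
  next
    case False
    then have "edge i k \<noteq> edge i j"
      using edge_eq_iff[OF ik ij] ij by (auto simp: half_edges_def)
    then have "(l + axis (edge i j) v) $ edge i k = l $ edge i k" for v by (simp add: axis_def)
    with False show ?thesis
      unfolding vec_mult_eq euler_add euler_mconst_mult euler_null_diff_other[OF False] euler_mult
        euler_null_vec_other[OF False] hom null_diff_mconst_mult
      by (simp add: algebra_simps)
  qed
next
  fix l p q v assume pq: "(p, q) \<in> half_edges \<and> p \<noteq> i \<and> q \<noteq> i"
  then have "edge i j \<noteq> edge p q" using edge_eq_iff[OF ij, of p q] by auto
  moreover have "F (l + axis (edge p q) v + axis (edge i j) w) = F (l + axis (edge i j) w)" for w
  proof -
    have "F (l + axis (edge i j) w + axis (edge p q) v) = F (l + axis (edge i j) w)"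
      using F pq unfolding face_family_def by blast
    then show ?thesis by (simp only: add_ac)
  qed
  ultimately show "vec_mult i j a F (l + axis (edge p q) v) = vec_mult i j a F l"
    by (simp add: vec_mult_def axis_def)
qed

text \<open>Different edges of a face have different spinors and different lengths, so all
  ingredients commute. Two components through the same edge are compared later, on
  \<open>face_poly\<close> only, by a detour over the other edges.\<close>

lemma vec_mult_commute:
  assumes ij: "(i, j) \<in> half_edges" and ik: "(i, k) \<in> half_edges" and "j \<noteq> k"
  shows "vec_mult i j a (vec_mult i k b F) l = vec_mult i k b (vec_mult i j a F) l"
proof -
  have "edge i j \<noteq> edge i k"
    using edge_eq_iff[OF ij ik] assms by (auto simp: half_edges_def)
  then have e: "(l + axis (edge i j) v) $ edge i k = l $ edge i k" "(l + axis (edge i k) v) $ edge i j = l $ edge i j" for v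
    by (simp_all add: axis_def)
  have s: "F (l + axis (edge i k) w + axis (edge i j) v) = F (l + axis (edge i j) v + axis (edge i k) w)" for v w
    by (simp add: ac_simps)
  have nd: "null_diff a i j (null_diff b i k p) = null_diff b i k (null_diff a i j p)" for p
    unfolding null_diff_def[of b] null_diff_null_comb null_diff_uminus pdiff_null_diff ..
  have z: "dx i j (null_vec b i k) = 0" "dy i j (null_vec b i k) = 0" "dx i k (null_vec a i j) = 0" "dy i k (null_vec a i j) = 0"
    using \<open>j \<noteq> k\<close> by (simp_all add: pdiff_null_vec)
  show ?thesis
    unfolding vec_mult_eq e s null_diff_add null_diff_mconst_mult nd
      null_diff_mult_left[OF z(1,2)] null_diff_mult_left[OF z(3,4)]
    by (simp only: distrib_left mult_ac add_ac)
qed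

lemma axis_plus_minus: "(l::real ^ edge) + axis e 1 + axis e (- 1) = l" "l + axis e (- 1) + axis e 1 = l"
  by (simp_all add: vec_eq_iff axis_def)

text \<open>The algebraic form of n_i . n_i = 1, matching the diagonal entries of the determinant.
  The terms shifted twice in the same direction vanish because the vectors are null; with x the
  length, the other two give (2x+1)/(4x) and (2x-1)/(4x). The bound on the length keeps the inner
  denominator 2 (x - 1) nonzero.\<close>

lemma sum_vec_mult_vec_mult:
  assumes F: "face_family i F" and ij: "(i, j) \<in> half_edges" and l: "l $ edge i j > 1"
  shows "(\<Sum>a<3. mconst (metric_sign a) * vec_mult i j a (vec_mult i j a F) l) = F l"
proof -
  define x where "x = l $ edge i j"
  let ?p = "F (l + axis (edge i j) 1 + axis (edge i j) 1)" and ?m = "F (l + axis (edge i j) (- 1) + axis (edge i j) (- 1))"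
  let ?c = "mconst (1 / (2 * x)) :: spoly" and ?cp = "mconst (1 / (2 * (x + 1))) :: spoly"
    and ?cm = "mconst (1 / (2 * (x - 1))) :: spoly"
  have hom: "euler i j (F l) = mconst (2 * x - 1) * F l"
    using F ij by (simp add: face_family_def x_def)
  have "mconst (metric_sign a) * vec_mult i j a (vec_mult i j a F) l =
      ?c * ?cp * (mconst (metric_sign a) * null_diff a i j (null_diff a i j ?p)) +
      ?c * ?cp * (mconst (metric_sign a) * null_diff a i j (null_vec a i j * F l)) +
      ?c * ?cm * (mconst (metric_sign a) * (null_vec a i j * null_diff a i j (F l))) +
      ?c * ?cm * (mconst (metric_sign a) * (null_vec a i j * null_vec a i j)) * ?m" for a
    by (simp add: vec_mult_eq null_diff_add null_diff_mconst_mult axis_plus_minus x_def[symmetric])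
      (simp add: axis_def x_def[symmetric] algebra_simps)
  then have "(\<Sum>a<3. mconst (metric_sign a) * vec_mult i j a (vec_mult i j a F) l) =
      ?c * ?cp * (\<Sum>a<3. mconst (metric_sign a) * null_diff a i j (null_diff a i j ?p)) +
      ?c * ?cp * (\<Sum>a<3. mconst (metric_sign a) * null_diff a i j (null_vec a i j * F l)) +
      ?c * ?cm * (\<Sum>a<3. mconst (metric_sign a) * (null_vec a i j * null_diff a i j (F l))) +
      ?c * ?cm * (\<Sum>a<3. mconst (metric_sign a) * (null_vec a i j * null_vec a i j)) * ?m"
    by (simp only: sum.distrib sum_distrib_left sum_distrib_right)
  also have "\<dots> = mconst (1 / (2 * x) * (1 / (2 * (x + 1))) * ((2 * x - 1 + 2) * (2 * x - 1 + 3) / 2) +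
      1 / (2 * x) * (1 / (2 * (x - 1))) * ((2 * x - 1) * (2 * x - 1 - 1) / 2)) * F l"
    unfolding null_diff_null_diff null_diff_null_vec[OF hom] null_vec_null_diff[OF hom] null_vec_null_vec
    by (simp only: mconst_add mconst_mult distrib_right mult.assoc mult_zero_left mult_zero_right add_0_left add_0_right)
  also have "1 / (2 * x) * (1 / (2 * (x + 1))) * ((2 * x - 1 + 2) * (2 * x - 1 + 3) / 2) +
      1 / (2 * x) * (1 / (2 * (x - 1))) * ((2 * x - 1) * (2 * x - 1 - 1) / 2) = 1"
  proof -
    have "x + 1 \<noteq> 0" "x - 1 \<noteq> 0" "x \<noteq> 0" using l by (simp_all add: x_def)
    have e: "(2 * x - 1 + 2) * (2 * x - 1 + 3) / 2 = (2 * x + 1) * (x + 1)"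
      "(2 * x - 1) * (2 * x - 1 - 1) / 2 = (2 * x - 1) * (x - 1)"
      by (simp_all add: field_simps)
    have c: "1 / (2 * x) * (1 / (2 * y)) * (z * y) = z / (4 * x)" if "y \<noteq> 0" for y z
      using that by simp
    have "(2 * x + 1) / (4 * x) + (2 * x - 1) / (4 * x) = 1"
      using \<open>x \<noteq> 0\<close> by (simp add: field_simps)
    then show ?thesis unfolding e c[OF \<open>x + 1 \<noteq> 0\<close>] c[OF \<open>x - 1 \<noteq> 0\<close>] .
  qed
  finally show ?thesis by simp
qed


section \<open>The faces\<close>

definition face_poly :: "nat \<Rightarrow> real ^ edge \<Rightarrow> spoly" where
  "face_poly i l = (let j = (if i = 1 then 2 else 1); k = nx i j; m = nx i k in
     mconst (face_weight i l) * (dpow (corner (i, j)) (corner_num l (i, j)) *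
       dpow (corner (i, k)) (corner_num l (i, k)) * dpow (corner (i, m)) (corner_num l (i, m))))"

lemma face_poly_eq:
  assumes "(i, j) \<in> half_edges"
  defines "k \<equiv> nx i j" defines "m \<equiv> nx i k"
  shows "face_poly i l =
    mconst (beta_weight (corner_num l (i, j)) (corner_num l (i, k)) (corner_num l (i, m))) *
      (dpow (corner (i, j)) (corner_num l (i, j)) * dpow (corner (i, k)) (corner_num l (i, k)) *
       dpow (corner (i, m)) (corner_num l (i, m)))"
  using half_edges_cases[OF assms(1)]
  by cases (simp_all add: face_poly_def face_weight_def k_def m_def nx_def Let_def ac_simps
      beta_weight_commute)

lemma corners_at:
  assumes "(i, j) \<in> half_edges"
  defines "k \<equiv> nx i j" defines "m \<equiv> nx i k"
  shows "(i, k) \<in> half_edges" "(i, m) \<in> half_edges" "nx i m = j" "j \<noteq> k" "k \<noteq> m" "j \<noteq> m"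
    "corner (i, j) = bracket i k i m" "corner (i, k) = bracket i m i j" "corner (i, m) = bracket i j i k"
    "corner_num l (i, j) = l $ edge i k + l $ edge i m - l $ edge i j - 1 / 2"
    "corner_num l (i, k) = l $ edge i m + l $ edge i j - l $ edge i k - 1 / 2"
    "corner_num l (i, m) = l $ edge i j + l $ edge i k - l $ edge i m - 1 / 2"
proof -
  show H: "(i, k) \<in> half_edges" "(i, m) \<in> half_edges"
    using nx_half_edge assms by auto
  show m: "nx i m = j" using nx_nx_nx assms by auto
  show "j \<noteq> k" "k \<noteq> m" "j \<noteq> m"
    using nx_neq[OF assms(1)] nx_neq[OF H(1)] nx_neq[OF H(2)] m by (auto simp: k_def m_def)
  show "corner (i, j) = bracket i k i m" "corner (i, k) = bracket i m i j" "corner (i, m) = bracket i j i k"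
    unfolding corner_def using m by (simp_all add: k_def m_def)
  show "corner_num l (i, j) = l $ edge i k + l $ edge i m - l $ edge i j - 1 / 2"
    "corner_num l (i, k) = l $ edge i m + l $ edge i j - l $ edge i k - 1 / 2"
    "corner_num l (i, m) = l $ edge i j + l $ edge i k - l $ edge i m - 1 / 2"
    unfolding corner_num_def using m by (simp_all add: k_def m_def)
qed

lemma euler_dpow: "euler i j b = b \<Longrightarrow> euler i j (dpow b \<nu>) = mconst \<nu> * dpow b \<nu>"
  "euler i j b = 0 \<Longrightarrow> euler i j (dpow b \<nu>) = 0"
proof -
  have "euler i j (dpow b \<nu>) = euler i j b * dpow b (\<nu> - 1)"
    by (simp add: euler_def pdiff_dpow algebra_simps)
  then show "euler i j b = b \<Longrightarrow> euler i j (dpow b \<nu>) = mconst \<nu> * dpow b \<nu>"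
    "euler i j b = 0 \<Longrightarrow> euler i j (dpow b \<nu>) = 0"
    by (simp_all add: dpow_rec)
qed

lemma face_family_face_poly:
  assumes "i \<in> {1..4}"
  shows "face_family i (face_poly i)"
  unfolding face_family_def
proof (intro conjI allI impI)
  fix l p q assume "p \<noteq> i"
  then show "dx p q (face_poly i l) = 0" "dy p q (face_poly i l) = 0"
    by (simp_all add: face_poly_def Let_def pdiff_mult pdiff_dpow corner_def bracket_def pdiff_simps)
next
  fix l j assume ij: "(i, j) \<in> half_edges"
  define k m where "k = nx i j" and "m = nx i k"
  note c = corners_at[OF ij, folded k_def, folded m_def]
  have e: "euler i j (bracket i k i m) = 0" "euler i j (bracket i m i j) = bracket i m i j"
    "euler i j (bracket i j i k) = bracket i j i k"
    using c(4-6) by (simp_all add: euler_def bracket_def pdiff_simps algebra_simps)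
  have "mconst (corner_num l (i, k)) + mconst (corner_num l (i, m)) = (mconst (2 * l $ edge i j - 1) :: spoly)"
    unfolding mconst_add[symmetric] c by (simp add: algebra_simps)
  then have s: "mconst (corner_num l (i, k)) * p + mconst (corner_num l (i, m)) * p = mconst (2 * l $ edge i j - 1) * p" for p :: spoly
    by (metis distrib_right)
  have "euler i j (face_poly i l) = mconst (corner_num l (i, k)) * face_poly i l + mconst (corner_num l (i, m)) * face_poly i l"
    unfolding face_poly_eq[OF ij, folded k_def, folded m_def] c(7-9) euler_mconst_mult euler_mult
      euler_dpow(2)[OF e(1)] euler_dpow(1)[OF e(2)] euler_dpow(1)[OF e(3)]
    by (simp add: algebra_simps)
  then show "euler i j (face_poly i l) = mconst (2 * l $ edge i j - 1) * face_poly i l"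
    unfolding s .
next
  fix l p q v assume pq: "(p, q) \<in> half_edges \<and> p \<noteq> i \<and> q \<noteq> i"
  have "(i, if i = 1 then 2 else 1) \<in> half_edges" using assms by (auto simp: half_edges_def)
  note c = corners_at[OF this]
  have "edge i j \<noteq> edge p q" if "(i, j) \<in> half_edges" for j
    using edge_eq_iff[OF that, of p q] pq by auto
  then have "corner_num (l + axis (edge p q) v) (i, j) = corner_num l (i, j)" if "(i, j) \<in> half_edges" for j
    using that nx_half_edge by (simp add: corner_num_def axis_def)
  then show "face_poly i (l + axis (edge p q) v) = face_poly i l"
    using c(1,2) \<open>(i, if i = 1 then 2 else 1) \<in> half_edges\<close>
    by (simp add: face_poly_def face_weight_def Let_def)
qed

section \<open>The vector operators on a face polynomial\<close>

lemma null_diff_dpow_prod: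
  fixes i j k m :: nat
  assumes "j \<noteq> k" "j \<noteq> m"
  defines "q \<equiv> bracket i m i j" and "r \<equiv> bracket i j i k"
  shows "null_diff a i j (dpow q (\<nu> + 1) * dpow r (\<mu> + 1)) =
    null_vec a i m * (dpow q (\<nu> - 1) * dpow r (\<mu> + 1)) + null_vec a i k * (dpow q (\<nu> + 1) * dpow r (\<mu> - 1)) -
    null_comb a (2 * (sx i k * sx i m)) (sx i k * sy i m + sy i k * sx i m) (2 * (sy i k * sy i m)) *
      (dpow q \<nu> * dpow r \<mu>)"
proof -
  have d: "dx i j q = - sy i m" "dy i j q = sx i m" "dx i j r = sy i k" "dy i j r = - sx i k"
    using assms(1,2) by (simp_all add: q_def r_def bracket_def pdiff_simps)
  have z: "pdiff v (sx i k) = 0" "pdiff v (sx i m) = 0" "pdiff v (sy i k) = 0" "pdiff v (sy i m) = 0"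
    if "v \<in> {(i, j, False), (i, j, True)}" for v
    using that assms(1,2) by (auto simp: pdiff_mvar)
  have n: "\<nu> + 1 - 1 = \<nu>" "\<mu> + 1 - 1 = \<mu>" by simp_all
  have d2: "dy i j (dy i j (dpow q (\<nu> + 1) * dpow r (\<mu> + 1))) =
      sx i m * sx i m * (dpow q (\<nu> - 1) * dpow r (\<mu> + 1)) + sx i k * sx i k * (dpow q (\<nu> + 1) * dpow r (\<mu> - 1))
      - 2 * (sx i k * sx i m) * (dpow q \<nu> * dpow r \<mu>)"
    "- dx i j (dy i j (dpow q (\<nu> + 1) * dpow r (\<mu> + 1))) =
      sx i m * sy i m * (dpow q (\<nu> - 1) * dpow r (\<mu> + 1)) + sx i k * sy i k * (dpow q (\<nu> + 1) * dpow r (\<mu> - 1))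
      - (sx i k * sy i m + sy i k * sx i m) * (dpow q \<nu> * dpow r \<mu>)"
    "dx i j (dx i j (dpow q (\<nu> + 1) * dpow r (\<mu> + 1))) =
      sy i m * sy i m * (dpow q (\<nu> - 1) * dpow r (\<mu> + 1)) + sy i k * sy i k * (dpow q (\<nu> + 1) * dpow r (\<mu> - 1))
      - 2 * (sy i k * sy i m) * (dpow q \<nu> * dpow r \<mu>)"
    by (simp_all add: pdiff_mult pdiff_add pdiff_diff pdiff_uminus pdiff_dpow n d z algebra_simps)
  show ?thesis
    unfolding null_diff_def null_vec_def d2 null_comb_mult(1)
    by (simp add: null_comb_def algebra_simps)
qed

lemma dpow_raise:
  assumes "\<nu> > 0"
  shows "dpow b \<nu> = mconst (1 / \<nu>) * (b * dpow b (\<nu> - 1))"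
    and "dpow b (\<nu> + 1) = mconst (1 / ((\<nu> + 1) * \<nu>)) * (b * b * dpow b (\<nu> - 1))"
proof -
  have r: "dpow b \<nu> = mconst (1 / \<nu>) * (b * dpow b (\<nu> - 1))" if "\<nu> > 0" for \<nu>
    using that unfolding dpow_rec by (simp add: mult.assoc[symmetric] mconst_mult[symmetric])
  then show "dpow b \<nu> = mconst (1 / \<nu>) * (b * dpow b (\<nu> - 1))" using assms .
  have "dpow b (\<nu> + 1) = mconst (1 / (\<nu> + 1)) * (b * dpow b \<nu>)" using r[of "\<nu> + 1"] assms by simp
  also have "\<dots> = mconst (1 / (\<nu> + 1)) * mconst (1 / \<nu>) * (b * b * dpow b (\<nu> - 1))"
    by (subst r[OF assms]) (simp add: ac_simps)
  finally show "dpow b (\<nu> + 1) = mconst (1 / ((\<nu> + 1) * \<nu>)) * (b * b * dpow b (\<nu> - 1))"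
    by (simp add: mconst_mult[symmetric])
qed

text \<open>Schouten's identity, squared.\<close>

lemma bracket_null_vec:
  "bracket i k i m * bracket i k i m * null_vec a i j =
    bracket i m i j * bracket i m i j * null_vec a i k + bracket i j i k * bracket i j i k * null_vec a i m +
    bracket i m i j * bracket i j i k *
      null_comb a (2 * (sx i k * sx i m)) (sx i k * sy i m + sy i k * sx i m) (2 * (sy i k * sy i m))"
  unfolding null_vec_def null_comb_mult(2) null_comb_add bracket_def
  by (rule arg_cong3[of _ _ _ _ _ _ "null_comb a"]) (simp_all add: algebra_simps)

text \<open>The common factor of the weights of a face after lengthening and after shortening one
  edge by 1. The 4 comes from two applications of the functional equation of Gamma at
  half-arguments.\<close>

definition raised_weight :: "real \<Rightarrow> real \<Rightarrow> real \<Rightarrow> real" where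
  "raised_weight x y z = Gamma (x / 2) * Gamma (y / 2) * Gamma (z / 2) / Gamma ((x + y + z) / 2 + 2) / (2 * pi) / 4"

lemma beta_weight_raised:
  assumes "x > 0" "y > 0" "z > 0"
  shows "beta_weight (x - 1) (y + 1) (z + 1) = raised_weight x y z * y * z"
    and "beta_weight (x + 1) (y - 1) (z - 1) = raised_weight x y z * x * (x + y + z + 2)"
proof -
  have p: "Gamma (u / 2 + 1) = u / 2 * Gamma (u / 2)" if "u > 0" for u :: real
    using that by (intro Gamma_plus1) (auto simp: nonpos_Ints_def)
  have e: "(x - 1 + 1) / 2 = x / 2" "(x + 1 + 1) / 2 = x / 2 + 1" "(y - 1 + 1) / 2 = y / 2" "(y + 1 + 1) / 2 = y / 2 + 1"
    "(z - 1 + 1) / 2 = z / 2" "(z + 1 + 1) / 2 = z / 2 + 1"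
    "(x - 1 + (y + 1) + (z + 1) + 3) / 2 = (x + y + z) / 2 + 2"
    "(x + 1 + (y - 1) + (z - 1) + 3) / 2 = (x + y + z) / 2 + 1"
    by (simp_all add: field_simps)
  have "Gamma ((x + y + z) / 2 + 1 + 1) = ((x + y + z) / 2 + 1) * Gamma ((x + y + z) / 2 + 1)"
  proof (rule Gamma_plus1)
    have "(x + y + z) / 2 + 1 > 0" using assms by (simp add: add_pos_pos)
    then show "(x + y + z) / 2 + 1 \<notin> \<int>\<^sub>\<le>\<^sub>0" by (auto dest: nonpos_Ints_nonpos)
  qed
  then have g: "Gamma ((x + y + z) / 2 + 2) = ((x + y + z) / 2 + 1) * Gamma ((x + y + z) / 2 + 1)"
    by (simp add: add.assoc)
  have nz: "Gamma ((x + y + z) / 2 + 1) \<noteq> 0" "(x + y + z) / 2 + 1 \<noteq> 0"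
    using assms Gamma_real_pos[of "(x + y + z) / 2 + 1"] by (simp_all add: add_pos_pos less_imp_neq[symmetric])
  show "beta_weight (x - 1) (y + 1) (z + 1) = raised_weight x y z * y * z"
    unfolding beta_weight_def raised_weight_def e p[OF assms(2)] p[OF assms(3)] by simp
  have "P / (s * G) / (2 * pi) / 4 * x * (2 * s) = x / 2 * P / G / (2 * pi)" if "s \<noteq> 0" "G \<noteq> 0" for P s G :: real
    using that by (simp add: field_simps)
  from this[OF nz(2,1)]
  have "raised_weight x y z * x * (2 * ((x + y + z) / 2 + 1)) =
      x / 2 * (Gamma (x / 2) * Gamma (y / 2) * Gamma (z / 2)) / Gamma ((x + y + z) / 2 + 1) / (2 * pi)"
    unfolding raised_weight_def g .
  moreover have "2 * ((x + y + z) / 2 + 1) = x + y + z + 2" by simp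
  ultimately show "beta_weight (x + 1) (y - 1) (z - 1) = raised_weight x y z * x * (x + y + z + 2)"
    unfolding beta_weight_def e p[OF assms(1)] by (simp only: mult.assoc)
qed

text \<open>The right-hand side is invariant under rotating the three corners, although the
  left-hand side singles out the edge ij. This is where the particular weights enter.\<close>

lemma vec_mult_face_poly:
  fixes i j :: nat and l :: "real ^ edge"
  assumes ij: "(i, j) \<in> half_edges"
  defines "k \<equiv> nx i j" defines "m \<equiv> nx i k"
  defines "x \<equiv> corner_num l (i, j)" and "y \<equiv> corner_num l (i, k)" and "z \<equiv> corner_num l (i, m)"
  assumes pos: "x > 0" "y > 0" "z > 0"
  shows "vec_mult i j a (face_poly i) l =
    mconst (raised_weight x y z) * (dpow (corner (i, j)) (x - 1) * dpow (corner (i, k)) (y - 1) * dpow (corner (i, m)) (z - 1)) *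
     (mconst (1 / (x + 1)) * (corner (i, j) * corner (i, j) * null_vec a i j) +
      mconst (1 / (y + 1)) * (corner (i, k) * corner (i, k) * null_vec a i k) +
      mconst (1 / (z + 1)) * (corner (i, m) * corner (i, m) * null_vec a i m))"
proof -
  note c = corners_at[OF ij, folded k_def, folded m_def]
  define p q r where "p = bracket i k i m" and "q = bracket i m i j" and "r = bracket i j i k"
  have b: "corner (i, j) = p" "corner (i, k) = q" "corner (i, m) = r"
    unfolding p_def q_def r_def by (rule c(7-9))+
  define S where "S = null_comb a (2 * (sx i k * sx i m)) (sx i k * sy i m + sy i k * sx i m) (2 * (sy i k * sy i m))"
  define A B C where "A = p * p * null_vec a i j" and "B = q * q * null_vec a i k" and "C = r * r * null_vec a i m"
  define P where "P = dpow p (x - 1) * dpow q (y - 1) * dpow r (z - 1)"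
  let ?W = "raised_weight x y z" and ?c = "1 / (y + z + 1)"
  have len: "2 * l $ edge i j = y + z + 1" unfolding y_def z_def c by simp
  have ne: "edge i k \<noteq> edge i j" "edge i m \<noteq> edge i j"
    using edge_eq_iff[OF c(1) ij] edge_eq_iff[OF c(2) ij] c(4,6) ij by (auto simp: half_edges_def)
  have up: "face_poly i (l + axis (edge i j) 1) =
      mconst (?W * y * z) * (dpow p (x - 1) * (dpow q (y + 1) * dpow r (z + 1)))"
  proof -
    have "corner_num (l + axis (edge i j) 1) (i, j) = x - 1" "corner_num (l + axis (edge i j) 1) (i, k) = y + 1"
      "corner_num (l + axis (edge i j) 1) (i, m) = z + 1"
      unfolding x_def y_def z_def c(10-12) using ne by (simp_all add: axis_def)
    then show ?thesis
      using face_poly_eq[OF ij, folded k_def, folded m_def] beta_weight_raised(1)[OF pos] by (simp add: b mult.assoc)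
  qed
  have down: "face_poly i (l + axis (edge i j) (- 1)) =
      mconst (?W * x * (x + y + z + 2)) * (dpow p (x + 1) * dpow q (y - 1) * dpow r (z - 1))"
  proof -
    have "corner_num (l + axis (edge i j) (- 1)) (i, j) = x + 1" "corner_num (l + axis (edge i j) (- 1)) (i, k) = y - 1"
      "corner_num (l + axis (edge i j) (- 1)) (i, m) = z - 1"
      unfolding x_def y_def z_def c(10-12) using ne by (simp_all add: axis_def)
    then show ?thesis
      using face_poly_eq[OF ij, folded k_def, folded m_def] beta_weight_raised(2)[OF pos] by (simp add: b)
  qed
  have z: "dx i j (dpow p (x - 1)) = 0" "dy i j (dpow p (x - 1)) = 0"
    using c(4-6) by (simp_all add: p_def pdiff_dpow bracket_def pdiff_simps)
  have "vec_mult i j a (face_poly i) l =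
      mconst ?c * mconst (?W * y * z) * (dpow p (x - 1) * (null_vec a i m * (dpow q (y - 1) * dpow r (z + 1)) +
        null_vec a i k * (dpow q (y + 1) * dpow r (z - 1)) - S * (dpow q y * dpow r z))) +
      mconst ?c * mconst (?W * x * (x + y + z + 2)) * (null_vec a i j * (dpow p (x + 1) * dpow q (y - 1) * dpow r (z - 1)))"
    unfolding vec_mult_eq up down len null_diff_mconst_mult null_diff_mult_left[OF z] q_def r_def
      null_diff_dpow_prod[OF c(4,6)] S_def
    by (simp only: ac_simps)
  also have "\<dots> = P * (mconst (?c * (?W * y * z) * (1 / ((z + 1) * z))) * C +
      mconst (?c * (?W * y * z) * (1 / ((y + 1) * y))) * B -
      mconst (?c * (?W * y * z) * (1 / y * (1 / z))) * (q * r * S) +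
      mconst (?c * (?W * x * (x + y + z + 2)) * (1 / ((x + 1) * x))) * A)"
    unfolding dpow_raise(2)[OF pos(1)] dpow_raise[OF pos(2)] dpow_raise[OF pos(3)] P_def A_def B_def C_def mconst_mult
    by (simp only: distrib_left right_diff_distrib mult_ac)
  \<comment> \<open>Schouten's identity trades the mixed term for squares. By partial fractions the
    terms with denominator y + z + 1, which remember the edge ij, then cancel.\<close>
  also have "q * r * S = A - B - C"
    unfolding A_def B_def C_def S_def p_def q_def r_def bracket_null_vec[of i k m a j] by simp
  also have "?c * (?W * y * z) * (1 / ((z + 1) * z)) = ?W * (1 / (z + 1)) - ?W * ?c"
    using pos by (simp add: divide_simps) (simp add: algebra_simps)
  also have "?c * (?W * y * z) * (1 / ((y + 1) * y)) = ?W * (1 / (y + 1)) - ?W * ?c"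
    using pos by (simp add: divide_simps) (simp add: algebra_simps)
  also have "?c * (?W * x * (x + y + z + 2)) * (1 / ((x + 1) * x)) = ?W * (1 / (x + 1)) + ?W * ?c"
    using pos by (simp add: divide_simps) (simp add: algebra_simps)
  also have "?c * (?W * y * z) * (1 / y * (1 / z)) = ?W * ?c"
    using pos by simp
  also have "P * (mconst (?W * (1 / (z + 1)) - ?W * ?c) * C + mconst (?W * (1 / (y + 1)) - ?W * ?c) * B -
      mconst (?W * ?c) * (A - B - C) + mconst (?W * (1 / (x + 1)) + ?W * ?c) * A) =
      mconst ?W * P * (mconst (1 / (x + 1)) * A + mconst (1 / (y + 1)) * B + mconst (1 / (z + 1)) * C)"
    unfolding mconst_add mconst_diff mconst_mult by (simp add: algebra_simps)
  finally show ?thesis unfolding A_def B_def C_def P_def b .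
qed

lemma raised_weight_rotate: "raised_weight y z x = raised_weight x y z"
  by (simp add: raised_weight_def ac_simps)

lemma vec_mult_face_poly_indep:
  assumes "(i, j) \<in> half_edges" "(i, k) \<in> half_edges" "l \<in> region (Suc r)"
  shows "vec_mult i j a (face_poly i) l = vec_mult i k a (face_poly i) l"
proof -
  have pos: "corner_num l c > 0" if "c \<in> half_edges" for c
    using assms(3) that by (force simp: region_def)
  have rot: "vec_mult i j a (face_poly i) l = vec_mult i (nx i j) a (face_poly i) l"
    if ij: "(i, j) \<in> half_edges" for j
  proof -
    note c = corners_at[OF ij]
    note e = vec_mult_face_poly[OF ij pos[OF ij] pos[OF c(1)] pos[OF c(2)], of a]
      vec_mult_face_poly[OF c(1), of l a, unfolded c(3), OF pos[OF c(1)] pos[OF c(2)] pos[OF ij]]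
    show ?thesis
      unfolding e raised_weight_rotate[of "corner_num l (i, nx i j)" _ "corner_num l (i, j)"]
      by (simp only: ac_simps)
  qed
  have "k = j \<or> k = nx i j \<or> k = nx i (nx i j)"
    using half_edges_cases[OF assms(1)] by cases (use assms(2) in \<open>auto simp: half_edges_def nx_def\<close>)
  then show ?thesis
    using rot[OF assms(1)] rot[OF nx_half_edge[OF assms(1)]] by auto
qed


section \<open>The shift operators act by multiplication with scalar products\<close>

lemma orient_sq: "orient i j * orient i j = 1"
  by (simp add: orient_def)

text \<open>Multiplication by the null vector at one end of an edge is adjoint to the differential
  operator at the other end. Two spinors are contracted, so the orientation sign is squared
  away.\<close>

lemma wick_null_vec:
  assumes "(i, j) \<in> half_edges"
  shows "wick (null_vec a i j * p) = wick (null_diff a j i p)"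
proof -
  have z: "dy j i (sy i j * p) = sy i j * dy j i p" for p
    using assms by (auto simp: pdiff_mult pdiff_mvar half_edges_def)
  have "wick (sx i j * sx i j * p) = wick (dy j i (dy j i p))"
    "wick (sx i j * sy i j * p) = wick (- dx j i (dy j i p))"
    "wick (sy i j * sy i j * p) = wick (dx j i (dx j i p))"
  proof -
    have o: "orient i j * (orient i j * c) = c" for c
      using orient_sq by (simp add: mult.assoc[symmetric])
    have "dy j i (sx i j * p) = sx i j * dy j i p" "dx j i (sy i j * p) = sy i j * dx j i p"
      using assms by (auto simp: pdiff_mult pdiff_mvar half_edges_def)
    then show "wick (sx i j * sx i j * p) = wick (dy j i (dy j i p))"
      "wick (sx i j * sy i j * p) = wick (- dx j i (dy j i p))"
      "wick (sy i j * sy i j * p) = wick (dx j i (dx j i p))"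
      by (simp_all add: mult.assoc wick_sx[OF assms] wick_sy[OF assms] z o wick_simps)
  qed
  then show ?thesis
    by (simp add: null_vec_def null_diff_def null_comb_def distrib_right left_diff_distrib mult.assoc wick_simps)
qed

lemma wick_null_diff:
  assumes "(i, j) \<in> half_edges" "dx i j q = 0" "dy i j q = 0"
  shows "wick (null_diff a i j p * q) = wick (p * (null_vec a j i * q))"
  using wick_null_vec[OF half_edges_swap[OF assms(1)], of a "q * p"] null_diff_mult_left[OF assms(2,3), of a p]
  by (simp add: ac_simps)

lemma wick_sum: "wick (p * (\<Sum>a\<in>A. mconst (c a) * f a)) = (\<Sum>a\<in>A. c a * wick (p * f a))"
proof -
  have "p * (\<Sum>a\<in>A. mconst (c a) * f a) = (\<Sum>a\<in>A. mconst (c a) * (p * f a))"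
    by (simp add: sum_distrib_left ac_simps)
  then show ?thesis by (simp add: wick_simps)
qed

lemma edge_swap: "edge j i = edge i j"
  by (simp add: edge_def insert_commute)

text \<open>The scalar product n_i . n_j acts as X_ij. Everything is moved to the end (j, i); of the
  four products the two mixing a raised with a lowered family vanish by nullity, and the others are
  Euler eigenvalues in degrees 2x + 1 and 2x - 3, x being the length.\<close>

lemma wick_vec_mult_vec_mult:
  assumes ij: "(i, j) \<in> half_edges" and F: "face_family i F" and G: "face_family j G"
    and R: "dx i j R = 0" "dy i j R = 0" "dx j i R = 0" "dy j i R = 0"
    and x: "l $ edge i j \<noteq> 0"
  shows "(\<Sum>a<3. metric_sign a * wick (vec_mult i j a F l * vec_mult j i a G l * R)) =
    ((1 + 1 / (2 * l $ edge i j)) * wick (F (l + axis (edge i j) 1) * G (l + axis (edge i j) 1) * R) +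
     (1 + (- 1) / (2 * l $ edge i j)) * wick (F (l + axis (edge i j) (- 1)) * G (l + axis (edge i j) (- 1)) * R)) / 2"
proof -
  define x where "x = l $ edge i j"
  define f f' g g' where "f = F (l + axis (edge i j) 1)" and "f' = F (l + axis (edge i j) (- 1))"
    and "g = G (l + axis (edge i j) 1)" and "g' = G (l + axis (edge i j) (- 1))"
  have ne: "i \<noteq> j" using ij by (auto simp: half_edges_def)
  have ji: "(j, i) \<in> half_edges" by (rule half_edges_swap[OF ij])
  have zF: "dx j i f = 0" "dy j i f = 0" "dx j i f' = 0" "dy j i f' = 0"
    using F ne by (auto simp: face_family_def f_def f'_def)
  have zG: "dx i j g = 0" "dy i j g = 0" "dx i j g' = 0" "dy i j g' = 0"
    using G ne by (auto simp: face_family_def g_def g'_def)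
  have zv: "dx i j (null_vec a j i) = 0" "dy i j (null_vec a j i) = 0" for a
    using ne by (simp_all add: pdiff_null_vec)
  have homg: "euler j i g = mconst (2 * x + 1) * g" "euler j i g' = mconst (2 * x - 3) * g'"
    using G ji unfolding face_family_def g_def g'_def x_def edge_swap[of j i]
    by (auto simp: edge_swap[of j i] axis_def algebra_simps)
  let ?c = "1 / (2 * x)"
  have vF: "vec_mult i j a F l = mconst ?c * (null_diff a i j f + null_vec a i j * f')" for a
    by (simp add: vec_mult_def f_def f'_def x_def)
  have vG: "vec_mult j i a G l = mconst ?c * (null_diff a j i g + null_vec a j i * g')" for a
    by (simp add: vec_mult_def g_def g'_def x_def edge_swap[of j i])
  have "wick (vec_mult i j a F l * vec_mult j i a G l * R) = ?c * ?c *
      (wick (f * R * (null_vec a j i * null_diff a j i g)) + wick (f * R * g' * (null_vec a j i * null_vec a j i)) +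
       wick (f' * R * null_diff a j i (null_diff a j i g)) + wick (f' * R * null_diff a j i (null_vec a j i * g')))" for a
  proof -
    have "vec_mult i j a F l * vec_mult j i a G l * R = mconst (?c * ?c) *
        (null_diff a i j f * (null_diff a j i g * R) + null_diff a i j f * (null_vec a j i * g' * R) +
         null_vec a i j * (f' * R * null_diff a j i g) + null_vec a i j * (f' * R * (null_vec a j i * g')))"
      unfolding vF vG mconst_mult by (simp only: distrib_left distrib_right mult_ac add_ac)
    moreover have "wick (null_diff a i j f * (null_diff a j i g * R)) = wick (f * R * (null_vec a j i * null_diff a j i g))"
      using zG R by (subst wick_null_diff[OF ij]) (simp_all add: pdiff_mult pdiff_null_diff null_diff_0 ac_simps)
    moreover have "wick (null_diff a i j f * (null_vec a j i * g' * R)) = wick (f * R * g' * (null_vec a j i * null_vec a j i))"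
      using zG R zv by (subst wick_null_diff[OF ij]) (simp_all add: pdiff_mult ac_simps)
    moreover have "dx j i (f' * R) = 0" "dy j i (f' * R) = 0"
      using zF R by (simp_all add: pdiff_mult)
    ultimately show ?thesis
      by (simp only: wick_simps wick_null_vec[OF ij] null_diff_mult_left)
  qed
  then have "(\<Sum>a<3. metric_sign a * wick (vec_mult i j a F l * vec_mult j i a G l * R)) = ?c * ?c *
      (wick (f * R * (\<Sum>a<3. mconst (metric_sign a) * (null_vec a j i * null_diff a j i g))) +
       wick (f * R * g' * (\<Sum>a<3. mconst (metric_sign a) * (null_vec a j i * null_vec a j i))) +
       wick (f' * R * (\<Sum>a<3. mconst (metric_sign a) * null_diff a j i (null_diff a j i g))) +
       wick (f' * R * (\<Sum>a<3. mconst (metric_sign a) * null_diff a j i (null_vec a j i * g'))))"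
    unfolding wick_sum by (simp add: sum_distrib_left sum.distrib distrib_left mult_ac)
  also have "\<dots> = ?c * ?c * (((2 * x + 1) * (2 * x + 1 - 1) / 2) * wick (f * g * R) +
      ((2 * x - 3 + 2) * (2 * x - 3 + 3) / 2) * wick (f' * g' * R))"
  proof -
    have "f * R * (mconst b * g) = mconst b * (f * g * R)" "f' * R * (mconst b * g') = mconst b * (f' * g' * R)" for b
      by (simp_all only: mult_ac)
    then show ?thesis
      unfolding null_vec_null_diff[OF homg(1)] null_vec_null_vec null_diff_null_diff null_diff_null_vec[OF homg(2)]
      by (simp only: wick_simps mult_zero_right) simp
  qed
  also have "\<dots> = ((1 + 1 / (2 * x)) * wick (f * g * R) + (1 + (- 1) / (2 * x)) * wick (f' * g' * R)) / 2"
    using x by (simp add: x_def[symmetric] field_simps)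
  finally show ?thesis unfolding x_def f_def g_def f'_def g'_def .
qed

definition face_pairing :: "(nat \<Rightarrow> real ^ edge \<Rightarrow> spoly) \<Rightarrow> real ^ edge \<Rightarrow> real" where
  "face_pairing \<Psi> l = wick (\<Prod>i\<in>{1..4}. \<Psi> i l)"

definition is_family :: "(nat \<Rightarrow> real ^ edge \<Rightarrow> spoly) \<Rightarrow> bool" where
  "is_family \<Psi> \<longleftrightarrow> (\<forall>i\<in>{1..4}. face_family i (\<Psi> i))"

definition act :: "nat \<Rightarrow> nat \<Rightarrow> nat \<Rightarrow> (nat \<Rightarrow> real ^ edge \<Rightarrow> spoly) \<Rightarrow> nat \<Rightarrow> real ^ edge \<Rightarrow> spoly" where
  "act i j a \<Psi> =
    (if i = j then (let k = (if i = 1 then 2 else 1) in \<Psi>(i := vec_mult i k a (vec_mult i k a (\<Psi> i))))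
     else \<Psi>(i := vec_mult i j a (\<Psi> i), j := vec_mult j i a (\<Psi> j)))"

lemma half_edgesI: "i \<in> {1..4} \<Longrightarrow> j \<in> {1..4} \<Longrightarrow> i \<noteq> j \<Longrightarrow> (i, j) \<in> half_edges"
proof -
  assume "i \<in> {1..4}" "j \<in> {1..4}" "i \<noteq> j"
  moreover from this have "i \<in> {1, 2, 3, 4}" "j \<in> {1, 2, 3, 4}" by auto
  ultimately show ?thesis by (auto simp: half_edges_def)
qed

lemma is_family_act:
  assumes "is_family \<Psi>" "i \<in> {1..4}" "j \<in> {1..4}"
  shows "is_family (act i j a \<Psi>)"
proof -
  have "(i, if i = 1 then 2 else 1) \<in> half_edges" using assms(2) by (intro half_edgesI) auto
  then have "face_family i (vec_mult i k a (vec_mult i k a (\<Psi> i)))" if "k = (if i = 1 then 2 else 1)" for k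
    using assms that by (auto simp: is_family_def intro!: face_family_vec_mult)
  moreover have "face_family i (vec_mult i j a (\<Psi> i))" "face_family j (vec_mult j i a (\<Psi> j))" if "i \<noteq> j"
    using assms that half_edgesI by (auto simp: is_family_def intro!: face_family_vec_mult)
  ultimately show ?thesis
    using assms by (auto simp: is_family_def act_def Let_def)
qed

lemma X_op_face_pairing:
  assumes fam: "is_family \<Psi>" and i: "i \<in> {1..4}" and j: "j \<in> {1..4}" and l: "l \<in> region 1"
  shows "X_op i j (face_pairing \<Psi>) l = (\<Sum>a<3. metric_sign a * face_pairing (act i j a \<Psi>) l)"
proof (cases "i = j")
  case True
  define k :: nat where "k = (if i = 1 then 2 else 1)"
  have ik: "(i, k) \<in> half_edges" using i unfolding k_def by (intro half_edgesI) auto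
  have F: "face_family i (\<Psi> i)" using fam i by (simp add: is_family_def)
  define R where "R = (\<Prod>m\<in>{1..4} - {i}. \<Psi> m l)"
  have R: "(\<Prod>m\<in>{1..4} - {i}. (\<Psi>(i := f)) m l) = R" for f
    unfolding R_def by (rule prod.cong) auto
  have "l $ edge i k > 1" using edge_pos_region[OF l, of "edge i k"] by simp
  then have "\<Psi> i l = (\<Sum>a<3. mconst (metric_sign a) * vec_mult i k a (vec_mult i k a (\<Psi> i)) l)"
    using sum_vec_mult_vec_mult[OF F ik] by simp
  then have "face_pairing \<Psi> l = (\<Sum>a<3. metric_sign a * wick (R * vec_mult i k a (vec_mult i k a (\<Psi> i)) l))"
    unfolding face_pairing_def prod.remove[OF finite_atLeastAtMost i]
    by (simp only: R_def[symmetric] mult.commute[of _ R] wick_sum)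
  also have "\<dots> = (\<Sum>a<3. metric_sign a * face_pairing (act i j a \<Psi>) l)"
    unfolding face_pairing_def prod.remove[OF finite_atLeastAtMost i] act_def Let_def k_def[symmetric]
    using True R by (simp add: mult.commute)
  finally show ?thesis using True by (simp add: X_op_def T_op_def)
next
  case False
  have ij: "(i, j) \<in> half_edges" by (rule half_edgesI[OF i j False])
  define R where "R = (\<Prod>m\<in>{1..4} - {i} - {j}. \<Psi> m l)"
  have split: "(\<Prod>m\<in>{1..4}. f m) = f i * f j * (\<Prod>m\<in>{1..4} - {i} - {j}. f m)" for f :: "nat \<Rightarrow> spoly"
  proof -
    have "j \<in> {1..4} - {i}" "finite ({1..4} - {i})" using j False by auto
    then show ?thesis
      using prod.remove[OF finite_atLeastAtMost i, of f] prod.remove[of "{1..4} - {i}" j f]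
      by (simp only: mult.assoc)
  qed
  have sR: "(\<Prod>m\<in>{1..4} - {i} - {j}. \<Psi> m (l + axis (edge i j) v)) = R" for v
    unfolding R_def
  proof (rule prod.cong[OF refl])
    fix m assume "m \<in> {1..4} - {i} - {j}"
    then have "face_family m (\<Psi> m)" "m \<noteq> i" "m \<noteq> j" using fam by (auto simp: is_family_def)
    then show "\<Psi> m (l + axis (edge i j) v) = \<Psi> m l" using ij by (auto simp: face_family_def)
  qed
  have sh: "face_pairing \<Psi> (l + axis (edge i j) v) = wick (\<Psi> i (l + axis (edge i j) v) * \<Psi> j (l + axis (edge i j) v) * R)" for v
    unfolding face_pairing_def split sR ..
  have aR: "(\<Prod>m\<in>{1..4} - {i} - {j}. (\<Psi>(i := f, j := g)) m l) = R" for f g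
    unfolding R_def by (rule prod.cong) auto
  have act: "act i j a \<Psi> = \<Psi>(i := vec_mult i j a (\<Psi> i), j := vec_mult j i a (\<Psi> j))" for a
    using False by (simp add: act_def)
  have ac: "face_pairing (act i j a \<Psi>) l = wick (vec_mult i j a (\<Psi> i) l * vec_mult j i a (\<Psi> j) l * R)" for a
    unfolding face_pairing_def split act aR using False by simp
  have zR: "pdiff v R = 0" if "v \<in> {(i, j, False), (i, j, True), (j, i, False), (j, i, True)}" for v
  proof -
    have "pdiff v (\<Psi> m l) = 0" if "m \<in> {1..4} - {i} - {j}" for m
    proof -
      have "face_family m (\<Psi> m)" "m \<noteq> i" "m \<noteq> j" using fam that by (auto simp: is_family_def)
      then show ?thesis using \<open>v \<in> _\<close> by (auto simp: face_family_def)
    qed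
    then have "pdiff v (\<Prod>m\<in>A. \<Psi> m l) = 0" if "A \<subseteq> {1..4} - {i} - {j}" for A
      using that by (induction A rule: infinite_finite_induct) (auto simp: pdiff_mult)
    then show ?thesis by (simp add: R_def)
  qed
  have "l $ edge i j \<noteq> 0" using edge_pos_region[OF l, of "edge i j"] by auto
  then show ?thesis
    unfolding ac using False fam i j zR
    by (subst wick_vec_mult_vec_mult[OF ij]) (simp_all add: is_family_def X_op_def T_op_def sh)
qed

section \<open>Vanishing of the determinant\<close>

lemma region_shift:
  assumes l: "l \<in> region (Suc r)" and v: "v \<in> {1, - 1}"
  shows "l + axis e v \<in> region r"
proof -
  have "corner_num (l + axis e v) c \<in> \<nat> \<and> corner_num (l + axis e v) c \<ge> real r" if "c \<in> half_edges" for c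
  proof -
    obtain i j where c: "c = (i, j)" by fastforce
    note h = corners_at[OF that[unfolded c]]
    have H: "(i, j) \<in> half_edges" using that c by simp
    have ne: "edge i (nx i j) \<noteq> edge i (nx i (nx i j))" "edge i (nx i j) \<noteq> edge i j" "edge i (nx i (nx i j)) \<noteq> edge i j"
      using edge_eq_iff[OF h(1) h(2)] edge_eq_iff[OF h(1) H] edge_eq_iff[OF h(2) H] h(4-6) H
      by (auto simp: half_edges_def)
    obtain n where n: "corner_num l c = real n"
    proof -
      have "corner_num l c \<in> \<nat>" using l \<open>c \<in> half_edges\<close> by (simp add: region_def)
      then show thesis using that by (auto elim: Nats_cases)
    qed
    with l \<open>c \<in> half_edges\<close> have "n \<ge> Suc r" by (force simp: region_def)
    have "corner_num (l + axis e v) c \<in> {real n, real n + 1, real n - 1}"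
      using v n ne unfolding c h(10) by (auto simp: axis_def)
    also have "{real n, real n + 1, real n - 1} = {real n, real (Suc n), real (n - 1)}"
      using \<open>n \<ge> Suc r\<close> by (simp add: of_nat_diff add.commute)
    finally show ?thesis using \<open>n \<ge> Suc r\<close> by auto
  qed
  then show ?thesis by (auto simp: region_def)
qed

lemma region_mono: "r \<le> r' \<Longrightarrow> l \<in> region r' \<Longrightarrow> l \<in> region r"
  by (force simp: region_def)

lemma X_op_cong:
  assumes "\<And>l. l \<in> region r \<Longrightarrow> C l = C' l" "l \<in> region (Suc r)"
  shows "X_op i j C l = X_op i j C' l"
  using assms region_shift[OF assms(2)] region_mono[OF _ assms(2), of r] by (simp add: X_op_def T_op_def)

lemma X_op_sum: "X_op i j (\<lambda>l. \<Sum>a\<in>A. c a * f a l) l = (\<Sum>a\<in>A. c a * X_op i j (f a) l)"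
  by (cases "i = j"; induction A rule: infinite_finite_induct)
    (simp_all add: X_op_def T_op_def algebra_simps add_divide_distrib diff_divide_distrib)

lemma X_op_sum_face_pairing:
  assumes C: "\<And>l. l \<in> region (Suc r) \<Longrightarrow> C l = (\<Sum>s\<in>S. c s * face_pairing (\<Psi> s) l)"
    and fam: "\<And>s. s \<in> S \<Longrightarrow> is_family (\<Psi> s)"
    and i: "i \<in> {1..4}" and j: "j \<in> {1..4}" and l: "l \<in> region (Suc (Suc r))"
  shows "X_op i j C l =
    (\<Sum>s\<in>S \<times> {..<3}. (c (fst s) * metric_sign (snd s)) * face_pairing (act i j (snd s) (\<Psi> (fst s))) l)"
proof -
  have "X_op i j C l = X_op i j (\<lambda>l. \<Sum>s\<in>S. c s * face_pairing (\<Psi> s) l) l"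
    by (rule X_op_cong[OF C l])
  also have "\<dots> = (\<Sum>s\<in>S. c s * X_op i j (face_pairing (\<Psi> s)) l)"
    by (rule X_op_sum)
  also have "\<dots> = (\<Sum>s\<in>S. \<Sum>a<3. (c s * metric_sign a) * face_pairing (act i j a (\<Psi> s)) l)"
    using region_mono[OF _ l, of 1]
    by (intro sum.cong refl) (simp add: X_op_face_pairing[OF fam i j] sum_distrib_left mult.assoc)
  finally show ?thesis by (simp add: sum.cartesian_product case_prod_beta')
qed

text \<open>The counterpart of inserting n_i^a n_i^b. The fixed edge is only a representative: on
  \<open>region 2\<close> any two edges of the face give the same value.\<close>

definition pair_vec :: "nat \<Rightarrow> nat \<Rightarrow> nat \<Rightarrow> real ^ edge \<Rightarrow> spoly" where
  "pair_vec i a b = (let k = (if i = 1 then 2 else 1) in vec_mult i k a (vec_mult i k b (face_poly i)))"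

lemma vec_mult_face_poly_shift:
  assumes "(i, j) \<in> half_edges" "(i, k) \<in> half_edges" "(i, m) \<in> half_edges" "l \<in> region 2"
  shows "vec_mult i j a (vec_mult i k b (face_poly i)) l = vec_mult i j a (vec_mult i m b (face_poly i)) l"
proof -
  have "vec_mult i k b (face_poly i) (l + axis e v) = vec_mult i m b (face_poly i) (l + axis e v)" if "v \<in> {1, - 1}" for v e
    using assms that region_shift[of l 1 v e] vec_mult_face_poly_indep[OF assms(2,3)] by (simp add: numeral_2_eq_2)
  then show ?thesis by (simp add: vec_mult_def)
qed

lemma vec_mult_vec_mult_face_poly:
  assumes i: "i \<in> {1..4}" and ij: "(i, j) \<in> half_edges" and ik: "(i, k) \<in> half_edges" and l: "l \<in> region 2"
  shows "vec_mult i j a (vec_mult i k b (face_poly i)) l = pair_vec i a b l"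
    and "pair_vec i a b l = pair_vec i b a l"
proof -
  let ?P = "\<lambda>j k a b. vec_mult i j a (vec_mult i k b (face_poly i)) l"
  have sh: "?P j k a b = ?P j m a b" if "(i, j) \<in> half_edges" "(i, k) \<in> half_edges" "(i, m) \<in> half_edges" for j k m a b
    using vec_mult_face_poly_shift[OF that l] .
  have diag: "?P j j a b = ?P k k b a" if "(i, j) \<in> half_edges" "(i, k) \<in> half_edges" "j \<noteq> k" for j k a b
    using sh[OF that(1,1,2)] vec_mult_commute[OF that] sh[OF that(2,1,2)] by simp
  \<comment> \<open>Passing to another edge swaps the two components. Three edges make an odd number
    of swaps, so returning to the starting edge exchanges a and b.\<close>
  have sym: "?P j j a b = ?P j j b a" if "(i, j) \<in> half_edges" for j a b
  proof -
    note c = corners_at[OF that]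
    show ?thesis
      using diag[OF that c(1,4), of a b] diag[OF c(1,2,5), of b a] diag[OF c(2) that] c(6) by simp
  qed
  have all: "?P j j a b = ?P k k a b" if "(i, j) \<in> half_edges" "(i, k) \<in> half_edges" for j k a b
    using diag[OF that, of a b] sym[OF that(2), of a b] by (cases "j = k") auto
  have p: "(i, if i = 1 then 2 else 1) \<in> half_edges" using i by (intro half_edgesI) auto
  show "?P j k a b = pair_vec i a b l"
    using sh[OF ij ik ij] all[OF ij p] by (simp add: pair_vec_def Let_def)
  show "pair_vec i a b l = pair_vec i b a l"
    using sym[OF p] by (simp add: pair_vec_def Let_def)
qed

text \<open>Composing \<sigma> on the right with the transposition of p and q flips the sign and
  replaces \<open>inv \<sigma>\<close> by its composition with that transposition, to which f is
  blind.\<close>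

lemma sum_sign_permutes_eq_0:
  fixes g :: "('a \<Rightarrow> 'b) \<Rightarrow> real"
  assumes "p \<in> S" "q \<in> S" "p \<noteq> q" "f p = f q" "finite S"
  shows "(\<Sum>\<sigma> | \<sigma> permutes S. of_int (sign \<sigma>) * g (\<lambda>i. f (inv \<sigma> i))) = 0"
proof -
  let ?\<tau> = "Transposition.transpose p q"
  have \<tau>: "?\<tau> permutes S" using assms by (intro permutes_swap_id)
  have f: "f (?\<tau> x) = f x" for x using assms(4) by (auto simp: Transposition.transpose_def)
  have "(\<Sum>\<sigma> | \<sigma> permutes S. of_int (sign \<sigma>) * g (\<lambda>i. f (inv \<sigma> i))) =
      (\<Sum>\<sigma> | \<sigma> permutes S. of_int (sign (\<sigma> \<circ> ?\<tau>)) * g (\<lambda>i. f (inv (\<sigma> \<circ> ?\<tau>) i)))"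
    by (rule sum_permutations_compose_right[OF \<tau>])
  also have "\<dots> = (\<Sum>\<sigma> | \<sigma> permutes S. - (of_int (sign \<sigma>) * g (\<lambda>i. f (inv \<sigma> i))))"
  proof (rule sum.cong[OF refl], clarify)
    fix \<sigma> assume \<sigma>: "\<sigma> permutes S"
    have "sign (\<sigma> \<circ> ?\<tau>) = - sign \<sigma>"
      using sign_compose[OF permutes_imp_permutation[OF assms(5) \<sigma>] permutes_imp_permutation[OF assms(5) \<tau>]]
        sign_swap_id[of p q] assms(3) by simp
    moreover have "inv (\<sigma> \<circ> ?\<tau>) = ?\<tau> \<circ> inv \<sigma>"
      using permutes_bij[OF \<sigma>] permutes_bij[OF \<tau>] by (simp add: o_inv_distrib)
    ultimately show "of_int (sign (\<sigma> \<circ> ?\<tau>)) * g (\<lambda>i. f (inv (\<sigma> \<circ> ?\<tau>) i)) =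
        - (of_int (sign \<sigma>) * g (\<lambda>i. f (inv \<sigma> i)))"
      by (simp add: f)
  qed
  finally show ?thesis by (simp add: sum_negf)
qed


section \<open>Expansion of the determinant over the 24 permutations\<close>

lemma atLeastAtMost_1_4: "{1..4::nat} = {1, 2, 3, 4}"
  by auto

lemma prod_1_4: "(\<Prod>i\<in>{1..4::nat}. f i) = f 1 * (f 2 * (f 3 * f 4))"
  unfolding atLeastAtMost_1_4 by simp

lemma distinct_4_cases:
  fixes a b c d :: nat
  assumes "a \<in> {1, 2, 3, 4}" "b \<in> {1, 2, 3, 4} - {a}" "c \<in> {1, 2, 3, 4} - {a, b}" "d \<in> {1, 2, 3, 4} - {a, b, c}"
  shows "(a, b, c, d) \<in>
    {(1, 2, 3, 4), (1, 2, 4, 3), (1, 3, 2, 4), (1, 3, 4, 2), (1, 4, 2, 3), (1, 4, 3, 2), (2, 1, 3,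
     4), (2, 1, 4, 3), (2, 3, 1, 4), (2, 3, 4, 1), (2, 4, 1, 3), (2, 4, 3, 1), (3, 1, 2, 4), (3, 1,
     4, 2), (3, 2, 1, 4), (3, 2, 4, 1), (3, 4, 1, 2), (3, 4, 2, 1), (4, 1, 2, 3), (4, 1, 3, 2), (4,
     2, 1, 3), (4, 2, 3, 1), (4, 3, 1, 2), (4, 3, 2, 1)}"
proof -
  consider "a = 1" | "a = 2" | "a = 3" | "a = 4" using assms(1) by blast
  then show ?thesis
  proof cases
    case 1
    with assms(2) have "b = 2 \<or> b = 3 \<or> b = 4" by auto
    with 1 assms(3,4) show ?thesis by (elim disjE) auto
  next
    case 2
    with assms(2) have "b = 1 \<or> b = 3 \<or> b = 4" by auto
    with 2 assms(3,4) show ?thesis by (elim disjE) auto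
  next
    case 3
    with assms(2) have "b = 1 \<or> b = 2 \<or> b = 4" by auto
    with 3 assms(3,4) show ?thesis by (elim disjE) auto
  next
    case 4
    with assms(2) have "b = 1 \<or> b = 2 \<or> b = 3" by auto
    with 4 assms(3,4) show ?thesis by (elim disjE) auto
  qed
qed

lemma permutes_4_cases:
  assumes "\<sigma> permutes {1..4::nat}"
  shows "(\<sigma> 1, \<sigma> 2, \<sigma> 3, \<sigma> 4) \<in>
    {(1, 2, 3, 4), (1, 2, 4, 3), (1, 3, 2, 4), (1, 3, 4, 2), (1, 4, 2, 3), (1, 4, 3, 2), (2, 1, 3,
     4), (2, 1, 4, 3), (2, 3, 1, 4), (2, 3, 4, 1), (2, 4, 1, 3), (2, 4, 3, 1), (3, 1, 2, 4), (3, 1,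
     4, 2), (3, 2, 1, 4), (3, 2, 4, 1), (3, 4, 1, 2), (3, 4, 2, 1), (4, 1, 2, 3), (4, 1, 3, 2), (4,
     2, 1, 3), (4, 2, 3, 1), (4, 3, 1, 2), (4, 3, 2, 1)}"
proof (rule distinct_4_cases)
  have i: "\<sigma> i \<in> {1, 2, 3, 4}" if "i \<in> {1..4}" for i
    using permutes_in_image[OF assms, of i] that unfolding atLeastAtMost_1_4 by blast
  have "\<sigma> i = \<sigma> j \<longleftrightarrow> i = j" for i j
    using permutes_inj[OF assms] by (simp add: inj_eq)
  then show "\<sigma> 1 \<in> {1, 2, 3, 4}" "\<sigma> 2 \<in> {1, 2, 3, 4} - {\<sigma> 1}" "\<sigma> 3 \<in> {1, 2, 3, 4} - {\<sigma> 1, \<sigma> 2}"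
    "\<sigma> 4 \<in> {1, 2, 3, 4} - {\<sigma> 1, \<sigma> 2, \<sigma> 3}"
    using i[of 1] i[of 2] i[of 3] i[of 4] by simp_all
qed

text \<open>Every face is touched by exactly two of the factors of a term of the determinant, with the index
  of the row through the edge to \<open>\<sigma> i\<close> and the one of the column through the edge to
  \<open>inv \<sigma> i\<close>.\<close>

lemma face_pairing_act_permutes:
  assumes \<sigma>: "\<sigma> permutes {1..4}" and l: "l \<in> region 2"
  shows "face_pairing (act 1 (\<sigma> 1) (a 1) (act 2 (\<sigma> 2) (a 2) (act 3 (\<sigma> 3) (a 3) (act 4 (\<sigma> 4) (a 4) face_poly)))) l =
    wick (\<Prod>i\<in>{1..4}. pair_vec i (a i) (a (inv \<sigma> i)) l)"
proof -
  have inv: "inv \<sigma> (\<sigma> 1) = 1" "inv \<sigma> (\<sigma> 2) = 2" "inv \<sigma> (\<sigma> 3) = 3" "inv \<sigma> (\<sigma> 4) = 4"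
    using permutes_inverses[OF \<sigma>] by simp_all
  have sym: "pair_vec i a b l = pair_vec i b a l" if "i \<in> {1..4}" for i a b
  proof -
    have "(i, if i = 1 then 2 else 1) \<in> half_edges" using that by (intro half_edgesI) auto
    then show ?thesis using vec_mult_vec_mult_face_poly(2) that l by blast
  qed
  note vm = vec_mult_vec_mult_face_poly(1)[OF _ _ _ l]
  from permutes_4_cases[OF \<sigma>] inv show ?thesis
    unfolding face_pairing_def prod_1_4
    by (elim insertE emptyE; simp add: act_def Let_def vm half_edges_def sym)
qed

text \<open>Row 4 acts first and each further row adds an outer pair, so the index of row 1 sits
  outermost.\<close>

definition row_index :: "(((unit \<times> nat) \<times> nat) \<times> nat) \<times> nat \<Rightarrow> nat \<Rightarrow> nat" where
  "row_index s i = (if i = 1 then snd s else if i = 2 then snd (fst s)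
     else if i = 3 then snd (fst (fst s)) else snd (fst (fst (fst s))))"

text \<open>Each of the four factors costs one level of the region, which leads from 5 down to 1.
  For a fixed choice s of components the signs of the form are the same for all permutations, and
  two of the four rows share one of the three components, so the signed sum over permutations
  cancels.\<close>

lemma op_det4_eq_0:
  assumes C: "\<And>l. l \<in> region 1 \<Longrightarrow> C l = face_pairing face_poly l" and l: "l \<in> region 5"
  shows "op_det4 X_op C l = 0"
proof -
  define S where "S = ((({()} \<times> {..<3::nat}) \<times> {..<3::nat}) \<times> {..<3::nat}) \<times> {..<3::nat}"
  define c where "c s = 1 * metric_sign (snd (fst (fst (fst s)))) * metric_sign (snd (fst (fst s))) *
    metric_sign (snd (fst s)) * metric_sign (snd s)" for s :: "(((unit \<times> nat) \<times> nat) \<times> nat) \<times> nat"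
  have f0: "is_family face_poly" by (simp add: is_family_def face_family_face_poly)
  have "(X_op 1 (\<sigma> 1) \<circ> X_op 2 (\<sigma> 2) \<circ> X_op 3 (\<sigma> 3) \<circ> X_op 4 (\<sigma> 4)) C l =
      (\<Sum>s\<in>S. c s * wick (\<Prod>i\<in>{1..4}. pair_vec i (row_index s i) (row_index s (inv \<sigma> i)) l))"
    if \<sigma>: "\<sigma> permutes {1..4}" for \<sigma>
  proof -
    have \<sigma>i: "\<sigma> i \<in> {1..4}" if "i \<in> {1..4}" for i using permutes_in_image[OF \<sigma>] that by blast
    have i: "1 \<in> {1..4::nat}" "2 \<in> {1..4::nat}" "3 \<in> {1..4::nat}" "4 \<in> {1..4::nat}" by auto
    define \<Psi>4 where "\<Psi>4 s = act 4 (\<sigma> 4) (snd s) face_poly" for s :: "unit \<times> nat"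
    define \<Psi>3 where "\<Psi>3 s = act 3 (\<sigma> 3) (snd s) (\<Psi>4 (fst s))" for s
    define \<Psi>2 where "\<Psi>2 s = act 2 (\<sigma> 2) (snd s) (\<Psi>3 (fst s))" for s
    define \<Psi>1 where "\<Psi>1 s = act 1 (\<sigma> 1) (snd s) (\<Psi>2 (fst s))" for s
    have f4: "is_family (\<Psi>4 s)" for s unfolding \<Psi>4_def by (intro is_family_act f0 i \<sigma>i)
    have f3: "is_family (\<Psi>3 s)" for s unfolding \<Psi>3_def by (intro is_family_act f4 i \<sigma>i)
    have f2: "is_family (\<Psi>2 s)" for s unfolding \<Psi>2_def by (intro is_family_act f3 i \<sigma>i)
    have e4: "X_op 4 (\<sigma> 4) C l = (\<Sum>s\<in>{()} \<times> {..<3}. (1 * metric_sign (snd s)) * face_pairing (\<Psi>4 s) l)"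
      if "l \<in> region 2" for l
      unfolding \<Psi>4_def using that C
      by (intro X_op_sum_face_pairing[where r = 0 and S = "{()}" and c = "\<lambda>_. 1" and \<Psi> = "\<lambda>_. face_poly"] f0 i \<sigma>i)
        (simp_all add: numeral_2_eq_2)
    have e3: "X_op 3 (\<sigma> 3) (X_op 4 (\<sigma> 4) C) l = (\<Sum>s\<in>({()} \<times> {..<3}) \<times> {..<3}.
        (1 * metric_sign (snd (fst s)) * metric_sign (snd s)) * face_pairing (\<Psi>3 s) l)"
      if "l \<in> region 3" for l
      unfolding \<Psi>3_def using that
      by (intro X_op_sum_face_pairing[where r = 1 and c = "\<lambda>s. 1 * metric_sign (snd s)" and \<Psi> = \<Psi>4] e4 f4 i \<sigma>i)
        (simp_all add: numeral_2_eq_2 numeral_3_eq_3)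
    have e2: "X_op 2 (\<sigma> 2) (X_op 3 (\<sigma> 3) (X_op 4 (\<sigma> 4) C)) l = (\<Sum>s\<in>(({()} \<times> {..<3}) \<times> {..<3}) \<times> {..<3}.
        (1 * metric_sign (snd (fst (fst s))) * metric_sign (snd (fst s)) * metric_sign (snd s)) * face_pairing (\<Psi>2 s) l)"
      if "l \<in> region 4" for l
      unfolding \<Psi>2_def using that
      by (intro X_op_sum_face_pairing[where r = 2 and \<Psi> = \<Psi>3
            and c = "\<lambda>s. 1 * metric_sign (snd (fst s)) * metric_sign (snd s)"] e3 f3 i \<sigma>i)
        (simp_all add: eval_nat_numeral)
    have e1: "X_op 1 (\<sigma> 1) (X_op 2 (\<sigma> 2) (X_op 3 (\<sigma> 3) (X_op 4 (\<sigma> 4) C))) l = (\<Sum>s\<in>S. c s * face_pairing (\<Psi>1 s) l)"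
      unfolding \<Psi>1_def S_def c_def using l
      by (intro X_op_sum_face_pairing[where r = 3 and \<Psi> = \<Psi>2
            and c = "\<lambda>s. 1 * metric_sign (snd (fst (fst s))) * metric_sign (snd (fst s)) * metric_sign (snd s)"] e2 f2 i \<sigma>i)
        (simp_all add: eval_nat_numeral)
    have "l \<in> region 2" using region_mono[OF _ l] by simp
    from face_pairing_act_permutes[OF \<sigma> this, of "row_index _"]
    have "face_pairing (\<Psi>1 s) l = wick (\<Prod>i\<in>{1..4}. pair_vec i (row_index s i) (row_index s (inv \<sigma> i)) l)" for s
      by (simp add: \<Psi>1_def \<Psi>2_def \<Psi>3_def \<Psi>4_def row_index_def)
    then show ?thesis using e1 by simp
  qed
  then have "op_det4 X_op C l = (\<Sum>\<sigma> | \<sigma> permutes {1..4}. of_int (sign \<sigma>) *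
      (\<Sum>s\<in>S. c s * wick (\<Prod>i\<in>{1..4}. pair_vec i (row_index s i) (row_index s (inv \<sigma> i)) l)))"
    unfolding op_det4_def by (intro sum.cong) auto
  also have "\<dots> = (\<Sum>s\<in>S. c s * (\<Sum>\<sigma> | \<sigma> permutes {1..4}. of_int (sign \<sigma>) *
      wick (\<Prod>i\<in>{1..4}. pair_vec i (row_index s i) (row_index s (inv \<sigma> i)) l)))"
    unfolding sum_distrib_left by (subst sum.swap) (simp add: mult.left_commute)
  also have "\<dots> = 0"
  proof (intro sum.neutral ballI)
    fix s assume "s \<in> S"
    then have "row_index s ` {1..4} \<subseteq> {..<3}" by (auto simp: S_def row_index_def)
    then have "card (row_index s ` {1..4}) \<le> 3" using card_mono[of "{..<3::nat}"] by fastforce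
    then have "\<not> inj_on (row_index s) {1..4}" by (intro pigeonhole) simp
    then obtain p q where "p \<in> {1..4}" "q \<in> {1..4}" "p \<noteq> q" "row_index s p = row_index s q"
      by (auto simp: inj_on_def)
    from sum_sign_permutes_eq_0[where f = "row_index s", OF this finite_atLeastAtMost, of "\<lambda>u. wick (\<Prod>i\<in>{1..4}. pair_vec i (row_index s i) (u i) l)"]
    show "c s * (\<Sum>\<sigma> | \<sigma> permutes {1..4}. of_int (sign \<sigma>) *
      wick (\<Prod>i\<in>{1..4}. pair_vec i (row_index s i) (row_index s (inv \<sigma> i)) l)) = 0" by simp
  qed
  finally show ?thesis .
qed

lemma face_pairing_face_poly:
  "face_pairing face_poly l =
    face_weight 1 l * face_weight 2 l * face_weight 3 l * face_weight 4 l * wick_count (corner_num l)"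
proof -
  have "(\<Prod>i\<in>{1..4}. face_poly i l) =
      mconst (face_weight 1 l * face_weight 2 l * face_weight 3 l * face_weight 4 l) * corner_prod (corner_num l)"
    unfolding prod_1_4 corner_prod_def half_edges_def
    by (simp add: face_poly_def nx_def Let_def mconst_mult ac_simps)
  then show ?thesis by (simp add: face_pairing_def wick_count_def wick_simps)
qed

section \<open>Admissible lengths far out in the cone\<close>

text \<open>Dropping the 1/2 gives a function homogeneous of degree 1, which can be scaled along the
  cone.\<close>

definition corner_excess :: "nat \<times> nat \<Rightarrow> real ^ edge \<Rightarrow> real" where
  "corner_excess c l = corner_num l c + 1 / 2"

lemma corner_excess_eq:
  "corner_excess (i, j) l = l $ edge i (nx i j) + l $ edge i (nx i (nx i j)) - l $ edge i j"
  by (simp add: corner_excess_def corner_num_def)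

text \<open>The triangle inequality in a face is strict because equality would put one vertex on the
  segment between two others, against affine independence.\<close>

lemma corner_excess_pos:
  assumes "l \<in> tetrahedron_lengths" "c \<in> half_edges"
  shows "corner_excess c l > 0"
proof -
  obtain i j where c: "c = (i, j)" by fastforce
  define k m where "k = nx i j" and "m = nx i k"
  obtain P :: "nat \<Rightarrow> real ^ 3" where inj: "inj_on P {1..4}" and indep: "\<not> affine_dependent (P ` {1..4})"
    and len: "\<And>i j k m. {i, j, k, m} = {1..4} \<Longrightarrow> l $ edge i j = dist (P k) (P m)"
    using assms(1) by (auto simp: tetrahedron_lengths_def)
  have S: "{i, j, k, m} = {1..4}"
    unfolding k_def m_def
    using half_edges_cases[OF assms(2)[unfolded c]] by cases (auto simp: nx_def atLeastAtMost_1_4)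
  then have "{i, k, j, m} = {1..4}" "{i, m, j, k} = {1..4}" by auto
  note d = len[OF S] len[OF this(1)] len[OF this(2)]
  have mem: "j \<in> {1..4}" "k \<in> {1..4}" "m \<in> {1..4}" using S by auto
  have "j \<noteq> k" "j \<noteq> m"
    using corners_at[OF assms(2)[unfolded c]] by (simp_all add: k_def m_def)
  then have ne: "P k \<noteq> P j" "P m \<noteq> P j" using inj_onD[OF inj] mem by metis+
  have "dist (P k) (P m) \<noteq> dist (P k) (P j) + dist (P j) (P m)"
  proof
    assume "dist (P k) (P m) = dist (P k) (P j) + dist (P j) (P m)"
    then have "P j \<in> closed_segment (P k) (P m)"
      by (simp add: between[symmetric] between_mem_segment[symmetric])
    then have "P j \<in> affine hull {P k, P m}"
      using convex_hull_subset_affine_hull by (auto simp: segment_convex_hull)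
    also have "\<dots> \<subseteq> affine hull (P ` {1..4} - {P j})"
      using ne mem by (intro hull_mono) auto
    finally show False using indep mem by (auto simp: affine_dependent_def)
  qed
  with dist_triangle[of "P k" "P m" "P j"] show ?thesis
    unfolding c corner_excess_eq k_def[symmetric] m_def[symmetric] d
    by (simp add: dist_commute)
qed

lemma corner_excess_scaleR: "corner_excess c (t *\<^sub>R x) = t * corner_excess c x"
  by (cases c) (simp add: corner_excess_eq algebra_simps)

lemma continuous_corner_excess: "continuous_on A (corner_excess c)"
  by (cases c) (auto simp: corner_excess_eq[abs_def] intro!: continuous_intros)

lemma triad_diff_Nats:
  assumes "triad a b c"
  shows "b + c - a \<in> \<nat>" "c + a - b \<in> \<nat>" "a + b - c \<in> \<nat>"
proof -
  have "a + b + c \<in> \<int>" "2 * a \<in> \<int>" "2 * b \<in> \<int>" "2 * c \<in> \<int>"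
    using assms Nats_subset_Ints by (auto simp: triad_def)
  from Ints_diff[OF this(1,2)] Ints_diff[OF this(1,3)] Ints_diff[OF this(1,4)]
  show "b + c - a \<in> \<nat>" "c + a - b \<in> \<nat>" "a + b - c \<in> \<nat>"
    using assms by (auto simp: triad_def Nats_altdef2 algebra_simps)
qed

lemma admissible_corner_num:
  assumes "admissible (spins l)" "c \<in> half_edges"
  shows "corner_num l c \<in> \<nat>"
proof -
  have 1: "triad (spins l $ E12) (spins l $ E13) (spins l $ E14)" "triad (spins l $ E12) (spins l $ E23) (spins l $ E24)"
    "triad (spins l $ E13) (spins l $ E23) (spins l $ E34)" "triad (spins l $ E14) (spins l $ E24) (spins l $ E34)"
    using assms(1) by (simp_all add: admissible_def)
  note t = triad_diff_Nats[OF 1(1)] triad_diff_Nats[OF 1(2)] triad_diff_Nats[OF 1(3)] triad_diff_Nats[OF 1(4)]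
  from half_edges_cases[OF assms(2)] show ?thesis
    by cases (use t in \<open>simp_all add: corner_num_def nx_def spins_def algebra_simps\<close>)
qed

text \<open>On the compact K the excesses are bounded below by positive constants and the norms are
  bounded above, so a large norm forces a large scale t and hence large corner numbers.\<close>

lemma cone_region:
  assumes "compact K" "K \<subseteq> tetrahedron_lengths"
  shows "\<exists>b. \<forall>l. norm l \<ge> b \<longrightarrow> l \<in> cone_over K \<longrightarrow> admissible (spins l) \<longrightarrow> l \<in> region r"
proof (cases "K = {}")
  case True
  then show ?thesis by (simp add: cone_over_def)
next
  case False
  have "\<exists>d>0. \<forall>x\<in>K. corner_excess c x \<ge> d" if c: "c \<in> half_edges" for c
  proof -
    obtain x where "x \<in> K" "\<forall>y\<in>K. corner_excess c x \<le> corner_excess c y"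
      using continuous_attains_inf[OF assms(1) False continuous_corner_excess] by blast
    then show ?thesis using corner_excess_pos[OF _ c] assms(2) by blast
  qed
  then obtain d where d: "\<And>c. c \<in> half_edges \<Longrightarrow> d c > 0" "\<And>c x. c \<in> half_edges \<Longrightarrow> x \<in> K \<Longrightarrow> corner_excess c x \<ge> d c"
    by metis
  obtain B where B: "B > 0" "\<And>x. x \<in> K \<Longrightarrow> norm x \<le> B"
    using compact_imp_bounded[OF assms(1)] by (auto simp: bounded_pos)
  \<comment> \<open>A sum of nonnegative terms, used as an upper bound for the threshold of each
    single corner; the extra 1 in \<open>real r + 1\<close> more than covers the 1/2 between excess
    and corner number.\<close>
  define b where "b = (\<Sum>c\<in>half_edges. (real r + 1) * B / d c)"
  have "l \<in> region r" if "norm l \<ge> b" "l \<in> cone_over K" "admissible (spins l)" for l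
  proof -
    obtain t x where l: "l = t *\<^sub>R x" and t: "t > 0" and x: "x \<in> K"
      using \<open>l \<in> cone_over K\<close> by (auto simp: cone_over_def)
    have "corner_num l c \<ge> real r" if c: "c \<in> half_edges" for c
    proof -
      have "(real r + 1) * B / d c \<le> b"
        unfolding b_def using d(1) B(1) by (intro member_le_sum c) (auto intro!: divide_nonneg_pos)
      also have "\<dots> \<le> t * norm x" using \<open>norm l \<ge> b\<close> t l by simp
      also have "\<dots> \<le> t * B" using B(2)[OF x] t by simp
      finally have "(real r + 1) * B \<le> (t * d c) * B"
        using d(1)[OF c] by (simp add: field_simps)
      then have "real r + 1 \<le> t * d c"
        using B(1) by (rule mult_right_le_imp_le)
      also have "\<dots> \<le> t * corner_excess c x" using d(2)[OF c x] t by simp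
      finally show ?thesis
        using corner_excess_scaleR[of c t x] l by (simp add: corner_excess_def)
    qed
    then show ?thesis
      using admissible_corner_num[OF \<open>admissible (spins l)\<close>] by (simp add: region_def)
  qed
  then show ?thesis by blast
qed

theorem mainTheorem3:
  fixes K :: "(real ^ edge) set" and M :: real
  assumes "compact K" and "K \<subseteq> tetrahedron_lengths" and "M > 0"
  shows "op_det4 X_op (\<lambda>l. normalization l * sixj l)
    \<in> O[inf at_infinity (principal {l \<in> cone_over K. admissible (spins l)})](\<lambda>l. norm l powr (- M))"
proof -
  let ?F = "inf at_infinity (principal {l \<in> cone_over K. admissible (spins l)})"
  have zero: "op_det4 X_op (\<lambda>l. normalization l * sixj l) l = 0" if "l \<in> region 5" for l
    using normalization_sixj region_mono[of 0 1] that
    by (intro op_det4_eq_0) (simp_all add: face_pairing_face_poly)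
  obtain b where "\<forall>l. norm l \<ge> b \<longrightarrow> l \<in> cone_over K \<longrightarrow> admissible (spins l) \<longrightarrow> l \<in> region 5"
    using cone_region[OF assms(1,2), of 5] by blast
  with zero have "eventually (\<lambda>l. op_det4 X_op (\<lambda>l. normalization l * sixj l) l = 0) ?F"
    unfolding eventually_inf_principal eventually_at_infinity by blast
  then show ?thesis
    by (simp add: landau_o.big.in_cong[where g = "\<lambda>_. 0"])
qed


end
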